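(* Let $k\ge2$, $p=2k$, and $G(4k)=\langle x,y\mid y^{-1}x^{p}y=x^{p}\rangle$, with generating set $X=\{x,y\}$. Let $\overline{\mathcal C}$ and $\overline{\mathcal D}$ be the sets of words defined in the context. Modulo cyclic permutations, the set $\overline{\mathcal C}$ gives a set of minimal length conjugacy representatives. Modulo split cyclic permutations, the set $\overline{\mathcal D}$ gives a set of minimal length conjugacy representatives. That is: (i) every word in $\overline{\mathcal C}$ is a conjugacy geodesic, and two words of $\overline{\mathcal C}$ represent conjugate elements if and only if they agree up to cyclic permutation (same power of $\Delta$, and the parts preceding the power of $\Delta$ are cyclic permutations of each other); (ii) every word in $\overline{\mathcal D}$ is a conjugacy geodesic, and two words of $\overline{\mathcal D}$ represent conjugate elements if and only if they are equal up to a split cyclic permutation; (iii) every element of $G(4k)$ is conjugate to an element represented by a word in $\overline{\mathcal C}$ or $\overline{\mathcal D}$.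
   Context: Words are over $\{x^{\pm1},y^{\pm1}\}$, and $\Delta=x^{2k}$ (a generator of the centre; powers of $\Delta$ are collected at the right). A word is a conjugacy geodesic if its length equals the minimal word length among all elements of the conjugacy class of the element it represents. - Type 1: words $(x^{\mu_1}y^{\epsilon_1}\cdots x^{\mu_n}y^{\epsilon_n}\Delta^c)^{\pm1}$ with $c,n\ge1$, $\mu_1\in[0,2k-1]\cap\mathbb Z$, $\mu_i\in[1,2k-1]\cap\mathbb Z$ for $2\le i\le n$, $\epsilon_i\in\mathbb Z$, $\epsilon_i\neq0$ for $1\le i\le n-1$. - Type 2: words $v^{\pm1}$, where for some $j$ with $k\le j\le 2k-1$, some $\tau_1\ge1$, $\tau_2\ge0$ and $\tau=\tau_1+\tau_2$, $v=A_1x^{d_1}A_2x^{d_2}\cdots A_\tau x^{d_\tau}A_{\tau+1}$ with $(x^{d_1},\dots,x^{d_\tau})$ equal to $\tau_1$ entries $x^{j}$ followed by $\tau_2$ entries $x^{-(2k-j)}$; the $A_s$ are reduced words over $x,y$ in which every maximal subword $x^\alpha$ has $\alpha\in[-2k+j+1,j-1]\cap\mathbb Z_{\neq0}$; $A_1$ is empty or ends with a nonzero power of $y$, $A_{\tau+1}$ is empty or starts with a nonzero power of $y$, and $A_s$ starts and ends with a nonzero power of $y$ for $2\le s\le\tau$. Type 2a is the case $\tau_2=0$ and Type 2b is the case $\tau_2\ge1$. - Type 3: words $x^{\alpha}y^{\epsilon_1}x^{\nu_1}\cdots x^{\nu_n}$ with $n\ge0$, $\epsilon_i\in\mathbb Z_{\neq0}$,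 $\alpha,\nu_n\in[-(k-1),k-1]\cap\mathbb Z$, and $\nu_i\in[-(k-1),k-1]\cap\mathbb Z_{\neq0}$ for $1\le i\le n-1$. $\mathcal C_1,\mathcal C_2,\mathcal C_3$ are the sets of Type 1, Type 2a and Type 3 words, $\mathcal C=\mathcal C_1\sqcup\mathcal C_2\sqcup\mathcal C_3$, and $\mathcal D$ is the set of Type 2b words. $\overline{\mathcal C}$ is the set of words in $\mathcal C$ which, written as $x^{\alpha_1}y^{\beta_1}\cdots x^{\alpha_n}y^{\beta_n}\Delta^c$ (only $\alpha_1$ and $\beta_n$ being allowed to vanish, $c=0$ for $\mathcal C_2,\mathcal C_3$), satisfy $\alpha_1=0\Leftrightarrow\beta_n=0$. $\overline{\mathcal D}$ is the set of words in $\mathcal D$, in the block form above, which start and end with opposite factors (one with an $x$-term, the other with a $y$-term). Split cyclic permutation of $w=A_1x^{d_1}A_2\cdots A_\tau x^{d_\tau}A_{\tau+1}$ in $\overline{\mathcal D}$: a geodesic in $\mathcal D$ in which the tuple $(x^{d_1},\dots,x^{d_\tau})$ is preserved and the blocks $A_s$ are cyclically permuted, of one of these forms. Case 1 (all blocks preserved): for some $1\le t\le\tau+1$, $w'=x^{d_1}A_tx^{d_2}A_{t+1}\cdots x^{d_{\tau-t+2}}A_{\tau+1}A_1x^{d_{\tau-t+3}}A_2\cdots x^{d_\tau}A_{t-1}$. Case 2 (one block is split): for some $1\le t\le\tau+1$, with $A_t=A_{t_1}A_{t_2}$ a reduced product of prefix and suffix, $w'=A_{t_2}x^{d_1}A_{t+1}x^{d_2}\cdots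 x^{d_{\tau-t+1}}A_{\tau+1}A_1x^{d_{\tau-t+2}}A_2\cdots x^{d_\tau}A_{t_1}$. For inverses of block-form words the same definition is applied to the inverse words.
   Formalization: The condition α₁=0⇔βₙ=0 defining C̄ is imposed only for n≥2, since for n=1 it would exclude the powers of x and of y and make (iii) false (e.g. for x); in Case 1 of split cyclic permutations t=1 is omitted, as d_{τ+1} does not exist. *)

theory Defs
  imports "HOL-Algebra.Group"
begin

section \<open>Words and group presentations\<close>

text \<open>A letter is a generator together with a flag which is \<open>True\<close> for the formal inverse.\<close>

type_synonym 'a gword = "('a \<times> bool) list"

definition winv :: "'a gword \<Rightarrow> 'a gword" where
  "winv w = rev (map (\<lambda>(a, b). (a, \<not> b)) w)"

definition pw :: "'a \<Rightarrow> int \<Rightarrow> 'a gword" where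
  "pw a n = replicate (nat \<bar>n\<bar>) (a, n < 0)"

inductive pres_eq :: "'a gword set \<Rightarrow> 'a gword \<Rightarrow> 'a gword \<Rightarrow> bool" for R where
  refl: "pres_eq R w w"
| sym: "pres_eq R v w \<Longrightarrow> pres_eq R w v"
| trans: "pres_eq R u v \<Longrightarrow> pres_eq R v w \<Longrightarrow> pres_eq R u w"
| cancel: "pres_eq R (u @ [(a, b), (a, \<not> b)] @ v) (u @ v)"
| relator: "r \<in> R \<Longrightarrow> pres_eq R (u @ r @ v) (u @ v)"

definition pres_rel :: "'a gword set \<Rightarrow> 'a gword rel" where
  "pres_rel R = {(u, v). pres_eq R u v}"

definition presented_group :: "'a gword set \<Rightarrow> 'a gword set monoid" where
  "presented_group R =
    \<lparr>carrier = UNIV // pres_rel R,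
     mult = (\<lambda>A B. \<Union>a\<in>A. \<Union>b\<in>B. pres_rel R `` {a @ b}),
     one = pres_rel R `` {[]}\<rparr>"

lemma equiv_pres_rel: "equiv UNIV (pres_rel R)"
proof (rule equivI)
  show "refl_on UNIV (pres_rel R)"
    by (simp add: refl_on_def pres_rel_def pres_eq.refl)
  show "sym (pres_rel R)"
    by (rule symI) (simp add: pres_rel_def pres_eq.sym)
  show "trans (pres_rel R)"
    by (rule transI) (simp add: pres_rel_def, rule pres_eq.trans)
qed simp

lemma pres_eq_append_left: "pres_eq R u v \<Longrightarrow> pres_eq R (w @ u) (w @ v)"
proof (induction rule: pres_eq.induct)
  case (cancel u a b v)
  show ?case using pres_eq.cancel[of R "w @ u" a b v] by simp
next
  case (relator r u v)
  then show ?case using pres_eq.relator[of r R "w @ u" v] by simp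
next
  case (refl w')
  show ?case by (rule pres_eq.refl)
next
  case (sym v u)
  from sym.IH show ?case by (rule pres_eq.sym)
next
  case (trans u v v')
  from trans.IH show ?case by (rule pres_eq.trans)
qed

lemma pres_eq_append_right: "pres_eq R u v \<Longrightarrow> pres_eq R (u @ w) (v @ w)"
proof (induction rule: pres_eq.induct)
  case (cancel u a b v)
  show ?case using pres_eq.cancel[of R u a b "v @ w"] by simp
next
  case (relator r u v)
  then show ?case using pres_eq.relator[of r R u "v @ w"] by simp
next
  case (refl w')
  show ?case by (rule pres_eq.refl)
next
  case (sym v u)
  from sym.IH show ?case by (rule pres_eq.sym)
next
  case (trans u v v')
  from trans.IH show ?case by (rule pres_eq.trans)
qed

lemma pres_eq_append: "pres_eq R u u' \<Longrightarrow> pres_eq R v v' \<Longrightarrow> pres_eq R (u @ v) (u' @ v')"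
  by (rule pres_eq.trans[OF pres_eq_append_right pres_eq_append_left])

lemma pres_eq_winv: "pres_eq R (winv w @ w) []"
proof (induction w)
  case Nil
  show ?case by (simp add: winv_def pres_eq.refl)
next
  case (Cons l w)
  obtain a b where l: "l = (a, b)" by (cases l)
  have "winv (l # w) @ l # w = winv w @ [(a, \<not> b), (a, \<not> \<not> b)] @ w"
    by (simp add: winv_def l)
  then have "pres_eq R (winv (l # w) @ l # w) (winv w @ w)"
    by (simp only: pres_eq.cancel)
  then show ?case using Cons.IH by (rule pres_eq.trans)
qed

lemma mult_presented_group:
  "pres_rel R `` {u} \<otimes>\<^bsub>presented_group R\<^esub> pres_rel R `` {v} = pres_rel R `` {u @ v}"
proof -
  have "pres_rel R `` {a @ b} = pres_rel R `` {u @ v}"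
    if "a \<in> pres_rel R `` {u}" "b \<in> pres_rel R `` {v}" for a b
  proof (rule equiv_class_eq[OF equiv_pres_rel])
    show "(a @ b, u @ v) \<in> pres_rel R"
      using that by (simp add: pres_rel_def pres_eq.sym[OF pres_eq_append])
  qed
  moreover have "u \<in> pres_rel R `` {u}" "v \<in> pres_rel R `` {v}"
    by (simp_all add: pres_rel_def pres_eq.refl)
  ultimately show ?thesis unfolding presented_group_def monoid.simps by blast
qed

lemma group_presented_group: "group (presented_group R)"
proof -
  have car: "carrier (presented_group R) = range (\<lambda>w. pres_rel R `` {w})"
    by (auto simp: presented_group_def quotient_def)
  have one: "\<one>\<^bsub>presented_group R\<^esub> = pres_rel R `` {[]}"
    by (simp add: presented_group_def)
  have "pres_rel R `` {winv w} \<otimes>\<^bsub>presented_group R\<^esub> pres_rel R `` {w} = \<one>\<^bsub>presented_group R\<^esub>" for w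
    unfolding mult_presented_group one
    by (rule equiv_class_eq[OF equiv_pres_rel]) (simp add: pres_rel_def pres_eq_winv)
  then show ?thesis
    by (intro groupI) (auto simp: car mult_presented_group one, blast)
qed


section \<open>The group and conjugacy geodesics\<close>

datatype gen = X | Y

type_synonym xyword = "gen gword"

text \<open>\<open>G4 k\<close> is the group $G(4k)$ with the relation $y^{-1} x^{2k} y = x^{2k}$;
  \<open>elt k w\<close> is the element represented by the word \<open>w\<close>.\<close>

definition relators :: "nat \<Rightarrow> xyword set" where
  "relators k = {pw Y (-1) @ pw X (2 * int k) @ pw Y 1 @ winv (pw X (2 * int k))}"

definition G4 :: "nat \<Rightarrow> xyword set monoid" where
  "G4 k = presented_group (relators k)"

definition elt :: "nat \<Rightarrow> xyword \<Rightarrow> xyword set" where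
  "elt k w = pres_rel (relators k) `` {w}"

lemma group_G4: "group (G4 k)"
  unfolding G4_def by (rule group_presented_group)

lemma carrier_G4: "carrier (G4 k) = range (elt k)"
  by (auto simp: G4_def elt_def presented_group_def quotient_def)

lemma mult_elt: "elt k u \<otimes>\<^bsub>G4 k\<^esub> elt k v = elt k (u @ v)"
  unfolding G4_def elt_def by (rule mult_presented_group)

lemma one_elt: "\<one>\<^bsub>G4 k\<^esub> = elt k []"
  by (simp add: G4_def elt_def presented_group_def)

definition conjugate_in :: "('g, 'm) monoid_scheme \<Rightarrow> 'g \<Rightarrow> 'g \<Rightarrow> bool" where
  "conjugate_in G a b \<longleftrightarrow> (\<exists>g\<in>carrier G. b = g \<otimes>\<^bsub>G\<^esub> a \<otimes>\<^bsub>G\<^esub> inv\<^bsub>G\<^esub> g)"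

definition word_length :: "nat \<Rightarrow> xyword set \<Rightarrow> nat" where
  "word_length k g = (LEAST n. \<exists>w. elt k w = g \<and> length w = n)"

definition geodesic :: "nat \<Rightarrow> xyword \<Rightarrow> bool" where
  "geodesic k w \<longleftrightarrow> length w = word_length k (elt k w)"

definition conj_geodesic :: "nat \<Rightarrow> xyword \<Rightarrow> bool" where
  "conj_geodesic k w \<longleftrightarrow>
    length w = (LEAST n. \<exists>h\<in>carrier (G4 k). conjugate_in (G4 k) (elt k w) h \<and> word_length k h = n)"


section \<open>Words of Types 1, 2 and 3\<close>

text \<open>The list \<open>[(\<alpha>\<^sub>1, \<beta>\<^sub>1), \<dots>, (\<alpha>\<^sub>n, \<beta>\<^sub>n)]\<close> stands for
  \<open>x\<^bsup>\<alpha>\<^sub>1\<^esup> y\<^bsup>\<beta>\<^sub>1\<^esup> \<dots> x\<^bsup>\<alpha>\<^sub>n\<^esup> y\<^bsup>\<beta>\<^sub>n\<^esup>\<close>. In \<open>block_form\<close> only \<open>\<alpha>\<^sub>1\<close> and \<open>\<beta>\<^sub>n\<close> may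
  vanish; every reduced word has exactly one block form, that of the empty word being
  \<open>[(0, 0)]\<close>.\<close>

definition bword :: "(int \<times> int) list \<Rightarrow> xyword" where
  "bword bs = concat (map (\<lambda>(\<alpha>, \<beta>). pw X \<alpha> @ pw Y \<beta>) bs)"

definition block_form :: "(int \<times> int) list \<Rightarrow> bool" where
  "block_form bs \<longleftrightarrow> bs \<noteq> [] \<and>
    (\<forall>i<length bs. 0 < i \<longrightarrow> fst (bs ! i) \<noteq> 0) \<and>
    (\<forall>i<length bs. Suc i < length bs \<longrightarrow> snd (bs ! i) \<noteq> 0)"

text \<open>A pair \<open>(w, c)\<close> stands for the word \<open>w \<Delta>\<^sup>c\<close> with \<open>\<Delta> = x\<^bsup>2k\<^esup>\<close>. As powers of \<open>\<Delta>\<close> are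
  collected at the right, its inverse is \<open>w\<^sup>-\<^sup>1 \<Delta>\<^bsup>-c\<^esup>\<close>.\<close>

type_synonym dword = "xyword \<times> int"

definition expand :: "nat \<Rightarrow> dword \<Rightarrow> xyword" where
  "expand k u = fst u @ pw X (2 * int k * snd u)"

definition dinv :: "dword \<Rightarrow> dword" where
  "dinv u = (winv (fst u), - snd u)"

definition type1_pos :: "nat \<Rightarrow> dword set" where
  "type1_pos k = {(bword bs, c) | bs c. c \<ge> 1 \<and> block_form bs \<and>
     (\<forall>(\<mu>, \<epsilon>)\<in>set bs. 0 \<le> \<mu> \<and> \<mu> \<le> 2 * int k - 1)}"

definition type1 :: "nat \<Rightarrow> dword set" where
  "type1 k = type1_pos k \<union> dinv ` type1_pos k"

definition x_bounded :: "int \<Rightarrow> int \<Rightarrow> xyword \<Rightarrow> bool" where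
  "x_bounded lo hi w \<longleftrightarrow>
    (\<exists>bs. block_form bs \<and> w = bword bs \<and> (\<forall>(\<alpha>, \<beta>)\<in>set bs. \<alpha> \<noteq> 0 \<longrightarrow> lo \<le> \<alpha> \<and> \<alpha> \<le> hi))"

definition type2_blocks :: "nat \<Rightarrow> int \<Rightarrow> nat \<Rightarrow> nat \<Rightarrow> (nat \<Rightarrow> xyword) \<Rightarrow> bool" where
  "type2_blocks k j \<tau>1 \<tau>2 A \<longleftrightarrow>
    int k \<le> j \<and> j \<le> 2 * int k - 1 \<and> \<tau>1 \<ge> 1 \<and>
    (\<forall>s\<in>{1..\<tau>1 + \<tau>2 + 1}. x_bounded (- 2 * int k + j + 1) (j - 1) (A s)) \<and>
    (A 1 = [] \<or> fst (last (A 1)) = Y) \<and>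
    (A (\<tau>1 + \<tau>2 + 1) = [] \<or> fst (hd (A (\<tau>1 + \<tau>2 + 1))) = Y) \<and>
    (\<forall>s\<in>{2..\<tau>1 + \<tau>2}. A s \<noteq> [] \<and> fst (hd (A s)) = Y \<and> fst (last (A s)) = Y)"

text \<open>The power \<open>x\<^bsup>d\<^sub>i\<^esup>\<close>, for \<open>1 \<le> i \<le> \<tau>\<close>.\<close>

definition xd :: "nat \<Rightarrow> int \<Rightarrow> nat \<Rightarrow> nat \<Rightarrow> xyword" where
  "xd k j \<tau>1 i = pw X (if i \<le> \<tau>1 then j else - (2 * int k - j))"

definition type2_word :: "nat \<Rightarrow> int \<Rightarrow> nat \<Rightarrow> nat \<Rightarrow> (nat \<Rightarrow> xyword) \<Rightarrow> xyword" where
  "type2_word k j \<tau>1 \<tau>2 A =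
    concat (map (\<lambda>i. A i @ xd k j \<tau>1 i) [1..<\<tau>1 + \<tau>2 + 1]) @ A (\<tau>1 + \<tau>2 + 1)"

definition type2a_pos :: "nat \<Rightarrow> xyword set" where
  "type2a_pos k = {type2_word k j \<tau>1 0 A | j \<tau>1 A. type2_blocks k j \<tau>1 0 A}"

definition type2a :: "nat \<Rightarrow> xyword set" where
  "type2a k = type2a_pos k \<union> winv ` type2a_pos k"

definition type2b_pos :: "nat \<Rightarrow> xyword set" where
  "type2b_pos k = {type2_word k j \<tau>1 \<tau>2 A | j \<tau>1 \<tau>2 A. \<tau>2 \<ge> 1 \<and> type2_blocks k j \<tau>1 \<tau>2 A}"

definition type2b :: "nat \<Rightarrow> xyword set" where
  "type2b k = type2b_pos k \<union> winv ` type2b_pos k"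

definition type3 :: "nat \<Rightarrow> xyword set" where
  "type3 k = {pw X \<alpha> @ concat (map (\<lambda>(\<epsilon>, \<nu>). pw Y \<epsilon> @ pw X \<nu>) es) | \<alpha> es.
     \<bar>\<alpha>\<bar> \<le> int k - 1 \<and>
     (\<forall>(\<epsilon>, \<nu>)\<in>set es. \<epsilon> \<noteq> 0 \<and> \<bar>\<nu>\<bar> \<le> int k - 1) \<and>
     (\<forall>i<length es. Suc i < length es \<longrightarrow> snd (es ! i) \<noteq> 0)}"


section \<open>The sets of representatives\<close>

definition setC :: "nat \<Rightarrow> dword set" where
  "setC k = type1 k \<union> (\<lambda>w. (w, 0)) ` type2a k \<union> (\<lambda>w. (w, 0)) ` type3 k"

abbreviation setD :: "nat \<Rightarrow> xyword set" where
  "setD k \<equiv> type2b k"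

text \<open>The condition \<open>\<alpha>\<^sub>1 = 0 \<longleftrightarrow> \<beta>\<^sub>n = 0\<close> is imposed for \<open>n \<ge> 2\<close> only. It says that the first and
  last syllables lie in different factors, and is void for a word with a single pair: imposed there,
  it would discard the nontrivial powers of \<open>x\<close> and of \<open>y\<close>, whose conjugacy classes would
  then have no representative.\<close>

definition Cbar :: "nat \<Rightarrow> dword set" where
  "Cbar k = {u \<in> setC k. \<exists>bs. block_form bs \<and> fst u = bword bs \<and>
     (length bs \<ge> 2 \<longrightarrow> (fst (hd bs) = 0 \<longleftrightarrow> snd (last bs) = 0))}"

definition Dbar :: "nat \<Rightarrow> xyword set" where
  "Dbar k = {w \<in> setD k. fst (hd w) \<noteq> fst (last w)}"

definition cyclic_perm :: "dword \<Rightarrow> dword \<Rightarrow> bool" where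
  "cyclic_perm u v \<longleftrightarrow> snd u = snd v \<and> (\<exists>n. fst v = rotate n (fst u))"

text \<open>All blocks preserved. The value \<open>t = 1\<close> is omitted, since the formula would then
  involve the nonexistent exponent \<open>d\<^bsub>\<tau>+1\<^esub>\<close>.\<close>

definition split_case1 ::
  "nat \<Rightarrow> int \<Rightarrow> nat \<Rightarrow> nat \<Rightarrow> (nat \<Rightarrow> xyword) \<Rightarrow> xyword \<Rightarrow> bool" where
  "split_case1 k j \<tau>1 \<tau>2 A w' \<longleftrightarrow> (let \<tau> = \<tau>1 + \<tau>2; x = xd k j \<tau>1 in
    \<exists>t\<in>{2..\<tau> + 1}.
      w' = concat (map (\<lambda>s. x (s + 1 - t) @ A s) [t..<\<tau> + 2]) @ A 1
         @ concat (map (\<lambda>s. x (\<tau> + 1 + s - t) @ A s) [2..<t]))"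

text \<open>The block \<open>A t = P @ Q\<close> is split; \<open>P\<close> or \<open>Q\<close> may be empty. The update \<open>A(t := P)\<close>
  makes \<open>P\<close> the final block, also in the boundary case \<open>t = 1\<close>.\<close>

definition split_case2 ::
  "nat \<Rightarrow> int \<Rightarrow> nat \<Rightarrow> nat \<Rightarrow> (nat \<Rightarrow> xyword) \<Rightarrow> xyword \<Rightarrow> bool" where
  "split_case2 k j \<tau>1 \<tau>2 A w' \<longleftrightarrow> (let \<tau> = \<tau>1 + \<tau>2; x = xd k j \<tau>1 in
    \<exists>t\<in>{1..\<tau> + 1}. \<exists>P Q. A t = P @ Q \<and>
      w' = Q @ concat (map (\<lambda>s. x (s - t) @ A s) [t + 1..<\<tau> + 2]) @ (A(t := P)) 1
         @ concat (map (\<lambda>s. x (\<tau> + s - t) @ (A(t := P)) s) [2..<t + 1]))"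

definition split_cyclic_pos :: "nat \<Rightarrow> xyword \<Rightarrow> xyword \<Rightarrow> bool" where
  "split_cyclic_pos k w w' \<longleftrightarrow> w' \<in> setD k \<and> geodesic k w' \<and>
    (\<exists>j \<tau>1 \<tau>2 A. \<tau>2 \<ge> 1 \<and> type2_blocks k j \<tau>1 \<tau>2 A \<and> w = type2_word k j \<tau>1 \<tau>2 A \<and>
      (split_case1 k j \<tau>1 \<tau>2 A w' \<or> split_case2 k j \<tau>1 \<tau>2 A w'))"

definition split_cyclic_perm :: "nat \<Rightarrow> xyword \<Rightarrow> xyword \<Rightarrow> bool" where
  "split_cyclic_perm k w w' \<longleftrightarrow>
    split_cyclic_pos k w w' \<or> split_cyclic_pos k (winv w) (winv w')"

end

theory Submission
  imports Defs
begin

text \<open>The centre is generated by \<open>\<Delta> = x\<^bsup>2k\<^esup>\<close>, the quotient by it is the free product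
  \<open>\<int>/2k * \<int>\<close>, and the exponent sum of \<open>x\<close> is injective on it. Hence two elements are conjugate
  iff their exponent sums in \<open>x\<close> agree and their images in the free product are conjugate, i.e. have
  the same cyclic normal form up to rotation. A conjugacy class thus prescribes the \<open>y\<close>-syllables,
  the residues modulo \<open>2k\<close> of the \<open>x\<close>-exponents and the sum of these exponents, and the shortest words
  are those that distribute the sum over the residues with the smallest sum of absolute values.
  When all exponents, up to full twists of their common sign which are collected in \<open>\<Delta>\<^sup>c\<close>, fit into a
  window of \<open>2k\<close> consecutive integers, this distribution is unique, which is the case of \<open>\<C>\<close>.
  Otherwise the extreme exponents \<open>j\<close> and \<open>j - 2k\<close> both occur; they are the
  same residue, only the number of each is determined, and listing the former first gives \<open>\<D>\<close>, where
  a cyclic permutation has to leave this list of extreme exponents in place.\<close>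

text \<open>No lower bound for word length is proved directly. Every word is reduced, without
  growing, to a conjugate representative, and conjugate representatives turn out to have equal
  length; minimality follows from these two facts. The obstacle in the uniqueness part is the
  unknown conjugator. Words act on the normal forms of the free product (van der Waerden's
  argument), which makes the normal form an invariant of the element modulo the centre. If
  \<open>h\<close> conjugates \<open>z\<close> to \<open>z'\<close>, it also conjugates their
  powers, and in a high power it disturbs only a bounded number of syllables at the ends; the two
  periodic patterns overlap, and one period is a rotation of the other. The exponents are recovered
  from their residues by an order argument: of two windows of \<open>2k\<close> integers one lies
  lower, so one list of exponents is entrywise at most the other, and equal sums leave no room for a
  difference.\<close>

lemma winv_Nil [simp]: "winv [] = []"
  by (simp add: winv_def)

lemma winv_append [simp]: "winv (u @ v) = winv v @ winv u"
  by (simp add: winv_def)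

lemma winv_winv [simp]: "winv (winv w) = w"
  by (induction w) (auto simp: winv_def rev_map)

lemma winv_pw [simp]: "winv (pw g n) = pw g (- n)"
  by (cases "n = 0") (auto simp: winv_def pw_def)

lemma length_pw [simp]: "length (pw g n) = nat \<bar>n\<bar>"
  by (simp add: pw_def)

lemma pw_0 [simp]: "pw g 0 = []"
  by (simp add: pw_def)

lemma pw_eq_Nil_iff [simp]: "pw g n = [] \<longleftrightarrow> n = 0"
  by (auto simp: pw_def)

lemma pw_add_same_sign:
  assumes "0 \<le> m * n"
  shows "pw g m @ pw g n = pw g (m + n)"
proof (cases "m = 0 \<or> n = 0")
  case False
  then have "(m < 0) = (n < 0)" using assms by (auto simp: zero_le_mult_iff)
  moreover have "nat \<bar>m + n\<bar> = nat \<bar>m\<bar> + nat \<bar>n\<bar>" "(m + n < 0) = (m < 0)"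
    using False assms by (auto simp: zero_le_mult_iff)
  ultimately show ?thesis by (simp add: pw_def replicate_add)
qed auto

lemma fst_hd_pw [simp]: "n \<noteq> 0 \<Longrightarrow> fst (hd (pw g n)) = g"
  by (simp add: pw_def)

lemma fst_last_pw [simp]: "n \<noteq> 0 \<Longrightarrow> fst (last (pw g n)) = g"
  by (simp add: pw_def)

lemma pw_Cons_neg: "pw g (- 1 - int n) = (g, True) # pw g (- int n)"
proof -
  have "nat \<bar>- 1 - int n\<bar> = Suc n" by simp
  then have "pw g (- 1 - int n) = replicate (Suc n) (g, True)" by (simp only: pw_def) simp
  then show ?thesis by (simp add: pw_def)
qed

definition letter_exp :: "gen \<times> bool \<Rightarrow> int" where
  "letter_exp l = (if snd l then -1 else 1)"

definition expsum :: "gen \<Rightarrow> xyword \<Rightarrow> int" where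
  "expsum g w = sum_list (map (\<lambda>l. if fst l = g then letter_exp l else 0) w)"

lemma expsum_Nil [simp]: "expsum g [] = 0"
  by (simp add: expsum_def)

lemma expsum_append [simp]: "expsum g (u @ v) = expsum g u + expsum g v"
  by (simp add: expsum_def)

lemma expsum_winv [simp]: "expsum g (winv w) = - expsum g w"
  by (induction w) (auto simp: expsum_def winv_def letter_exp_def)

lemma expsum_pw [simp]: "expsum g (pw h n) = (if g = h then n else 0)"
  by (auto simp: expsum_def pw_def map_replicate sum_list_replicate letter_exp_def)

abbreviation group_eq :: "nat \<Rightarrow> xyword \<Rightarrow> xyword \<Rightarrow> bool" where
  "group_eq k \<equiv> pres_eq (relators k)"

declare pres_eq.trans [trans]

text \<open>Cancelling pairs and the relator have exponent sum 0 in either generator.\<close>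

lemma expsum_group_eq: "group_eq k u v \<Longrightarrow> expsum g u = expsum g v"
proof (induction rule: pres_eq.induct)
  case (cancel u a b v)
  have "expsum g [(a, b), (a, \<not> b)] = 0" by (simp add: expsum_def letter_exp_def)
  then show ?case by (simp only: expsum_append)
next
  case (relator r u v)
  then show ?case by (simp add: relators_def)
qed simp_all

lemma elt_eq_iff: "elt k u = elt k v \<longleftrightarrow> group_eq k u v"
  unfolding elt_def by (subst eq_equiv_class_iff[OF equiv_pres_rel UNIV_I UNIV_I]) (simp add: pres_rel_def)

lemma group_eq_reverse_winv: "group_eq k (w @ winv w) []"
  using pres_eq_winv[of "relators k" "winv w"] by simp

text \<open>No rule of \<open>pres_eq\<close> inverts a relator, so there is no induction over the
  relation. Instead, in the group, \<open>winv u\<close> equals \<open>winv u @ v @ winv v\<close>,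
  where \<open>v\<close> may be replaced by \<open>u\<close>.\<close>

lemma group_eq_winv:
  assumes "group_eq k u v"
  shows "group_eq k (winv u) (winv v)"
proof -
  have "elt k (winv u) = elt k (winv u @ v @ winv v)"
    unfolding elt_eq_iff using pres_eq_append_left[OF group_eq_reverse_winv, of k "winv u" v]
    by (simp add: pres_eq.sym)
  also have "\<dots> = elt k (winv u @ u @ winv v)"
    unfolding elt_eq_iff by (intro pres_eq_append_left pres_eq_append_right pres_eq.sym[OF assms])
  also have "\<dots> = elt k (winv v)"
    unfolding elt_eq_iff using pres_eq_append_right[OF pres_eq_winv, of "relators k" u "winv v"] by simp
  finally show ?thesis by (simp add: elt_eq_iff)
qed

lemma inv_elt: "inv\<^bsub>G4 k\<^esub> (elt k w) = elt k (winv w)"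
  by (rule group.inv_equality[OF group_G4])
    (auto simp: mult_elt one_elt carrier_G4 elt_eq_iff pres_eq_winv)

lemma conjugate_elt_iff:
  "conjugate_in (G4 k) (elt k u) (elt k v) \<longleftrightarrow> (\<exists>g. group_eq k v (g @ u @ winv g))"
  by (auto simp: conjugate_in_def carrier_G4 mult_elt inv_elt elt_eq_iff)

lemma elt_cong_append: "elt k u = elt k u' \<Longrightarrow> elt k v = elt k v' \<Longrightarrow> elt k (u @ v) = elt k (u' @ v')"
  by (simp add: elt_eq_iff pres_eq_append)

lemma elt_cong_middle: "elt k v = elt k v' \<Longrightarrow> elt k (u @ v @ w) = elt k (u @ v' @ w)"
  unfolding elt_eq_iff by (intro pres_eq_append_left pres_eq_append_right)

abbreviation words_commute :: "nat \<Rightarrow> xyword \<Rightarrow> xyword \<Rightarrow> bool" where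
  "words_commute k u v \<equiv> group_eq k (u @ v) (v @ u)"

lemma commute_winv_right:
  assumes "words_commute k u v"
  shows "words_commute k u (winv v)"
proof -
  have "elt k ([] @ (u @ winv v)) = elt k ((winv v @ v) @ (u @ winv v))"
    by (intro elt_cong_append) (simp_all add: elt_eq_iff pres_eq.sym[OF pres_eq_winv])
  also have "\<dots> = elt k (winv v @ (v @ u) @ winv v)" by simp
  also have "\<dots> = elt k (winv v @ (u @ v) @ winv v)"
    by (rule elt_cong_middle) (simp add: elt_eq_iff pres_eq.sym[OF assms])
  also have "\<dots> = elt k ((winv v @ u) @ (v @ winv v))" by simp
  also have "\<dots> = elt k ((winv v @ u) @ [])"
    by (intro elt_cong_append) (simp_all add: elt_eq_iff group_eq_reverse_winv)
  finally show ?thesis by (simp add: elt_eq_iff)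
qed

text \<open>Only opposite signs need the group. A positive power before a negative one cancels at
  the junction, letter by letter; the other order is reduced to this one by commutation.\<close>

lemma group_eq_pw_add: "group_eq k (pw g m @ pw g n) (pw g (m + n))"
proof -
  have drop1: "group_eq k (pw g (int (Suc i)) @ pw g (- int (Suc j))) (pw g (int i) @ pw g (- int j))" for i j
  proof -
    have "pw g (int (Suc i)) @ pw g (- int (Suc j)) =
        pw g (int i) @ [(g, False), (g, \<not> False)] @ pw g (- int j)"
      using pw_Cons_neg[of g j] pw_add_same_sign[of "int i" 1 g]
      by (simp add: pw_def)
    then show ?thesis by (simp only: pres_eq.cancel)
  qed
  have pos_neg: "group_eq k (pw g (int i) @ pw g (- int j)) (pw g (int i - int j))" for i j
  proof (induction i arbitrary: j)
    case 0
    show ?case by (simp add: pres_eq.refl)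
  next
    case (Suc i)
    show ?case
    proof (cases j)
      case 0
      then show ?thesis by (simp add: pres_eq.refl)
    next
      case [simp]: (Suc j')
      show ?thesis using pres_eq.trans[OF drop1 Suc.IH[of j'], of] by simp
    qed
  qed
  consider "0 \<le> m * n" | "0 < m" "n < 0" | "m < 0" "0 < n"
    by (cases "0 \<le> m * n") (auto simp: not_le mult_less_0_iff)
  then show ?thesis
  proof cases
    case 1
    then show ?thesis by (simp add: pw_add_same_sign pres_eq.refl)
  next
    case 2
    then show ?thesis using pos_neg[of "nat m" "nat (- n)"] by simp
  next
    case 3
    \<comment> \<open>Here \<open>n\<close> and \<open>- m\<close> are both positive, so these
      powers commute already as words; inverting the second one gives commutation with
      \<open>pw g m\<close>.\<close>
    have "words_commute k (pw g n) (pw g (- m))"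
      using 3 pw_add_same_sign[of n "- m" g] pw_add_same_sign[of "- m" n g]
      by (simp add: mult_nonpos_nonneg mult_nonneg_nonpos pres_eq.refl)
    then have "words_commute k (pw g n) (winv (pw g (- m)))" by (rule commute_winv_right)
    moreover have "group_eq k (pw g n @ pw g m) (pw g (n + m))"
      using 3 pos_neg[of "nat n" "nat (- m)"] by simp
    ultimately show ?thesis
      unfolding winv_pw minus_minus add.commute[of n] by (rule pres_eq.trans[OF pres_eq.sym])
  qed
qed

section \<open>The centre\<close>

definition full_twist :: "nat \<Rightarrow> int \<Rightarrow> xyword" where
  "full_twist k c = pw X (2 * int k * c)"

lemma full_twist_0 [simp]: "full_twist k 0 = []"
  by (simp add: full_twist_def)

lemma length_full_twist [simp]: "length (full_twist k c) = 2 * k * nat \<bar>c\<bar>"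
  by (simp add: full_twist_def abs_mult nat_mult_distrib)

lemma winv_full_twist [simp]: "winv (full_twist k c) = full_twist k (- c)"
  by (simp add: full_twist_def)

lemma expsum_full_twist [simp]: "expsum g (full_twist k c) = (if g = X then 2 * int k * c else 0)"
  by (simp add: full_twist_def)

lemma expand_eq: "expand k (w, c) = w @ full_twist k c"
  by (simp add: expand_def full_twist_def)

lemma group_eq_full_twist_add: "group_eq k (full_twist k c @ full_twist k d) (full_twist k (c + d))"
  unfolding full_twist_def by (simp add: distrib_left group_eq_pw_add)

lemma commute_append_left:
  assumes "words_commute k u w" "words_commute k v w"
  shows "words_commute k (u @ v) w"
proof -
  have "group_eq k (u @ v @ w) (u @ w @ v)" by (rule pres_eq_append_left[OF assms(2)])
  moreover have "group_eq k ((u @ w) @ v) ((w @ u) @ v)" by (rule pres_eq_append_right[OF assms(1)])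
  ultimately show ?thesis by (simp add: pres_eq.trans)
qed

text \<open>The relator says precisely that \<Delta> commutes with \<open>y\<close>, and \<Delta> is
  a power of \<open>x\<close>. \<open>commute_winv_right\<close> adds the inverse of
  \<open>y\<close> and the negative powers of \<Delta>; products inherit commutation.\<close>

lemma full_twist_central: "words_commute k w (full_twist k c)"
proof -
  have nat_central: "words_commute k [(g, b)] (full_twist k 1)" for g b
  proof -
    have X: "words_commute k (pw X n) (full_twist k 1)" for n
      unfolding full_twist_def
      using pres_eq.trans[OF group_eq_pw_add[of k X n "2 * int k"]
          pres_eq.sym[OF group_eq_pw_add[of k X "2 * int k" n, unfolded add.commute[of "2 * int k"]]]]
      by simp
    \<comment> \<open>The word is read in two ways: deleting the relator leaves \<open>y\<close>
      followed by \<Delta>, cancelling freely leaves \<Delta> followed by \<open>y\<close>.\<close>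
    have "group_eq k (pw Y 1 @ (pw Y (- 1) @ full_twist k 1 @ pw Y 1 @ winv (full_twist k 1)) @ full_twist k 1)
        (pw Y 1 @ full_twist k 1)"
      by (rule pres_eq.relator) (simp add: relators_def full_twist_def)
    moreover have "elt k (pw Y 1 @ (pw Y (- 1) @ full_twist k 1 @ pw Y 1 @ winv (full_twist k 1)) @ full_twist k 1)
        = elt k (full_twist k 1 @ pw Y 1)"
    proof -
      have "elt k ((pw Y 1 @ winv (pw Y 1)) @ (full_twist k 1 @ pw Y 1) @ (winv (full_twist k 1) @ full_twist k 1))
        = elt k ([] @ (full_twist k 1 @ pw Y 1) @ [])"
        by (intro elt_cong_append) (simp_all add: elt_eq_iff pres_eq_winv group_eq_reverse_winv pres_eq.refl
            del: winv_pw winv_full_twist)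
      then show ?thesis by simp
    qed
    ultimately have Y1: "words_commute k (pw Y 1) (full_twist k 1)"
      by (metis elt_eq_iff)
    then have "words_commute k (full_twist k 1) (winv (pw Y 1))"
      by (intro commute_winv_right) (rule pres_eq.sym)
    then have "words_commute k (pw Y (- 1)) (full_twist k 1)" by (simp add: pres_eq.sym)
    then have "words_commute k (pw g (if b then - 1 else 1)) (full_twist k 1)"
      using X Y1 by (cases g) simp_all
    then show ?thesis by (simp add: pw_def split: if_splits)
  qed
  have one: "words_commute k w (full_twist k 1)" for w
  proof (induction w)
    case Nil
    show ?case by (simp add: pres_eq.refl)
  next
    case (Cons l w)
    then show ?case using commute_append_left[of k "[l]" "full_twist k 1" w] nat_central
      by (cases l) simp
  qed
  have pos: "words_commute k w (full_twist k (int n))" for n w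
  proof (induction n)
    case 0
    show ?case by (simp add: pres_eq.refl)
  next
    case (Suc n)
    have "words_commute k (full_twist k (int n) @ full_twist k 1) w"
      by (intro commute_append_left pres_eq.sym[OF Suc] pres_eq.sym[OF one])
    moreover have "full_twist k (int n) @ full_twist k 1 = full_twist k (int (Suc n))"
      unfolding full_twist_def by (subst pw_add_same_sign) (simp_all add: algebra_simps)
    ultimately show ?case by (simp add: pres_eq.sym)
  qed
  show ?thesis
  proof (cases "c \<ge> 0")
    case True
    then show ?thesis using pos[of w "nat c"] by simp
  next
    case False
    then show ?thesis using commute_winv_right[OF pos[of w "nat (- c)"]] by simp
  qed
qed

text \<open>Conjugacy in the quotient by the centre, written without inverses: \<open>g\<close>
  conjugates \<open>u\<close> to \<open>v\<close> up to a central error.\<close>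

definition modconj :: "nat \<Rightarrow> xyword \<Rightarrow> xyword \<Rightarrow> bool" where
  "modconj k u v \<longleftrightarrow> (\<exists>g c. group_eq k (g @ u) (v @ g @ full_twist k c))"

lemma modconj_group_eq: "group_eq k u v \<Longrightarrow> modconj k u v"
  unfolding modconj_def by (rule exI[of _ "[]"], rule exI[of _ 0]) simp

lemma modconj_refl [simp]: "modconj k w w"
  by (simp add: modconj_group_eq pres_eq.refl)

lemma modconj_trans [trans]:
  assumes "modconj k u v" "modconj k v w"
  shows "modconj k u w"
proof -
  obtain g c h d where 1: "group_eq k (g @ u) (v @ g @ full_twist k c)"
    and 2: "group_eq k (h @ v) (w @ h @ full_twist k d)"
    using assms unfolding modconj_def by blast
  have "elt k ((h @ g) @ u) = elt k (h @ v @ g @ full_twist k c)"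
    by (simp add: elt_eq_iff pres_eq_append_left[OF 1])
  also have "\<dots> = elt k (w @ h @ full_twist k d @ g @ full_twist k c)"
    using pres_eq_append_right[OF 2, of "g @ full_twist k c"] by (simp add: elt_eq_iff)
  also have "\<dots> = elt k (w @ h @ g @ full_twist k d @ full_twist k c)"
    using pres_eq_append_left[OF pres_eq_append_right[OF pres_eq.sym[OF full_twist_central]], of k "w @ h" d g "full_twist k c"]
    by (simp add: elt_eq_iff)
  also have "\<dots> = elt k (w @ (h @ g) @ full_twist k (d + c))"
    using pres_eq_append_left[OF group_eq_full_twist_add[of k d c], of "w @ h @ g"]
    by (simp add: elt_eq_iff)
  finally show ?thesis unfolding modconj_def elt_eq_iff by blast
qed

lemma modconj_sym:
  assumes "modconj k u v"
  shows "modconj k v u"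
proof -
  obtain g c where 1: "group_eq k (g @ u) (v @ g @ full_twist k c)"
    using assms unfolding modconj_def by blast
  have "elt k (winv g @ v) = elt k (winv g @ (v @ g @ full_twist k c) @ full_twist k (- c) @ winv g)"
  proof -
    have "elt k ((winv g @ v) @ g @ ((full_twist k c @ full_twist k (- c)) @ winv g))
        = elt k ((winv g @ v) @ g @ ([] @ winv g))"
      using group_eq_full_twist_add[of k c "- c"]
      by (intro elt_cong_append) (simp_all add: elt_eq_iff)
    also have "\<dots> = elt k ((winv g @ v) @ [])"
      by (intro elt_cong_append) (simp_all add: elt_eq_iff group_eq_reverse_winv)
    finally show ?thesis by simp
  qed
  also have "\<dots> = elt k (winv g @ (g @ u) @ full_twist k (- c) @ winv g)"
    by (rule elt_cong_middle) (simp add: elt_eq_iff 1 pres_eq.sym)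
  also have "\<dots> = elt k ((winv g @ g) @ u @ (full_twist k (- c) @ winv g))" by simp
  also have "\<dots> = elt k ([] @ u @ (winv g @ full_twist k (- c)))"
    by (intro elt_cong_append[OF _ elt_cong_append[OF HOL.refl]])
      (simp_all add: elt_eq_iff pres_eq_winv pres_eq.sym[OF full_twist_central])
  finally show ?thesis unfolding modconj_def elt_eq_iff append_Nil by blast
qed

lemma modconj_full_twist: "modconj k (w @ full_twist k c) w"
  unfolding modconj_def by (rule exI[of _ "[]"], rule exI[of _ c]) (simp add: pres_eq.refl)

lemma modconj_append_commute: "modconj k (u @ v) (v @ u)"
  unfolding modconj_def by (rule exI[of _ "v"], rule exI[of _ 0]) (simp add: pres_eq.refl)

lemma modconj_rotate: "modconj k w (rotate n w)"
  using modconj_append_commute[of k "take (n mod length w) w" "drop (n mod length w) w"]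
  by (simp add: rotate_drop_take)

lemma modconj_twist_inside: "modconj k (u @ full_twist k c @ v) (u @ v)"
proof -
  have "group_eq k (u @ full_twist k c @ v) (u @ v @ full_twist k c)"
    by (intro pres_eq_append_left pres_eq.sym[OF full_twist_central])
  then show ?thesis
    using modconj_trans[OF modconj_group_eq modconj_full_twist] by (metis append.assoc)
qed

text \<open>The difference is a power of \<Delta>, which moves to the end of the word and is
  absorbed by the centre. This turns \<open>x\<close>-exponents into residues modulo
  \<open>2k\<close>.\<close>

lemma modconj_shift: "modconj k (u @ pw X a @ v) (u @ pw X (a + 2 * int k * c) @ v)"
proof -
  have "elt k (u @ pw X a @ v) = elt k (u @ (full_twist k (- c) @ pw X (a + 2 * int k * c)) @ v)"
    using group_eq_pw_add[of k X "2 * int k * (- c)" "a + 2 * int k * c"]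
    by (intro elt_cong_append) (simp_all add: elt_eq_iff full_twist_def pres_eq.sym)
  then show ?thesis
    using modconj_trans[OF modconj_group_eq modconj_twist_inside] by (simp add: elt_eq_iff)
qed

lemma modconj_expsum_Y: "modconj k u v \<Longrightarrow> expsum Y u = expsum Y v"
  unfolding modconj_def by (auto dest!: expsum_group_eq[where g = Y])

lemma modconj_expsum_X: "modconj k u v \<Longrightarrow> expsum X u mod (2 * int k) = expsum X v mod (2 * int k)"
  unfolding modconj_def by (auto dest!: expsum_group_eq[where g = X])

text \<open>The contribution of \<open>g\<close> to the \<open>x\<close>-exponent sum cancels in the
  equation defining \<open>modconj\<close>, so equal sums for \<open>u\<close> and \<open>v\<close>
  leave \<open>2k * c = 0\<close>, and the central error vanishes.\<close>

lemma conjugate_iff_modconj: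
  assumes "k > 0"
  shows "conjugate_in (G4 k) (elt k u) (elt k v) \<longleftrightarrow> modconj k u v \<and> expsum X u = expsum X v"
proof (intro iffI conjI)
  assume "conjugate_in (G4 k) (elt k u) (elt k v)"
  then obtain g where g: "group_eq k v (g @ u @ winv g)" by (auto simp: conjugate_elt_iff)
  have "elt k (g @ u) = elt k ((g @ u) @ (winv g @ g))"
    using pres_eq_append_left[OF pres_eq_winv[of _ g], of "relators k" "g @ u"]
    by (simp add: elt_eq_iff pres_eq.sym)
  also have "\<dots> = elt k ((g @ u @ winv g) @ g)" by simp
  also have "\<dots> = elt k (v @ g)"
    by (intro elt_cong_append) (simp_all add: elt_eq_iff g pres_eq.sym)
  finally have "group_eq k (g @ u) (v @ g @ full_twist k 0)" by (simp add: elt_eq_iff)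
  then show "modconj k u v" unfolding modconj_def by blast
  show "expsum X u = expsum X v" using expsum_group_eq[OF g, of X] by simp
next
  assume *: "modconj k u v \<and> expsum X u = expsum X v"
  then obtain g c where g: "group_eq k (g @ u) (v @ g @ full_twist k c)"
    unfolding modconj_def by blast
  have "c = 0" using expsum_group_eq[OF g, of X] * assms by simp
  have "elt k ((g @ u) @ winv g) = elt k ((v @ g) @ winv g)"
    using g \<open>c = 0\<close> by (intro elt_cong_append[OF _ HOL.refl]) (simp add: elt_eq_iff)
  also have "\<dots> = elt k (v @ [])"
    unfolding append.assoc by (intro elt_cong_append) (simp_all add: elt_eq_iff group_eq_reverse_winv)
  finally have "group_eq k v (g @ u @ winv g)" by (simp add: elt_eq_iff pres_eq.sym)
  then show "conjugate_in (G4 k) (elt k u) (elt k v)" by (auto simp: conjugate_elt_iff)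
qed

lemma conjugate_winv:
  assumes "conjugate_in (G4 k) (elt k u) (elt k v)"
  shows "conjugate_in (G4 k) (elt k (winv u)) (elt k (winv v))"
proof -
  obtain g where "group_eq k v (g @ u @ winv g)" using assms by (auto simp: conjugate_elt_iff)
  then have "group_eq k (winv v) (g @ winv u @ winv g)"
    using group_eq_winv by fastforce
  then show ?thesis by (auto simp: conjugate_elt_iff)
qed

section \<open>Normal forms in the quotient by the centre\<close>

type_synonym syll = "gen \<times> int"

text \<open>Since \<open>n mod 0 = n\<close>, the value 0 for \<open>Y\<close> makes reduction
  trivial in the infinite factor, and both factors share all lemmas.\<close>

definition period :: "nat \<Rightarrow> gen \<Rightarrow> int" where
  "period k g = (case g of X \<Rightarrow> 2 * int k | Y \<Rightarrow> 0)"

lemma period_simps [simp]: "period k X = 2 * int k" "period k Y = 0"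
  by (simp_all add: period_def)

abbreviation alternating :: "syll list \<Rightarrow> bool" where
  "alternating \<equiv> successively (\<lambda>s t. fst s \<noteq> fst t)"

definition nform :: "nat \<Rightarrow> syll list \<Rightarrow> bool" where
  "nform k z \<longleftrightarrow> alternating z \<and> (\<forall>(g, n)\<in>set z. n \<noteq> 0 \<and> n mod period k g = n)"

definition ncons :: "nat \<Rightarrow> gen \<Rightarrow> int \<Rightarrow> syll list \<Rightarrow> syll list" where
  "ncons k g n z = (if n mod period k g = 0 then z else (g, n mod period k g) # z)"

text \<open>Left multiplication of a normal form by a power of a generator in the free product;
  folding it over a word is van der Waerden's action.\<close>

fun push :: "nat \<Rightarrow> syll \<Rightarrow> syll list \<Rightarrow> syll list" where
  "push k (g, n) [] = ncons k g n []"
| "push k (g, n) ((h, m) # z) = (if g = h then ncons k g (n + m) z else ncons k g n ((h, m) # z))"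

abbreviation pushes :: "nat \<Rightarrow> syll list \<Rightarrow> syll list \<Rightarrow> syll list" where
  "pushes k \<equiv> foldr (push k)"

lemma nform_Nil [simp]: "nform k []"
  by (simp add: nform_def)

lemma nform_Cons:
  "nform k ((g, n) # z) \<longleftrightarrow> n \<noteq> 0 \<and> n mod period k g = n \<and> nform k z \<and> (z = [] \<or> fst (hd z) \<noteq> g)"
  by (auto simp: nform_def successively_Cons)

lemma nform_append:
  "nform k (u @ v) \<longleftrightarrow> nform k u \<and> nform k v \<and> (u = [] \<or> v = [] \<or> fst (last u) \<noteq> fst (hd v))"
  by (auto simp: nform_def successively_append_iff)

lemma nform_push: "nform k z \<Longrightarrow> nform k (push k s z)"
  by (cases "(k, s, z)" rule: push.cases) (auto simp: ncons_def nform_Cons)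

lemma nform_pushes: "nform k z \<Longrightarrow> nform k (pushes k ss z)"
  by (induction ss) (auto simp: nform_push)

lemma ncons_cong: "m mod period k g = n mod period k g \<Longrightarrow> ncons k g m z = ncons k g n z"
  by (simp add: ncons_def)

lemma push_mod [simp]: "push k (g, n mod period k g) z = push k (g, n) z"
  by (cases "(k, (g, n), z)" rule: push.cases) (auto intro: ncons_cong simp: mod_add_left_eq)

lemma push_period: "nform k z \<Longrightarrow> n mod period k g = 0 \<Longrightarrow> push k (g, n) z = z"
proof (cases "(k, (g, n), z)" rule: push.cases)
  case (2 k' g' n' h m z')
  assume "nform k z" "n mod period k g = 0"
  moreover from this have "(n + m) mod period k g = m mod period k g"
    by (metis add.left_neutral mod_add_left_eq)
  ultimately show ?thesis using 2 by (auto simp: ncons_def nform_Cons)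
qed (auto simp: ncons_def)

lemma push_ncons:
  assumes "nform k z" "z = [] \<or> fst (hd z) \<noteq> g"
  shows "push k (g, m) (ncons k g n z) = push k (g, m + n) z"
proof (cases "n mod period k g = 0")
  case True
  then have "(m + n) mod period k g = m mod period k g"
    by (metis add.right_neutral mod_add_right_eq)
  then have "push k (g, m + n) z = push k (g, m) z"
    by (metis push_mod)
  then show ?thesis using True by (simp add: ncons_def)
next
  case False
  have "push k (g, m) (ncons k g n z) = ncons k g (m + n) z"
    using False by (simp add: ncons_def mod_add_right_eq)
  also have "\<dots> = push k (g, m + n) z"
    using assms(2) by (cases "(k, (g, m + n), z)" rule: push.cases) auto
  finally show ?thesis .
qed

text \<open>The powers of one generator act as a group. Together with \<open>push_period\<close>
  this makes the relator and cancelling pairs act trivially.\<close>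

lemma push_push:
  assumes "nform k z"
  shows "push k (g, m) (push k (g, n) z) = push k (g, m + n) z"
proof (cases "(k, (g, n), z)" rule: push.cases)
  case (1 k' g' n')
  then show ?thesis using push_ncons[of k "[]" g m n] by simp
next
  case (2 k' g' n' h a z')
  show ?thesis
  proof (cases "g = h")
    case True
    then have "nform k z'" "z' = [] \<or> fst (hd z') \<noteq> g" using assms 2 by (auto simp: nform_Cons)
    moreover from this have "push k (g, m + (n + a)) z' = ncons k g (m + (n + a)) z'"
      by (cases "(k, (g, m + (n + a)), z')" rule: push.cases) auto
    ultimately show ?thesis using push_ncons[of k z' g m "n + a"] True 2 by (simp add: add.assoc)
  next
    case False
    then show ?thesis using push_ncons[of k z g m n] assms 2 by simp
  qed
qed

section \<open>The action of words on normal forms\<close>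

definition act :: "nat \<Rightarrow> xyword \<Rightarrow> syll list \<Rightarrow> syll list" where
  "act k w = pushes k (map (\<lambda>l. (fst l, letter_exp l)) w)"

lemma act_Nil [simp]: "act k [] z = z"
  by (simp add: act_def)

lemma act_append [simp]: "act k (u @ v) z = act k u (act k v z)"
  by (simp add: act_def)

lemma nform_act: "nform k z \<Longrightarrow> nform k (act k w z)"
  by (simp add: act_def nform_pushes)

lemma act_replicate:
  "nform k z \<Longrightarrow> act k (replicate n l) z = push k (fst l, int n * letter_exp l) z"
proof (induction n)
  case 0
  then show ?case by (simp add: push_period)
next
  case (Suc n)
  have "act k (replicate (Suc n) l) z = push k (fst l, letter_exp l) (act k (replicate n l) z)"
    by (simp add: act_def)
  then show ?case using Suc by (simp add: push_push algebra_simps)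
qed

lemma act_pw: "nform k z \<Longrightarrow> act k (pw g n) z = push k (g, n) z"
  by (auto simp: pw_def act_replicate letter_exp_def)

text \<open>A cancelling pair acts as a push by exponent 0. In the relator both powers of \<Delta>
  act trivially, which leaves the inverse of \<open>y\<close> times \<open>y\<close>.\<close>

lemma act_group_eq: "group_eq k u v \<Longrightarrow> nform k z \<Longrightarrow> act k u z = act k v z"
proof (induction arbitrary: z rule: pres_eq.induct)
  case (cancel u a b v)
  have "act k [(a, b), (a, \<not> b)] z' = z'" if "nform k z'" for z'
    using that by (auto simp: act_def push_push letter_exp_def push_period)
  then show ?case using nform_act[OF cancel] by (metis act_append)
next
  case (relator r u v)
  have "act k r z' = z'" if "nform k z'" for z'
    using that relator by (simp add: relators_def act_pw nform_push push_push push_period)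
  then show ?case using nform_act[OF relator(2)] by simp
qed simp_all

lemma act_full_twist [simp]: "nform k z \<Longrightarrow> act k (full_twist k c) z = z"
  by (simp add: full_twist_def act_pw push_period)

lemma pushes_ncons:
  assumes "nform k (pushes k h z)"
  shows "pushes k (ncons k g n h) z = push k (g, n) (pushes k h z)"
  using assms by (simp add: ncons_def push_period)

lemma push_pushes:
  assumes "nform k z"
  shows "pushes k (push k s h) z = push k s (pushes k h z)"
proof (cases "(k, s, h)" rule: push.cases)
  case (1 k' g n)
  then show ?thesis using assms by (simp add: pushes_ncons)
next
  case (2 k' g n h' m z')
  then show ?thesis using assms
    by (simp add: pushes_ncons nform_pushes nform_push push_push)
qed

text \<open>Acting by a word is multiplication by the normal form \<open>act k w []\<close> of its
  element, so a conjugator, given as an arbitrary word, becomes a normal form of fixed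
  length.\<close>

lemma act_pushes: "nform k z \<Longrightarrow> act k w z = pushes k (act k w []) z"
proof (induction w)
  case (Cons l w)
  then show ?case by (simp add: act_def push_pushes)
qed simp

lemma push_nform_Cons: "nform k (s # z) \<Longrightarrow> push k s z = s # z"
  by (cases "(k, s, z)" rule: push.cases) (auto simp: nform_Cons ncons_def)

lemma pushes_nform_append: "nform k (u @ z) \<Longrightarrow> pushes k u z = u @ z"
proof (induction u)
  case (Cons s u)
  then have "nform k (u @ z)" by (cases s) (simp add: nform_Cons)
  then show ?case using Cons push_nform_Cons by simp
qed simp

text \<open>At the junction of two normal forms syllables cancel in pairs, until one side is
  exhausted, two different factors meet, or two syllables of one factor merge into a single new one,
  which is \<open>m\<close>. What counts is the shape: if one of the two lists is fixed, all but a
  bounded part of the other survives.\<close>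

lemma pushes_decomp:
  assumes "nform k u" "nform k h"
  shows "\<exists>i m. i \<le> length u \<and> i \<le> length h \<and> length m \<le> 1 \<and>
    pushes k u h = take (length u - i) u @ m @ drop i h"
  using assms
proof (induction h arbitrary: u)
  case Nil
  then show ?case
    by (intro exI[of _ 0] exI[of _ "[]"]) (use pushes_nform_append[of k u "[]"] in auto)
next
  case (Cons s h)
  show ?case
  proof (cases "u = [] \<or> fst (last u) \<noteq> fst s")
    case True
    then have "nform k (u @ s # h)" using Cons.prems by (auto simp: nform_append)
    then show ?thesis
      by (intro exI[of _ 0] exI[of _ "[]"]) (use pushes_nform_append[of k u "s # h"] in auto)
  next
    case False
    then obtain u' g a b where u: "u = u' @ [(g, a)]" and s: "s = (g, b)"
      by (cases u rule: rev_exhaust) (auto, metis prod.collapse)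
    have h: "nform k h" "h = [] \<or> fst (hd h) \<noteq> g" using Cons.prems s by (auto simp: nform_Cons)
    have u': "nform k u'" "u' = [] \<or> fst (last u') \<noteq> g" using Cons.prems u by (auto simp: nform_append)
    have *: "pushes k u (s # h) = pushes k u' (ncons k g (a + b) h)"
      by (simp add: u s)
    show ?thesis
    proof (cases "(a + b) mod period k g = 0")
      case True
      obtain i m where "i \<le> length u'" "i \<le> length h" "length m \<le> 1"
        "pushes k u' h = take (length u' - i) u' @ m @ drop i h"
        using Cons.IH[OF u'(1) h(1)] by blast
      then show ?thesis using True
        by (intro exI[of _ "Suc i"] exI[of _ m]) (simp only: * ncons_def, simp add: u)
    next
      case False
      let ?c = "(a + b) mod period k g"
      have "nform k (u' @ [(g, ?c)] @ h)"
        using u' h False by (auto simp: nform_append nform_Cons)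
      then have "pushes k u' ((g, ?c) # h) = u' @ (g, ?c) # h"
        using pushes_nform_append by fastforce
      then show ?thesis using False
        by (intro exI[of _ 1] exI[of _ "[(g, ?c)]"]) (simp only: * ncons_def, simp add: u)
    qed
  qed
qed

section \<open>Conjugacy in the free product of cyclic groups\<close>

definition wd :: "syll list \<Rightarrow> xyword" where
  "wd ss = concat (map (\<lambda>(g, n). pw g n) ss)"

lemma wd_simps [simp]: "wd [] = []" "wd ((g, n) # ss) = pw g n @ wd ss" "wd (ss @ ts) = wd ss @ wd ts"
  by (simp_all add: wd_def)

definition cyc :: "syll list \<Rightarrow> bool" where
  "cyc ss \<longleftrightarrow> length ss \<le> 1 \<or> fst (hd ss) \<noteq> fst (last ss)"

definition red :: "nat \<Rightarrow> syll \<Rightarrow> syll" where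
  "red k s = (fst s, snd s mod period k (fst s))"

lemma fst_red [simp]: "fst (red k s) = fst s"
  by (simp add: red_def)

lemma red_Pair [simp]: "red k (g, n) = (g, n mod period k g)"
  by (simp add: red_def)

lemma act_wd: "nform k z \<Longrightarrow> act k (wd ss) z = pushes k ss z"
proof (induction ss)
  case (Cons s ss)
  then show ?case by (cases s) (simp add: act_pw nform_pushes)
qed simp

lemma group_eq_wd_red: "\<exists>c. group_eq k (wd ss) (wd (map (red k) ss) @ full_twist k c)"
proof (induction ss)
  case Nil
  show ?case by (rule exI[of _ 0]) (simp add: pres_eq.refl)
next
  case (Cons s ss)
  obtain g n where s: "s = (g, n)" by (cases s)
  obtain c where c: "group_eq k (wd ss) (wd (map (red k) ss) @ full_twist k c)" using Cons by blast
  have "\<exists>d. group_eq k (pw g n) (pw g (n mod period k g) @ full_twist k d)"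
  proof (cases g)
    case X
    then show ?thesis
      using pres_eq.sym[OF group_eq_pw_add[of k X "n mod (2 * int k)" "2 * int k * (n div (2 * int k))"]]
      by (auto simp: full_twist_def add.commute)
  next
    case Y
    then show ?thesis by (intro exI[of _ 0]) (simp add: pres_eq.refl)
  qed
  then obtain d where d: "group_eq k (pw g n) (pw g (n mod period k g) @ full_twist k d)" by blast
  let ?p = "pw g (n mod period k g)" and ?w = "wd (map (red k) ss)"
  have "group_eq k (pw g n @ wd ss) (?p @ (full_twist k d @ ?w) @ full_twist k c)"
    using pres_eq_append[OF d c] by simp
  also have "group_eq k \<dots> (?p @ (?w @ full_twist k d) @ full_twist k c)"
    by (intro pres_eq_append_left pres_eq_append_right pres_eq.sym[OF full_twist_central])
  also have "group_eq k \<dots> (?p @ ?w @ full_twist k (d + c))"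
    using pres_eq_append_left[OF group_eq_full_twist_add[of k d c], of "?p @ ?w"] by simp
  finally show ?case by (auto simp: s)
qed

lemma modconj_wd_red: "modconj k (wd ss) (wd (map (red k) ss))"
  using group_eq_wd_red modconj_trans[OF modconj_group_eq modconj_full_twist] by blast

abbreviation list_power :: "nat \<Rightarrow> 'a list \<Rightarrow> 'a list" where
  "list_power n z \<equiv> concat (replicate n z)"

lemma length_power: "length (list_power n z) = n * length z"
  by (induction n) auto

lemma nth_power: "q < n * length z \<Longrightarrow> list_power n z ! q = z ! (q mod length z)"
proof (induction n arbitrary: q)
  case (Suc n)
  then show ?case by (auto simp: nth_append le_mod_geq not_less)
qed simp

lemma nform_power:
  assumes "nform k z" "z \<noteq> []" "fst (hd z) \<noteq> fst (last z)"
  shows "nform k (list_power n z)"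
proof (induction n)
  case (Suc n)
  show ?case using assms Suc by (cases n) (auto simp: nform_append)
qed simp

text \<open>The bound \<open>C\<close> does not depend on \<open>n\<close>. The lengths of the two
  powers differ by at most \<open>2 * C\<close>, which for large \<open>n\<close> forces equal
  periods; beyond the disturbed ends a full period can then be compared, and the offset of the two
  patterns is the rotation.\<close>

lemma eventually_periodic_rotate:
  fixes z z' :: "'a list"
  assumes ne: "z \<noteq> []" "z' \<noteq> []"
    and eq: "\<And>n. \<exists>i j u v. i \<le> C \<and> j \<le> C \<and> length u \<le> C \<and> length v \<le> C \<and>
      u @ drop i (list_power n z) = take (n * length z' - j) (list_power n z') @ v"
  shows "\<exists>N. z' = rotate N z"
proof -
  \<comment> \<open>More than \<open>2 * C\<close> copies make a difference of one in the period
    visible, and \<open>n * L \<ge> n + (L - 1)\<close> leaves \<open>L\<close> undisturbed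
    positions between the two ends.\<close>
  define n where "n = 2 * C + 2"
  define L where "L = length z"
  obtain i j u v where b: "i \<le> C" "j \<le> C" "length u \<le> C" "length v \<le> C"
    and e: "u @ drop i (list_power n z) = take (n * length z' - j) (list_power n z') @ v"
    using eq by blast
  have L: "L \<ge> 1" "length z' \<ge> 1" using ne by (auto simp: L_def Suc_le_eq)
  have nL: "n * m \<ge> n + (m - 1)" if "m \<ge> 1" for m
    using that by (cases m) (auto simp: n_def)
  note nL = nL[OF L(1)] nL[OF L(2)]
  have "length u + (n * L - i) = n * length z' - j + length v"
    using arg_cong[OF e, of length] by (simp add: length_power L_def)
  then have "n * L \<le> n * length z' + 2 * C" "n * length z' \<le> n * L + 2 * C"
    using b nL by linarith+
  moreover have "n * L + n \<le> n * length z'" if "L < length z'"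
    using mult_le_mono2[of "Suc L" "length z'" n] that by simp
  moreover have "n * length z' + n \<le> n * L" if "length z' < L"
    using mult_le_mono2[of "Suc (length z')" L n] that by simp
  ultimately have LL: "length z' = L"
    by (cases L "length z'" rule: linorder_cases) (auto simp: n_def)
  have letter: "z ! ((i + q) mod L) = z' ! ((length u + q) mod L)" if q: "q < L" for q
  proof -
    have q': "i + q < n * L" "length u + q < n * L - j"
      using q nL b unfolding n_def by linarith+
    have "(u @ drop i (list_power n z)) ! (length u + q) = z ! ((i + q) mod L)"
      using q' by (simp add: nth_append nth_power length_power L_def)
    moreover have "(take (n * length z' - j) (list_power n z') @ v) ! (length u + q) = z' ! ((length u + q) mod L)"
      using q' by (simp add: nth_append nth_power length_power LL)
    ultimately show ?thesis using e by simp
  qed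
  \<comment> \<open>Modulo \<open>L\<close> this is \<open>i - length u\<close>, the offset of the
    two patterns; the factor \<open>L - 1\<close> replaces the minus sign within the natural
    numbers.\<close>
  define N where "N = i + (L - 1) * length u"
  have "z' = rotate N z"
  proof (rule nth_equalityI)
    show "length z' = length (rotate N z)" by (simp add: LL L_def)
    fix r assume "r < length z'"
    then have r: "r < L" by (simp add: LL)
    define q where "q = (r + (L - 1) * length u) mod L"
    have "(length u + q) mod L = (length u + (r + (L - 1) * length u)) mod L"
      unfolding q_def by (rule mod_add_right_eq)
    also have "length u + (r + (L - 1) * length u) = r + L * length u"
      using L by (cases L) auto
    also have "\<dots> mod L = r" using r by simp
    finally have 1: "(length u + q) mod L = r" .
    have "(i + q) mod L = (N + r) mod L"
      unfolding q_def N_def by (simp add: mod_add_right_eq ac_simps)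
    then show "z' ! r = rotate N z ! r"
      using letter[of q] 1 r L by (simp add: q_def nth_rotate L_def[symmetric] LL) 
  qed
  then show ?thesis ..
qed

lemma conj_push_power:
  assumes comm: "\<And>s. nform k s \<Longrightarrow> act k g (pushes k z s) = pushes k z' (act k g s)"
    and "nform k s"
  shows "act k g (pushes k (list_power n z) s) = pushes k (list_power n z') (act k g s)"
  using assms(2) by (induction n) (simp_all add: comm nform_pushes)

lemma length_push_le: "length (push k s z) \<le> Suc (length z)"
  by (cases "(k, s, z)" rule: push.cases) (auto simp: ncons_def)

text \<open>All copies belong to one factor and act as a single push. This tells lists of at most
  one syllable apart from longer cyclic normal forms, whose powers grow.\<close>

lemma short_power_bounded:
  assumes "length z \<le> 1" "nform k s"
  shows "length (pushes k (list_power n z) s) \<le> Suc (length s)"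
proof (cases z)
  case (Cons t ts)
  then have z: "z = [t]" using assms by simp
  obtain g a where t: "t = (g, a)" by (cases t)
  have "pushes k (list_power n z) s = push k (g, int n * a) s"
    by (induction n) (simp_all add: assms z t push_period push_push algebra_simps)
  then show ?thesis by (simp add: length_push_le)
next
  case Nil
  then have "list_power n z = []" by simp
  then show ?thesis by (simp only: foldr.simps id_apply)
qed

text \<open>The central error of \<open>modconj\<close> acts trivially, so conjugacy modulo the
  centre becomes an exact intertwining relation, which then passes to powers.\<close>

lemma modconj_act:
  assumes "modconj k (wd z) (wd z')"
  obtains g where "\<And>s. nform k s \<Longrightarrow> act k g (pushes k z s) = pushes k z' (act k g s)"
proof -
  obtain g c where *: "group_eq k (g @ wd z) (wd z' @ g @ full_twist k c)"
    using assms unfolding modconj_def by blast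
  have "act k g (pushes k z s) = pushes k z' (act k g s)" if "nform k s" for s
    using act_group_eq[OF * that] that by (simp add: act_wd nform_act)
  then show ?thesis using that by blast
qed

text \<open>Let \<open>h\<close> be the normal form of the conjugator; then
  \<open>h z^n = z'^n h\<close> for all \<open>n\<close>. By \<open>pushes_decomp\<close> the left
  side is \<open>z^n\<close> changed near its beginning, the right side is \<open>z'^n\<close>
  changed near its end, both within bounds independent of \<open>n\<close>, and
  \<open>eventually_periodic_rotate\<close> applies.\<close>

lemma modconj_nform_long:
  assumes "nform k z" "nform k z'" "modconj k (wd z) (wd z')"
    and z: "length z \<ge> 2" "fst (hd z) \<noteq> fst (last z)" and "cyc z'"
  shows "\<exists>n. z' = rotate n z"
proof -
  obtain g where comm: "\<And>s. nform k s \<Longrightarrow> act k g (pushes k z s) = pushes k z' (act k g s)"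
    using modconj_act[OF assms(3)] by blast
  define h where "h = act k g []"
  have h: "nform k h" by (simp add: h_def nform_act)
  have zn: "nform k (list_power n z)" for n using nform_power assms(1) z by fastforce
  have eq: "pushes k h (list_power n z) = pushes k (list_power n z') h" for n
  proof -
    have pn: "pushes k (list_power n z) [] = list_power n z"
      using pushes_nform_append[of k "list_power n z" "[]"] zn[of n] by simp
    have "pushes k h (list_power n z) = act k g (pushes k (list_power n z) [])"
      using act_pushes[OF zn[of n], of g] unfolding pn h_def by (rule HOL.sym)
    also have "\<dots> = pushes k (list_power n z') h"
      unfolding h_def by (rule conj_push_power[OF comm]) simp_all
    finally show ?thesis .
  qed
  have left: "\<exists>i u. i \<le> length h \<and> length u \<le> Suc (length h) \<and> pushes k h (list_power n z) = u @ drop i (list_power n z)" for n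
  proof -
    obtain i m where "i \<le> length h" "length m \<le> 1"
      "pushes k h (list_power n z) = take (length h - i) h @ m @ drop i (list_power n z)"
      using pushes_decomp[OF h zn] by blast
    then show ?thesis by (intro exI[of _ i] exI[of _ "take (length h - i) h @ m"]) auto
  qed
  \<comment> \<open>Otherwise the right side would stay bounded by
    \<open>short_power_bounded\<close> while the left side grows. The two syllables are what makes
    the powers of \<open>z'\<close> normal forms.\<close>
  have long: "length z' \<ge> 2"
  proof (rule ccontr)
    assume "\<not> length z' \<ge> 2"
    define N where "N = 2 * length h + 2"
    have "length (pushes k (list_power N z') h) \<le> Suc (length h)"
      using short_power_bounded[of z' k h N] h \<open>\<not> length z' \<ge> 2\<close> by simp
    moreover obtain i u where "i \<le> length h" "pushes k h (list_power N z) = u @ drop i (list_power N z)"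
      using left by blast
    then have "length (pushes k h (list_power N z)) \<ge> N * length z - length h"
      by (simp add: length_power)
    moreover have "N * 2 \<le> N * length z"
      using z by (intro mult_le_mono2)
    ultimately show False unfolding eq[of N] N_def[symmetric] using N_def by linarith
  qed
  then have z'n: "nform k (list_power n z')" for n
    using nform_power[of k z' n] assms by (force simp: cyc_def)
  have right: "\<exists>j v. j \<le> length h \<and> length v \<le> Suc (length h) \<and>
      pushes k (list_power n z') h = take (n * length z' - j) (list_power n z') @ v" for n
  proof -
    obtain j m where "j \<le> length h" "length m \<le> 1"
      "pushes k (list_power n z') h = take (length (list_power n z') - j) (list_power n z') @ m @ drop j h"
      using pushes_decomp[OF z'n h] by blast
    then show ?thesis by (intro exI[of _ j] exI[of _ "m @ drop j h"]) (auto simp: length_power)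
  qed
  show ?thesis
  proof (rule eventually_periodic_rotate[where C = "Suc (length h)"])
    fix n
    obtain i u where 1: "i \<le> length h" "length u \<le> Suc (length h)" "pushes k h (list_power n z) = u @ drop i (list_power n z)"
      using left by blast
    obtain j v where 2: "j \<le> length h" "length v \<le> Suc (length h)"
      "pushes k (list_power n z') h = take (n * length z' - j) (list_power n z') @ v"
      using right by blast
    have 3: "u @ drop i (list_power n z) = take (n * length z' - j) (list_power n z') @ v"
      using eq[of n] 1(3) 2(3) by simp
    show "\<exists>i j u v. i \<le> Suc (length h) \<and> j \<le> Suc (length h) \<and> length u \<le> Suc (length h) \<and>
        length v \<le> Suc (length h) \<and> u @ drop i (list_power n z) = take (n * length z' - j) (list_power n z') @ v"
      by (rule exI[of _ i], rule exI[of _ j], rule exI[of _ u], rule exI[of _ v])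
        (use 1(1,2) 2(1,2) 3 in auto)
  qed (use z long in auto)
qed

text \<open>Lists of at most one syllable are settled by the abelianisation: the
  \<open>y\<close>-exponent sum and the \<open>x\<close>-exponent sum modulo \<open>2k\<close>
  determine them. Otherwise \<open>modconj_nform_long\<close> applies in one direction or the
  other.\<close>

lemma modconj_nform_rotate:
  assumes "nform k z" "nform k z'" "modconj k (wd z) (wd z')" "cyc z" "cyc z'"
  shows "\<exists>n. z' = rotate n z"
proof (cases "length z \<le> 1 \<and> length z' \<le> 1")
  case True
  have "expsum Y (wd z) = expsum Y (wd z')" "expsum X (wd z) mod period k X = expsum X (wd z') mod period k X"
    using modconj_expsum_Y modconj_expsum_X assms(3) by auto
  moreover have "y = [] \<or> (\<exists>a. y = [(X, a)]) \<or> (\<exists>a. y = [(Y, a)])" if "length y \<le> 1" for y :: "syll list"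
    using that by (auto simp: le_Suc_eq length_Suc_conv) (metis gen.exhaust)
  then have "z = [] \<or> (\<exists>a. z = [(X, a)]) \<or> (\<exists>a. z = [(Y, a)])"
    "z' = [] \<or> (\<exists>a. z' = [(X, a)]) \<or> (\<exists>a. z' = [(Y, a)])"
    using True by auto
  ultimately have "z = z'" using assms(1,2)
    by (elim disjE exE) (simp_all add: nform_Cons)
  then show ?thesis by (intro exI[of _ 0]) simp
next
  case False
  show ?thesis
  proof (cases "length z \<ge> 2")
    case True
    then show ?thesis using modconj_nform_long[OF assms(1-3)] assms(4,5) by (auto simp: cyc_def)
  next
    case False
    then have "length z' \<ge> 2" using \<open>\<not> (length z \<le> 1 \<and> length z' \<le> 1)\<close> by auto
    then obtain n where "z = rotate n z'"
      using modconj_nform_long[OF assms(2,1) modconj_sym[OF assms(3)]] assms(4,5) by (auto simp: cyc_def)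
    then have "length z = length z'" by simp
    then show ?thesis using False \<open>length z' \<ge> 2\<close> by simp
  qed
qed

section \<open>Comparing balanced exponents\<close>

text \<open>The syllables of a freely reduced word. In contrast to \<open>nform\<close> the
  exponents are integers and not residues, as lengths and exponent sums in the group
  require.\<close>

definition syl :: "syll list \<Rightarrow> bool" where
  "syl ss \<longleftrightarrow> alternating ss \<and> (\<forall>s\<in>set ss. snd s \<noteq> 0)"

lemma syl_Nil [simp]: "syl []"
  by (simp add: syl_def)

lemma syl_Cons: "syl ((g, n) # ss) \<longleftrightarrow> n \<noteq> 0 \<and> syl ss \<and> (ss = [] \<or> fst (hd ss) \<noteq> g)"
  by (auto simp: syl_def successively_Cons)

lemma syl_append:
  "syl (ss @ ts) \<longleftrightarrow> syl ss \<and> syl ts \<and> (ss = [] \<or> ts = [] \<or> fst (last ss) \<noteq> fst (hd ts))"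
  by (auto simp: syl_def successively_append_iff)

text \<open>For a list satisfying \<open>syl\<close> this keeps every \<open>x\<close>-syllable
  nontrivial modulo \<open>2k\<close>, so that reduction does not change the syllable
  structure.\<close>

definition x_small :: "nat \<Rightarrow> syll list \<Rightarrow> bool" where
  "x_small k ss \<longleftrightarrow> (\<forall>a. (X, a) \<in> set ss \<longrightarrow> \<bar>a\<bar> < 2 * int k)"

lemma nform_red:
  assumes "syl ss" "x_small k ss"
  shows "nform k (map (red k) ss)"
proof -
  have "n mod period k g \<noteq> 0" if "(g, n) \<in> set ss" for g n
  proof (cases g)
    case X
    then have "n \<noteq> 0" "\<bar>n\<bar> < 2 * int k" using that assms by (auto simp: syl_def x_small_def)
    then show ?thesis using X dvd_imp_le_int[of n "2 * int k"] by (auto simp: mod_eq_0_iff_dvd)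
  next
    case Y
    then show ?thesis using that assms by (auto simp: syl_def)
  qed
  then show ?thesis using assms unfolding nform_def
    by (auto simp: successively_map syl_def red_def)
qed

lemma cyc_red [simp]: "cyc (map (red k) ss) \<longleftrightarrow> cyc ss"
  by (cases ss) (auto simp: cyc_def last_map)

lemma modconj_sylls_rotate:
  assumes "syl ss" "syl ts" "x_small k ss" "x_small k ts" "cyc ss" "cyc ts"
    and "modconj k (wd ss) (wd ts)"
  shows "\<exists>n. map (red k) ts = map (red k) (rotate n ss)"
proof -
  have "modconj k (wd (map (red k) ss)) (wd (map (red k) ts))"
    using modconj_trans[OF modconj_sym[OF modconj_wd_red] modconj_trans[OF assms(7) modconj_wd_red]] .
  then show ?thesis
    using modconj_nform_rotate[of k "map (red k) ss" "map (red k) ts"] nform_red assms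
    by (simp add: rotate_map)
qed

definition x_exp :: "syll \<Rightarrow> int" where
  "x_exp s = (if fst s = X then snd s else 0)"

lemma x_exp_simps [simp]: "x_exp (X, n) = n" "x_exp (Y, n) = 0"
  by (simp_all add: x_exp_def)

lemma expsum_X_wd: "expsum X (wd ss) = sum_list (map x_exp ss)"
  by (induction ss) (auto simp: x_exp_def)

lemma length_wd: "length (wd ss) = sum_list (map (\<lambda>s. nat \<bar>snd s\<bar>) ss)"
  by (induction ss) auto

lemma sum_list_map_rotate:
  fixes f :: "'a \<Rightarrow> 'b::comm_monoid_add"
  shows "sum_list (map f (rotate n xs)) = sum_list (map f xs)"
proof -
  let ?m = "n mod length xs"
  have "sum_list (map f xs) = sum_list (map f (take ?m xs)) + sum_list (map f (drop ?m xs))"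
    by (metis append_take_drop_id map_append sum_list_append)
  then show ?thesis by (simp add: rotate_drop_take add.commute)
qed

text \<open>Corresponding entries share generator and residue, so the second hypothesis compares
  them entry by entry; equal sums then leave no strict inequality. That hypothesis speaks of members
  and not of positions, so it can be verified from bounds on the exponents alone.\<close>

lemma red_eq_dominated:
  assumes "map (red k) ss = map (red k) ts"
    and "\<And>a b. (X, a) \<in> set ss \<Longrightarrow> (X, b) \<in> set ts \<Longrightarrow> a mod (2 * int k) = b mod (2 * int k) \<Longrightarrow> a \<le> b"
  shows "sum_list (map x_exp ss) \<le> sum_list (map x_exp ts) \<and>
    (sum_list (map x_exp ss) = sum_list (map x_exp ts) \<longrightarrow> ss = ts)"
  using assms
proof (induction ss arbitrary: ts)
  case (Cons s ss)
  obtain t ts' where ts: "ts = t # ts'" using Cons.prems by (cases ts) auto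
  obtain g a b where s: "s = (g, a)" and t: "t = (g, b)"
    using Cons.prems(1) by (cases s; cases t) (auto simp: ts red_def)
  have IH: "sum_list (map x_exp ss) \<le> sum_list (map x_exp ts') \<and>
    (sum_list (map x_exp ss) = sum_list (map x_exp ts') \<longrightarrow> ss = ts')"
    using Cons.prems by (intro Cons.IH) (auto simp: ts)
  have ab: "a mod period k g = b mod period k g"
    using Cons.prems(1) by (simp add: ts s t red_def)
  show ?case
  proof (cases g)
    case X
    then have "a \<le> b" using Cons.prems(2)[of a b] ab by (simp add: s t ts)
    then show ?thesis using IH X by (auto simp: s t ts)
  next
    case Y
    then show ?thesis using IH ab by (auto simp: s t ts)
  qed
qed simp

lemma mod_eq_gap:
  fixes a b p :: int
  assumes "a mod p = b mod p" "b < a" "p > 0"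
  shows "b \<le> a - p"
proof -
  have "p dvd a - b" using assms by (simp add: mod_eq_dvd_iff)
  then show ?thesis using zdvd_imp_le[of p "a - b"] assms by simp
qed

definition x_window :: "nat \<Rightarrow> int \<Rightarrow> int \<Rightarrow> syll list \<Rightarrow> bool" where
  "x_window k c \<theta> ss \<longleftrightarrow>
    (c = 0 \<and> 1 \<le> \<theta> \<and> \<theta> \<le> 2 * int k \<or> c \<ge> 1 \<and> \<theta> = 2 * int k \<or> c \<le> - 1 \<and> \<theta> = 1) \<and>
    (\<forall>a. (X, a) \<in> set ss \<longrightarrow> \<theta> - 2 * int k \<le> a \<and> a < \<theta>)"

text \<open>The closed interval from \<open>j - 2k\<close> to \<open>j\<close> has one integer more
  than there are residues; its two ends, both of residue \<open>j\<close>, are the ties, required in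
  a fixed order. Admitting all \<open>j\<close> from \<open>1\<close> to \<open>2k - 1\<close>
  covers inverse words as well, since inversion sends \<open>j\<close> to
  \<open>2k - j\<close>.\<close>

definition x_tied :: "nat \<Rightarrow> int \<Rightarrow> nat \<Rightarrow> nat \<Rightarrow> syll list \<Rightarrow> bool" where
  "x_tied k j \<tau>1 \<tau>2 ss \<longleftrightarrow> 1 \<le> j \<and> j < 2 * int k \<and> \<tau>1 \<ge> 1 \<and> \<tau>2 \<ge> 1 \<and>
    (\<forall>a. (X, a) \<in> set ss \<longrightarrow> j - 2 * int k \<le> a \<and> a \<le> j) \<and>
    filter (\<lambda>s. red k s = (X, j)) ss = replicate \<tau>1 (X, j) @ replicate \<tau>2 (X, j - 2 * int k)"

lemma x_windowD: "x_window k c \<theta> ss \<Longrightarrow> (X, a) \<in> set ss \<Longrightarrow> \<theta> - 2 * int k \<le> a \<and> a < \<theta>"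
  by (simp add: x_window_def)

lemma x_window_rotate [simp]: "x_window k c \<theta> (rotate n ss) = x_window k c \<theta> ss"
  by (simp add: x_window_def)

lemma x_tiedD:
  assumes "x_tied k j \<tau>1 \<tau>2 ss"
  shows "(X, j) \<in> set ss" "(X, j - 2 * int k) \<in> set ss"
proof -
  have "{(X, j), (X, j - 2 * int k)} \<subseteq> set (filter (\<lambda>s. red k s = (X, j)) ss)"
    using assms by (auto simp: x_tied_def)
  then show "(X, j) \<in> set ss" "(X, j - 2 * int k) \<in> set ss" by auto
qed

lemma x_window_small: "syl ss \<Longrightarrow> x_window k c \<theta> ss \<Longrightarrow> x_small k ss"
  by (auto simp: x_window_def x_small_def syl_def)

lemma x_tied_small: "x_tied k j \<tau>1 \<tau>2 ss \<Longrightarrow> x_small k ss"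
  by (auto simp: x_tied_def x_small_def)

text \<open>Let the window of \<open>ss\<close> be the lower one. Exponents of equal residue are
  equal or differ by at least \<open>2k\<close>, so those of \<open>ss\<close> are entrywise at most
  those of \<open>ts\<close>. With equal windows this holds in both directions; with different ones
  also \<open>c \<le> d\<close>, and the total sum forces equality in both places.\<close>

lemma x_window_unique:
  assumes red: "map (red k) ss = map (red k) ts"
    and ss: "x_window k c \<theta> ss" and ts: "x_window k d \<eta> ts" and "k > 0"
    and sum: "sum_list (map x_exp ss) + 2 * int k * c = sum_list (map x_exp ts) + 2 * int k * d"
  shows "ss = ts \<and> c = d"
  using assms
proof (induction \<theta> \<eta> arbitrary: ss ts c d rule: linorder_wlog)
  case (sym \<theta> \<eta>)
  from sym(1)[OF sym(2)[symmetric] sym(4) sym(3) sym(5) sym(6)[symmetric]] show ?case by simp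
next
  case (le \<theta> \<eta>)
  have le_ab: "a \<le> b" if "(X, a) \<in> set ss" "(X, b) \<in> set ts" "a mod (2 * int k) = b mod (2 * int k)" for a b
  proof (rule ccontr)
    assume "\<not> a \<le> b"
    then have "b \<le> a - 2 * int k" using mod_eq_gap[of a "2 * int k" b] that le.prems(4) by simp
    then show False using x_windowD[OF le.prems(2) that(1)] x_windowD[OF le.prems(3) that(2)] le.hyps by linarith
  qed
  have dom: "sum_list (map x_exp ss) \<le> sum_list (map x_exp ts)"
    "sum_list (map x_exp ss) = sum_list (map x_exp ts) \<Longrightarrow> ss = ts"
    using red_eq_dominated[OF le.prems(1) le_ab] by blast+
  have p: "2 * int k > 0" using le.prems(4) by simp
  show ?case
  proof (cases "\<theta> = \<eta>")
    case True
    have ge_ab: "a \<le> b" if "(X, a) \<in> set ts" "(X, b) \<in> set ss" "a mod (2 * int k) = b mod (2 * int k)" for a b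
    proof (rule ccontr)
      assume "\<not> a \<le> b"
      then have "b \<le> a - 2 * int k" using mod_eq_gap[of a "2 * int k" b] that p by simp
      then show False using x_windowD[OF le.prems(3) that(1)] x_windowD[OF le.prems(2) that(2)] True by linarith
    qed
    have "sum_list (map x_exp ts) \<le> sum_list (map x_exp ss)"
      using red_eq_dominated[OF le.prems(1)[symmetric] ge_ab] by blast
    then have "ss = ts" using dom by linarith
    then show ?thesis using le.prems(5) p by simp
  next
    case False
    \<comment> \<open>A window below another is not \<open>[0, 2k)\<close>, and one above another is
      not \<open>(-2k, 0]\<close>, hence \<open>c \<le> 0\<close> and
      \<open>0 \<le> d\<close>.\<close>
    then have "c \<le> d" using le by (auto simp: x_window_def)
    then have "2 * int k * c \<le> 2 * int k * d" using p by (intro mult_left_mono) auto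
    then have "sum_list (map x_exp ss) = sum_list (map x_exp ts)" "2 * int k * c = 2 * int k * d"
      using dom(1) le.prems(5) by linarith+
    then show ?thesis using dom(2) p by simp
  qed
qed

text \<open>If \<open>j < \<theta>\<close>, the tied list is dominated by the other one and
  \<open>c \<ge> 0\<close>; if \<open>\<theta> \<le> j\<close>, the domination is reversed and
  \<open>c \<le> 0\<close>. Either way the sums force the lists to coincide, but a window of
  \<open>2k\<close> integers cannot contain both ties.\<close>

lemma x_window_not_tied:
  assumes red: "map (red k) ss = map (red k) ts"
    and ss: "x_window k c \<theta> ss" and ts: "x_tied k j \<tau>1 \<tau>2 ts"
    and sum: "sum_list (map x_exp ss) + 2 * int k * c = sum_list (map x_exp ts)"
  shows False
proof -
  have p: "2 * int k > 0" using ts by (auto simp: x_tied_def)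
  note mem = x_tiedD[OF ts]
  show False
  proof (cases "j < \<theta>")
    case True
    have "a \<le> b" if "(X, a) \<in> set ts" "(X, b) \<in> set ss" "a mod (2 * int k) = b mod (2 * int k)" for a b
    proof (rule ccontr)
      assume "\<not> a \<le> b"
      then have "b \<le> a - 2 * int k" using mod_eq_gap[of a "2 * int k" b] that p by simp
      moreover have "a \<le> j" "\<theta> - 2 * int k \<le> b" using that ss ts by (auto simp: x_window_def x_tied_def)
      ultimately show False using True by linarith
    qed
    from red_eq_dominated[OF red[symmetric] this]
    have dom: "sum_list (map x_exp ts) \<le> sum_list (map x_exp ss)"
      "sum_list (map x_exp ts) = sum_list (map x_exp ss) \<Longrightarrow> ts = ss" by blast+
    have "0 \<le> c" using ss ts True by (auto simp: x_window_def x_tied_def)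
    then have "0 \<le> 2 * int k * c" using p by simp
    then have "ts = ss" using dom sum by linarith
    then have "\<theta> - 2 * int k \<le> j - 2 * int k" using mem ss by (auto simp: x_window_def)
    then show False using True by simp
  next
    case False
    have "a \<le> b" if "(X, a) \<in> set ss" "(X, b) \<in> set ts" "a mod (2 * int k) = b mod (2 * int k)" for a b
    proof (rule ccontr)
      assume "\<not> a \<le> b"
      then have "b \<le> a - 2 * int k" using mod_eq_gap[of a "2 * int k" b] that p by simp
      moreover have "j - 2 * int k \<le> b" "a < \<theta>" using that ss ts by (auto simp: x_window_def x_tied_def)
      ultimately show False using False by linarith
    qed
    from red_eq_dominated[OF red this]
    have dom: "sum_list (map x_exp ss) \<le> sum_list (map x_exp ts)"
      "sum_list (map x_exp ss) = sum_list (map x_exp ts) \<Longrightarrow> ss = ts" by blast+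
    have "c \<le> 0" using ss ts False by (auto simp: x_window_def x_tied_def)
    then have "2 * int k * c \<le> 0" using p by (simp add: mult_nonneg_nonpos)
    then have "ss = ts" using dom sum by linarith
    then have "j < \<theta>" using mem ss by (auto simp: x_window_def)
    then show False using False by simp
  qed
qed

text \<open>A higher level \<open>j'\<close> would make \<open>ts\<close> dominate \<open>ss\<close>
  entrywise; equal sums would then give equal lists, although \<open>j'\<close> exceeds all
  exponents in \<open>ss\<close>.\<close>

lemma tie_level_le:
  assumes red: "map (red k) ss = map (red k) ts" and "k > 0"
    and ss: "\<forall>a. (X, a) \<in> set ss \<longrightarrow> j - 2 * int k \<le> a \<and> a \<le> j"
    and ts: "\<forall>a. (X, a) \<in> set ts \<longrightarrow> j' - 2 * int k \<le> a \<and> a \<le> j'" "(X, j') \<in> set ts"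
    and sum: "sum_list (map x_exp ss) = sum_list (map x_exp ts)"
  shows "j' \<le> j"
proof (rule ccontr)
  assume "\<not> j' \<le> j"
  have "a \<le> b" if "(X, a) \<in> set ss" "(X, b) \<in> set ts" "a mod (2 * int k) = b mod (2 * int k)" for a b
  proof (rule ccontr)
    assume "\<not> a \<le> b"
    then have "b \<le> a - 2 * int k" using mod_eq_gap[of a "2 * int k" b] that \<open>k > 0\<close> by simp
    moreover have "a \<le> j" "j' - 2 * int k \<le> b" using that ss ts by auto
    ultimately show False using \<open>\<not> j' \<le> j\<close> by linarith
  qed
  from red_eq_dominated[OF red this] have "ss = ts" using sum by blast
  then show False using ts ss \<open>\<not> j' \<le> j\<close> by blast
qed

text \<open>Forgets which of the two extreme exponents stands at a tie. A split cyclic permutation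
  rotates the list of marks, while the list of extreme exponents stays put.\<close>

definition mark :: "nat \<Rightarrow> int \<Rightarrow> syll \<Rightarrow> syll option" where
  "mark k j s = (if red k s = (X, j) then None else Some s)"

lemma sum_list_mark:
  fixes f :: "syll \<Rightarrow> 'b::comm_monoid_add"
  shows "sum_list (map f ss) = sum_list (map (case_option 0 f) (map (mark k j) ss)) +
    sum_list (map f (filter (\<lambda>s. red k s = (X, j)) ss))"
  by (induction ss) (auto simp: mark_def ac_simps)

text \<open>An arbitrary \<open>f\<close> serves for all statistics in use: the number of syllables,
  the \<open>x\<close>-exponent sum and the length.\<close>

lemma sum_list_tied:
  fixes f :: "syll \<Rightarrow> 'b::comm_semiring_1"
  assumes "x_tied k j \<tau>1 \<tau>2 ss"
  shows "sum_list (map f ss) = sum_list (map (case_option 0 f) (map (mark k j) ss)) +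
    (of_nat \<tau>1 * f (X, j) + of_nat \<tau>2 * f (X, j - 2 * int k))"
  using sum_list_mark[of f ss k j] assms
  by (simp add: x_tied_def sum_list_replicate)

text \<open>\<open>tie_level_le\<close> in both directions identifies the levels. Away from the ties
  the exponents lie strictly between \<open>j - 2k\<close> and \<open>j\<close>, where the residue
  determines them. The number of ties and the exponent sum are two linear equations for the numbers
  of \<open>j\<close> and of \<open>j - 2k\<close>, independent because \<open>2k\<close> is
  positive.\<close>

lemma x_tied_unique:
  assumes red: "map (red k) ts = map (red k) (rotate n ss)"
    and ss: "x_tied k j \<tau>1 \<tau>2 ss" and ts: "x_tied k j' \<sigma>1 \<sigma>2 ts"
    and sum: "sum_list (map x_exp ss) = sum_list (map x_exp ts)"
  shows "j' = j \<and> \<sigma>1 = \<tau>1 \<and> \<sigma>2 = \<tau>2 \<and> map (mark k j) ts = rotate n (map (mark k j) ss)"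
proof -
  have p: "2 * int k > 0" and "k > 0" using ss by (auto simp: x_tied_def)
  define rs where "rs = rotate n ss"
  have rs: "\<forall>a. (X, a) \<in> set rs \<longrightarrow> j - 2 * int k \<le> a \<and> a \<le> j" "(X, j) \<in> set rs"
    using ss x_tiedD[OF ss] by (auto simp: rs_def x_tied_def)
  have ts': "\<forall>a. (X, a) \<in> set ts \<longrightarrow> j' - 2 * int k \<le> a \<and> a \<le> j'" "(X, j') \<in> set ts"
    using ts x_tiedD[OF ts] by (auto simp: x_tied_def)
  have sum': "sum_list (map x_exp rs) = sum_list (map x_exp ts)"
    using sum by (simp add: rs_def sum_list_map_rotate)
  have red': "map (red k) rs = map (red k) ts" using red by (simp add: rs_def)
  have [simp]: "j' = j"
    using tie_level_le[OF red' \<open>k > 0\<close> rs(1) ts' sum'] tie_level_le[OF red'[symmetric] \<open>k > 0\<close> ts'(1) rs sum'[symmetric]]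
    by simp
  have "mark k j t = mark k j r" if rt: "red k r = red k t" "r \<in> set rs" "t \<in> set ts" for r t
  proof (cases "red k t = (X, j)")
    case False
    obtain g a b where r: "r = (g, a)" and t: "t = (g, b)"
      using rt(1) by (cases r; cases t) (auto simp: red_def)
    have "a = b"
    proof (cases g)
      case X
      have ab: "j - 2 * int k \<le> a" "a \<le> j" "j - 2 * int k \<le> b" "b \<le> j" "a mod (2 * int k) = b mod (2 * int k)"
        using rt rs ts' by (auto simp: r t X red_def)
      have "a \<noteq> j" "b \<noteq> j" using False rt(1) ss by (auto simp: r t X red_def x_tied_def)
      then show ?thesis
        using mod_eq_gap[of a "2 * int k" b] mod_eq_gap[of b "2 * int k" a] ab p by linarith
    next
      case Y
      then show ?thesis using rt(1) by (simp add: r t red_def)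
    qed
    then show ?thesis by (simp add: r t)
  qed (use rt in \<open>simp add: mark_def\<close>)
  then have "map (mark k j) ts = map (mark k j) rs"
    using red' by (auto simp: list_eq_iff_nth_eq)
  then have marks: "map (mark k j) ts = rotate n (map (mark k j) ss)"
    by (simp add: rs_def rotate_map)
  have len: "length ts = length ss" using arg_cong[OF red, of length] by simp
  have "\<sigma>1 + \<sigma>2 = \<tau>1 + \<tau>2"
    using sum_list_tied[OF ts, of "\<lambda>_. 1 :: nat"] sum_list_tied[OF ss, of "\<lambda>_. 1 :: nat"] len
    by (simp add: marks sum_list_map_rotate sum_list_triv)
  moreover have "int \<sigma>1 * j + int \<sigma>2 * (j - 2 * int k) = int \<tau>1 * j + int \<tau>2 * (j - 2 * int k)"
    using sum_list_tied[OF ts, of x_exp] sum_list_tied[OF ss, of x_exp] sum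
    by (simp add: marks sum_list_map_rotate x_exp_def)
  then have "(int \<sigma>1 + int \<sigma>2) * j - int \<sigma>2 * (2 * int k) = (int \<tau>1 + int \<tau>2) * j - int \<tau>2 * (2 * int k)"
    by (simp add: algebra_simps)
  moreover from calculation(1) have "int \<sigma>1 + int \<sigma>2 = int \<tau>1 + int \<tau>2" by linarith
  ultimately have "int \<sigma>2 * (2 * int k) = int \<tau>2 * (2 * int k)" by simp
  then have "\<sigma>2 = \<tau>2" using p by simp
  then show ?thesis using marks \<open>\<sigma>1 + \<sigma>2 = \<tau>1 + \<tau>2\<close> by simp
qed

section \<open>Syllables of the words of Types 1 to 3\<close>

lemma block_form_Cons:
  "block_form ((a, b) # bs) \<longleftrightarrow> bs = [] \<or> b \<noteq> 0 \<and> fst (hd bs) \<noteq> 0 \<and> block_form bs"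
proof (cases bs)
  case (Cons c cs)
  then show ?thesis
    by (cases c) (auto simp: block_form_def All_less_Suc2)
qed (simp add: block_form_def)

lemma bword_simps [simp]: "bword [] = []" "bword ((a, b) # bs) = pw X a @ pw Y b @ bword bs"
  by (simp_all add: bword_def)

definition block_sylls :: "(int \<times> int) list \<Rightarrow> syll list" where
  "block_sylls bs = filter (\<lambda>s. snd s \<noteq> 0) (concat (map (\<lambda>(a, b). [(X, a), (Y, b)]) bs))"

lemma wd_block_sylls: "wd (block_sylls bs) = bword bs"
  by (induction bs) (auto simp: block_sylls_def)

lemma set_block_sylls: "(X, a) \<in> set (block_sylls bs) \<longleftrightarrow> a \<noteq> 0 \<and> (\<exists>b. (a, b) \<in> set bs)"
  by (auto simp: block_sylls_def)

lemma hd_block_sylls: "block_form bs \<Longrightarrow> fst (hd bs) \<noteq> 0 \<Longrightarrow> block_sylls bs \<noteq> [] \<and> fst (hd (block_sylls bs)) = X"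
  by (cases bs) (auto simp: block_sylls_def block_form_def)

lemma syl_block_sylls: "block_form bs \<Longrightarrow> syl (block_sylls bs)"
proof (induction bs)
  case (Cons c bs)
  obtain a b where c: "c = (a, b)" by (cases c)
  show ?case
  proof (cases "bs = []")
    case True
    then show ?thesis by (auto simp: c block_sylls_def syl_Cons)
  next
    case False
    then have *: "b \<noteq> 0" "fst (hd bs) \<noteq> 0" "block_form bs" using Cons.prems by (auto simp: c block_form_Cons)
    have "block_sylls (c # bs) = filter (\<lambda>s. snd s \<noteq> 0) [(X, a), (Y, b)] @ block_sylls bs"
      by (simp add: block_sylls_def c)
    then show ?thesis using * Cons.IH hd_block_sylls[of bs] by (auto simp: syl_Cons)
  qed
qed (simp add: block_form_def)

text \<open>Built from the right: a \<open>y\<close>-power opens a block with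
  \<open>x\<close>-exponent 0, and an \<open>x\<close>-power in front of it fills this 0. The last
  two clauses translate the condition on the outer exponents of a block form.\<close>

lemma blocks_of_sylls:
  assumes "syl ss"
  shows "\<exists>bs. block_form bs \<and> bword bs = wd ss \<and> (\<forall>(a, b)\<in>set bs. a \<noteq> 0 \<longrightarrow> (X, a) \<in> set ss) \<and>
    (fst (hd bs) \<noteq> 0 \<longleftrightarrow> ss \<noteq> [] \<and> fst (hd ss) = X) \<and> (snd (last bs) \<noteq> 0 \<longleftrightarrow> ss \<noteq> [] \<and> fst (last ss) = Y)"
  using assms
proof (induction ss)
  case Nil
  show ?case by (rule exI[of _ "[(0, 0)]"]) (simp add: block_form_Cons)
next
  case (Cons s ss)
  obtain g n where s: "s = (g, n)" by (cases s)
  have n: "n \<noteq> 0" and ss: "syl ss" "ss = [] \<or> fst (hd ss) \<noteq> g" using Cons.prems by (auto simp: s syl_Cons)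
  obtain bs where bs: "block_form bs" "bword bs = wd ss" "\<forall>(a, b)\<in>set bs. a \<noteq> 0 \<longrightarrow> (X, a) \<in> set ss"
    "fst (hd bs) \<noteq> 0 \<longleftrightarrow> ss \<noteq> [] \<and> fst (hd ss) = X" "snd (last bs) \<noteq> 0 \<longleftrightarrow> ss \<noteq> [] \<and> fst (last ss) = Y"
    using Cons.IH[OF ss(1)] by blast
  show ?case
  proof (cases g)
    case Y
    show ?thesis
    proof (cases "ss = []")
      case True
      then show ?thesis using n
        by (intro exI[of _ "[(0, n)]"]) (simp add: block_form_Cons s Y)
    next
      case False
      then have "fst (hd bs) \<noteq> 0" using ss bs(4) Y by (metis gen.exhaust)
      then show ?thesis using n bs False
        by (intro exI[of _ "(0, n) # bs"]) (auto simp: block_form_Cons s Y, auto simp: block_form_def)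
    qed
  next
    case X
    obtain b r where r: "bs = (0, b) # r"
      using bs(1,4) ss(2) X by (cases bs) (auto simp: block_form_def)
    show ?thesis using n bs ss
      by (intro exI[of _ "(n, b) # r"]) (auto simp: block_form_Cons s X r)
  qed
qed

lemma hd_wd: "syl ss \<Longrightarrow> ss \<noteq> [] \<Longrightarrow> fst (hd (wd ss)) = fst (hd ss)"
  by (cases ss) (auto simp: syl_Cons)

lemma last_wd: "syl ss \<Longrightarrow> ss \<noteq> [] \<Longrightarrow> fst (last (wd ss)) = fst (last ss)"
  by (cases ss rule: rev_cases) (auto simp: syl_append syl_Cons)

lemma wd_eq_Nil_iff: "syl ss \<Longrightarrow> wd ss = [] \<longleftrightarrow> ss = []"
  by (cases ss) (auto simp: syl_Cons)

text \<open>For two or more pairs the condition puts the first and the last letter into different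
  factors. It is void for a single pair; there the word is at most one syllable, or it starts with
  \<open>x\<close> and ends with \<open>y\<close>.\<close>

lemma bword_cyclic_sylls:
  assumes "block_form bs" "syl ss" "wd ss = bword bs"
    and "length bs \<ge> 2 \<longrightarrow> (fst (hd bs) = 0 \<longleftrightarrow> snd (last bs) = 0)"
  shows "cyc ss"
proof (rule ccontr)
  assume "\<not> cyc ss"
  then have ss: "length ss \<ge> 2" "fst (hd ss) = fst (last ss)" by (auto simp: cyc_def)
  obtain s t ts where sst: "ss = s # t # ts" using ss by (cases ss; cases "tl ss") auto
  have gens: "fst ` set (wd ss) = UNIV"
    using assms(2) sst by (cases s; cases t) (auto simp: syl_Cons pw_def, (metis gen.exhaust)+)
  have ne: "wd ss \<noteq> []" using gens by auto
  have "ss \<noteq> []" using sst by simp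
  then have eq: "fst (hd (wd ss)) = fst (last (wd ss))"
    using hd_wd[OF assms(2)] last_wd[OF assms(2)] ss by simp
  show False
  proof (cases "length bs \<ge> 2")
    case True
    have *: "block_sylls bs \<noteq> []" using ne assms(3) wd_block_sylls[of bs] by auto
    have "fst (hd (block_sylls bs)) \<noteq> fst (last (block_sylls bs))"
    proof -
      obtain a b bs' where 1: "bs = (a, b) # bs'" "bs' \<noteq> []"
        using True by (cases bs; cases "tl bs") auto
      obtain bs'' c d where 2: "bs = bs'' @ [(c, d)]"
        using 1(1) by (metis list.distinct(1) rev_exhaust surj_pair)
      then have "bs'' \<noteq> []" using True by auto
      note 2 = 2 this
      have b: "b \<noteq> 0" using assms(1) 1 by (simp add: block_form_Cons)
      have c: "c \<noteq> 0"
        using assms(1) 2 by (auto simp: block_form_def dest!: spec[of _ "length bs''"])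
      have "fst (hd (block_sylls bs)) = (if a = 0 then Y else X)"
        using b by (simp add: 1 block_sylls_def)
      moreover have "fst (last (block_sylls bs)) = (if d = 0 then X else Y)"
        using c by (simp add: 2 block_sylls_def)
      moreover have "a = 0 \<longleftrightarrow> d = 0" using assms(4) True 1 2(1) by (metis fst_conv snd_conv list.sel(1) last_snoc)
      ultimately show ?thesis by auto
    qed
    then show False
      using eq hd_wd[OF syl_block_sylls * ] last_wd[OF syl_block_sylls * ] assms(1,3)
      by (simp add: wd_block_sylls)
  next
    case False
    then obtain a b where "bs = [(a, b)]" using assms(1)
      by (cases bs; cases "tl bs") (auto simp: block_form_def)
    then have w: "wd ss = pw X a @ pw Y b" using assms(3) by simp
    show False
    proof (cases "a = 0 \<or> b = 0")
      case True
      then have "X \<notin> fst ` set (wd ss) \<or> Y \<notin> fst ` set (wd ss)"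
        using w by (auto simp: pw_def)
      then show False using gens by simp
    next
      case False
      then show False using eq w by simp
    qed
  qed
qed

section \<open>Type 3 words\<close>

lemma type3_sylls:
  assumes "w \<in> type3 k" "k \<ge> 1"
  shows "\<exists>ss. syl ss \<and> wd ss = w \<and> (\<forall>a. (X, a) \<in> set ss \<longrightarrow> \<bar>a\<bar> \<le> int k - 1)"
proof -
  obtain \<alpha> es where w: "w = pw X \<alpha> @ concat (map (\<lambda>(\<epsilon>, \<nu>). pw Y \<epsilon> @ pw X \<nu>) es)"
    and \<alpha>: "\<bar>\<alpha>\<bar> \<le> int k - 1" and es: "\<forall>(\<epsilon>, \<nu>)\<in>set es. \<epsilon> \<noteq> 0 \<and> \<bar>\<nu>\<bar> \<le> int k - 1"
    "\<forall>i<length es. Suc i < length es \<longrightarrow> snd (es ! i) \<noteq> 0"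
    using assms unfolding type3_def by blast
  have "\<exists>ss. syl ss \<and> wd ss = concat (map (\<lambda>(\<epsilon>, \<nu>). pw Y \<epsilon> @ pw X \<nu>) es) \<and>
    (\<forall>a. (X, a) \<in> set ss \<longrightarrow> \<bar>a\<bar> \<le> int k - 1) \<and> (ss = [] \<or> fst (hd ss) = Y)"
    using es
  proof (induction es)
    case (Cons e es)
    obtain \<epsilon> \<nu> where e: "e = (\<epsilon>, \<nu>)" by (cases e)
    have \<epsilon>: "\<epsilon> \<noteq> 0" "\<bar>\<nu>\<bar> \<le> int k - 1" "es \<noteq> [] \<longrightarrow> \<nu> \<noteq> 0"
      using Cons.prems by (auto simp: e All_less_Suc2)
    have "\<forall>i<length es. Suc i < length es \<longrightarrow> snd (es ! i) \<noteq> 0"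
      using Cons.prems(2) by (auto simp: All_less_Suc2)
    then obtain ss where ss: "syl ss" "wd ss = concat (map (\<lambda>(\<epsilon>, \<nu>). pw Y \<epsilon> @ pw X \<nu>) es)"
      "\<forall>a. (X, a) \<in> set ss \<longrightarrow> \<bar>a\<bar> \<le> int k - 1" "ss = [] \<or> fst (hd ss) = Y" 
      using Cons.IH Cons.prems(1) by auto
    show ?case
    proof (cases "\<nu> = 0")
      case True
      \<comment> \<open>Only the last exponent \<open>\<nu>\<close> may vanish, so the word ends
        here.\<close>
      then have "es = []" using \<epsilon> by auto
      then show ?thesis using \<epsilon> True by (intro exI[of _ "[(Y, \<epsilon>)]"]) (simp add: syl_Cons e)
    next
      case False
      then show ?thesis using \<epsilon> ss by (intro exI[of _ "(Y, \<epsilon>) # (X, \<nu>) # ss"]) (auto simp: syl_Cons e)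
    qed
  qed (rule exI[of _ "[]"], simp)
  then obtain ss where "syl ss" "wd ss = concat (map (\<lambda>(\<epsilon>, \<nu>). pw Y \<epsilon> @ pw X \<nu>) es)"
    "\<forall>a. (X, a) \<in> set ss \<longrightarrow> \<bar>a\<bar> \<le> int k - 1" "ss = [] \<or> fst (hd ss) = Y" by blast
  then show ?thesis using \<alpha> w
    by (intro exI[of _ "if \<alpha> = 0 then ss else (X, \<alpha>) # ss"]) (auto simp: syl_Cons)
qed

lemma sylls_type3:
  assumes "syl ss" "\<forall>a. (X, a) \<in> set ss \<longrightarrow> \<bar>a\<bar> \<le> int k - 1" "k \<ge> 1"
  shows "wd ss \<in> type3 k"
proof -
  \<comment> \<open>The last two clauses strengthen the induction: a pair with exponent
    \<open>\<alpha>\<close> may be put in front of a nonempty \<open>es\<close> only if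
    \<open>\<alpha>\<close> is nonzero.\<close>
  have "\<exists>\<alpha> es. wd ss = pw X \<alpha> @ concat (map (\<lambda>(\<epsilon>, \<nu>). pw Y \<epsilon> @ pw X \<nu>) es) \<and>
     \<bar>\<alpha>\<bar> \<le> int k - 1 \<and> (\<forall>(\<epsilon>, \<nu>)\<in>set es. \<epsilon> \<noteq> 0 \<and> \<bar>\<nu>\<bar> \<le> int k - 1) \<and>
     (\<forall>i<length es. Suc i < length es \<longrightarrow> snd (es ! i) \<noteq> 0) \<and>
     (\<alpha> \<noteq> 0 \<longleftrightarrow> ss \<noteq> [] \<and> fst (hd ss) = X) \<and> (ss = [] \<longrightarrow> es = [])"
    using assms(1,2)
  proof (induction ss)
    case Nil
    show ?case by (rule exI[of _ 0], rule exI[of _ "[]"]) (use assms(3) in simp)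
  next
    case (Cons s ss)
    obtain g n where s: "s = (g, n)" by (cases s)
    have n: "n \<noteq> 0" and ss: "syl ss" "ss = [] \<or> fst (hd ss) \<noteq> g" using Cons.prems by (auto simp: s syl_Cons)
    obtain \<alpha> es where IH: "wd ss = pw X \<alpha> @ concat (map (\<lambda>(\<epsilon>, \<nu>). pw Y \<epsilon> @ pw X \<nu>) es)"
     "\<bar>\<alpha>\<bar> \<le> int k - 1" "\<forall>(\<epsilon>, \<nu>)\<in>set es. \<epsilon> \<noteq> 0 \<and> \<bar>\<nu>\<bar> \<le> int k - 1"
     "\<forall>i<length es. Suc i < length es \<longrightarrow> snd (es ! i) \<noteq> 0"
     "\<alpha> \<noteq> 0 \<longleftrightarrow> ss \<noteq> [] \<and> fst (hd ss) = X" "ss = [] \<longrightarrow> es = []"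
      using Cons.IH[OF ss(1)] Cons.prems(2) by auto
    show ?case
    proof (cases g)
      case X
      then have "\<alpha> = 0" using ss IH(5) by auto
      then show ?thesis using n IH Cons.prems(2)
        by (intro exI[of _ n] exI[of _ es]) (simp add: s X)
    next
      case Y
      then have "es \<noteq> [] \<longrightarrow> \<alpha> \<noteq> 0" using ss IH(5,6) by (metis gen.exhaust)
      then show ?thesis using n IH assms(3)
        by (intro exI[of _ 0] exI[of _ "(n, \<alpha>) # es"]) (auto simp: s Y All_less_Suc2)
    qed
  qed
  then show ?thesis unfolding type3_def by blast
qed

section \<open>Words with marked ties\<close>

text \<open>Decodes a marked list: entries \<open>Some a\<close> are written by \<open>f\<close>,
  and the successive entries \<open>None\<close> receive \<open>h i\<close>,
  \<open>h (i + 1)\<close> and so on, whatever stands between them. Rotating the marked list and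
  decoding it again models a split cyclic permutation.\<close>

fun fill :: "('a \<Rightarrow> 'b list) \<Rightarrow> (nat \<Rightarrow> 'b list) \<Rightarrow> nat \<Rightarrow> 'a option list \<Rightarrow> 'b list" where
  "fill f h i [] = []"
| "fill f h i (None # M) = h i @ fill f h (Suc i) M"
| "fill f h i (Some a # M) = f a @ fill f h i M"

definition nones :: "'a option list \<Rightarrow> nat" where
  "nones M = length (filter (\<lambda>m. m = None) M)"

lemma nones_simps [simp]:
  "nones [] = 0" "nones (None # M) = Suc (nones M)" "nones (Some a # M) = nones M"
  "nones (M @ N) = nones M + nones N" "nones (map Some as) = 0"
  by (auto simp: nones_def filter_empty_conv)

lemma nones_rotate [simp]: "nones (rotate n M) = nones M"
proof -
  have "nones M = sum_list (map (\<lambda>m. if m = None then 1 else 0) M)" for M :: "'a option list"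
    by (induction M) (auto simp: nones_def)
  then show ?thesis by (simp add: sum_list_map_rotate)
qed

lemma fill_append: "fill f h i (M @ N) = fill f h i M @ fill f h (i + nones M) N"
  by (induction f h i M rule: fill.induct) auto

lemma fill_Somes [simp]: "fill f h i (map Some as) = concat (map f as)"
  by (induction as) auto

lemma fill_const_index: "fill f (\<lambda>_. x) i N = fill f (\<lambda>_. x) i' N"
proof (induction N arbitrary: i i')
  case (Cons m N)
  then show ?case by (cases m) auto
qed simp

lemma fill_const_rotate:
  "\<exists>m. fill f (\<lambda>_. x) 1 (rotate n M) = rotate m (fill f (\<lambda>_. x) 1 M)"
proof -
  let ?m = "n mod length M"
  have "fill f (\<lambda>_. x) 1 (rotate n M) = fill f (\<lambda>_. x) 1 (drop ?m M) @ fill f (\<lambda>_. x) 1 (take ?m M)"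
    unfolding rotate_drop_take fill_append by (subst fill_const_index[where i' = 1]) (rule HOL.refl)
  also have "\<dots> = rotate (length (fill f (\<lambda>_. x) 1 (take ?m M)))
      (fill f (\<lambda>_. x) 1 (take ?m M) @ fill f (\<lambda>_. x) 1 (drop ?m M))"
    by (simp add: rotate_append)
  also have "fill f (\<lambda>_. x) 1 (take ?m M) @ fill f (\<lambda>_. x) 1 (drop ?m M) = fill f (\<lambda>_. x) 1 M"
    by (metis append_take_drop_id fill_append fill_const_index)
  finally show ?thesis by blast
qed

lemma group_eq_fill_const:
  assumes "\<And>i. d i mod (2 * int k) = j mod (2 * int k)"
  shows "\<exists>c. group_eq k (fill f (\<lambda>i. pw X (d i)) i M) (fill f (\<lambda>_. pw X j) i M @ full_twist k c)"
proof (induction f "\<lambda>i. pw X (d i)" i M rule: fill.induct)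
  case (1 f i)
  show ?case by (rule exI[of _ 0]) (simp add: pres_eq.refl)
next
  case (2 f i M)
  obtain c where c: "group_eq k (fill f (\<lambda>i. pw X (d i)) (Suc i) M) (fill f (\<lambda>_. pw X j) (Suc i) M @ full_twist k c)"
    using 2 by blast
  let ?w = "fill f (\<lambda>_. pw X j) (Suc i) M"
  have "2 * int k dvd d i - j" using assms by (simp add: mod_eq_dvd_iff)
  then obtain e where "d i - j = 2 * int k * e" by blast
  then have e: "d i = j + 2 * int k * e" by simp
  have "group_eq k (pw X (d i) @ fill f (\<lambda>i. pw X (d i)) (Suc i) M) ((pw X j @ full_twist k e) @ ?w @ full_twist k c)"
    using pres_eq_append[OF pres_eq.sym[OF group_eq_pw_add[of k X j "2 * int k * e"]] c]
    by (simp add: e full_twist_def)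
  also have "(pw X j @ full_twist k e) @ ?w @ full_twist k c = pw X j @ (full_twist k e @ ?w) @ full_twist k c"
    by simp
  also have "group_eq k \<dots> (pw X j @ (?w @ full_twist k e) @ full_twist k c)"
    by (intro pres_eq_append_left pres_eq_append_right pres_eq.sym[OF full_twist_central])
  also have "group_eq k \<dots> (pw X j @ ?w @ full_twist k (e + c))"
    using pres_eq_append_left[OF group_eq_full_twist_add[of k e c], of "pw X j @ ?w"] by simp
  finally show ?case by auto
next
  case (3 f i a M)
  then obtain c where "group_eq k (fill f (\<lambda>i. pw X (d i)) i M) (fill f (\<lambda>_. pw X j) i M @ full_twist k c)"
    by blast
  then have "group_eq k (f a @ fill f (\<lambda>i. pw X (d i)) i M) (f a @ fill f (\<lambda>_. pw X j) i M @ full_twist k c)"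
    by (rule pres_eq_append_left)
  then show ?case by auto
qed

text \<open>Modulo the centre all inserted powers equal \<open>pw X j\<close>. With a constant
  insert the numbering of the ties is immaterial, so rotating the marked list rotates the
  word.\<close>

lemma modconj_fill_rotate:
  assumes "\<And>i. d i mod (2 * int k) = j mod (2 * int k)"
  shows "modconj k (fill f (\<lambda>i. pw X (d i)) 1 M) (fill f (\<lambda>i. pw X (d i)) 1 (rotate n M))"
proof -
  have const: "modconj k (fill f (\<lambda>i. pw X (d i)) 1 N) (fill f (\<lambda>_. pw X j) 1 N)" for N
    using group_eq_fill_const[where d = d and j = j and f = f and i = 1 and M = N, OF assms] modconj_trans[OF modconj_group_eq modconj_full_twist] by blast
  have "modconj k (fill f (\<lambda>_. pw X j) 1 M) (fill f (\<lambda>_. pw X j) 1 (rotate n M))"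
    using fill_const_rotate[of f "pw X j" n M] modconj_rotate by metis
  then show ?thesis
    using modconj_trans[OF const modconj_trans[OF _ modconj_sym[OF const]]] by blast
qed

text \<open>The inserted exponents depend on the number of ties and not on their positions, hence
  the sum is invariant under rotation of the marked list.\<close>

lemma expsum_fill:
  "expsum X (fill f (\<lambda>i. pw X (d i)) i M) =
    sum_list (map (case_option 0 (\<lambda>a. expsum X (f a))) M) + (\<Sum>l\<in>{i..<i + nones M}. d l)"
proof (induction f "\<lambda>i. pw X (d i)" i M rule: fill.induct)
  case (2 f i M)
  then show ?case by (simp add: sum.atLeast_Suc_lessThan)
qed auto

lemma expsum_fill_rotate:
  "expsum X (fill f (\<lambda>i. pw X (d i)) 1 (rotate n M)) = expsum X (fill f (\<lambda>i. pw X (d i)) 1 M)"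
  by (simp add: expsum_fill sum_list_map_rotate)

text \<open>The shape of a Type 2 word: \<open>C 1\<close> to \<open>C (\<tau> + 1)\<close> are the
  blocks, numbered as in \<open>type2_word\<close>, and each \<open>None\<close> between them stands
  for an extreme power of \<open>x\<close>.\<close>

definition separated :: "(nat \<Rightarrow> 'a list) \<Rightarrow> nat \<Rightarrow> 'a option list" where
  "separated C \<tau> = map Some (C 1) @ concat (map (\<lambda>s. None # map Some (C s)) [2..<\<tau> + 2])"

lemma separated_0 [simp]: "separated C 0 = map Some (C 1)"
  by (simp add: separated_def)

lemma separated_Suc [simp]:
  "separated C (Suc \<tau>) = separated C \<tau> @ None # map Some (C (\<tau> + 2))"
  by (simp add: separated_def)

lemma separated_cong: "(\<And>s. s \<in> {1..\<tau> + 1} \<Longrightarrow> C s = C' s) \<Longrightarrow> separated C \<tau> = separated C' \<tau>"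
  by (induction \<tau>) auto

lemma nones_separated [simp]: "nones (separated C \<tau>) = \<tau>"
  by (induction \<tau>) auto

lemma separated_exists: "\<exists>C. M = separated C (nones M)"
proof (induction M rule: rev_induct)
  case Nil
  show ?case by (rule exI[of _ "\<lambda>_. []"]) simp
next
  case (snoc m M)
  then obtain C where C: "M = separated C (nones M)" by blast
  show ?case
  proof (cases m)
    case None
    define C' where "C' = C(nones M + 2 := [])"
    have "separated C' (nones M) = separated C (nones M)"
      by (rule separated_cong) (auto simp: C'_def)
    moreover have "C' (nones M + 2) = []" by (simp add: C'_def)
    ultimately show ?thesis using C by (intro exI[of _ C']) (simp add: None)
  next
    case (Some a)
    define C' where "C' = C(nones M + 1 := C (nones M + 1) @ [a])"
    have "separated C' (nones M) = M @ [Some a]"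
    proof (cases "nones M")
      case 0
      then show ?thesis using C by (simp add: C'_def)
    next
      case (Suc \<tau>)
      have "separated C' \<tau> = separated C \<tau>"
        by (rule separated_cong) (auto simp: C'_def Suc)
      moreover have "M = separated C \<tau> @ None # map Some (C (\<tau> + 2))" using C by (simp add: Suc)
      ultimately show ?thesis by (simp add: C'_def Suc)
    qed
    then show ?thesis by (intro exI[of _ C']) (simp add: Some)
  qed
qed

text \<open>Block \<open>s \<ge> 2\<close> follows the \<open>None\<close> with number
  \<open>s - 1\<close>, and the numbering starts at \<open>i\<close>, hence the argument
  \<open>i + s - 2\<close>.\<close>

lemma fill_separated:
  "fill f h i (separated C \<tau>) = concat (map f (C 1)) @
    concat (map (\<lambda>s. h (i + s - 2) @ concat (map f (C s))) [2..<\<tau> + 2])"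
  by (induction \<tau>) (auto simp: fill_append)

text \<open>The last block on the left and the first one on the right meet without a
  \<open>None\<close> and merge. Read backwards, cutting a marked list splits exactly one block, as
  in the second form of a split cyclic permutation.\<close>

lemma separated_append:
  "separated C \<tau> @ separated D \<sigma> =
    separated (\<lambda>s. if s \<le> \<tau> then C s else if s = \<tau> + 1 then C s @ D 1 else D (s - \<tau>)) (\<tau> + \<sigma>)"
proof (induction \<sigma>)
  case 0
  show ?case
  proof (cases \<tau>)
    case (Suc \<tau>')
    have "separated C \<tau>' = separated (\<lambda>s. if s \<le> \<tau> then C s else if s = \<tau> + 1 then C s @ D 1 else D (s - \<tau>)) \<tau>'"
      by (rule separated_cong) (auto simp: Suc)
    then show ?thesis by (simp add: Suc)
  qed simp
next
  case (Suc \<sigma>)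
  then show ?case by (simp flip: append_assoc)
qed

text \<open>Exhibits the ties next to a block; by alternation with these powers of \<open>x\<close>
  the generators at the ends of the block are determined.\<close>

lemma separated_block:
  assumes "s \<in> {1..\<tau> + 1}"
  shows "\<exists>U V. separated C \<tau> = U @ map Some (C s) @ V \<and>
    (if s = 1 then U = [] else U \<noteq> [] \<and> last U = None) \<and>
    (if s = \<tau> + 1 then V = [] else V \<noteq> [] \<and> hd V = None)"
  using assms
proof (induction \<tau>)
  case 0
  then show ?case by auto
next
  case (Suc \<tau>)
  show ?case
  proof (cases "s = \<tau> + 2")
    case True
    then show ?thesis
      by (intro exI[of _ "separated C \<tau> @ [None]"] exI[of _ "[]"]) simp
  next
    case False
    then obtain U V where UV: "separated C \<tau> = U @ map Some (C s) @ V"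
      "if s = 1 then U = [] else U \<noteq> [] \<and> last U = None"
      "if s = \<tau> + 1 then V = [] else V \<noteq> [] \<and> hd V = None"
      using Suc by auto
    then show ?thesis using False
      by (intro exI[of _ U] exI[of _ "V @ None # map Some (C (\<tau> + 2))"]) (auto split: if_splits)
  qed
qed

section \<open>Type 2 words as decoded marked lists\<close>

lemma type2_word_eq:
  "type2_word k j \<tau>1 \<tau>2 A = A 1 @ concat (map (\<lambda>s. xd k j \<tau>1 (s - 1) @ A s) [2..<\<tau>1 + \<tau>2 + 2])"
proof -
  have "concat (map (\<lambda>i. A i @ xd k j \<tau>1 i) [1..<\<tau> + 1]) @ A (\<tau> + 1) =
    A 1 @ concat (map (\<lambda>s. xd k j \<tau>1 (s - 1) @ A s) [2..<\<tau> + 2])" for \<tau>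
  proof (induction \<tau>)
    case (Suc \<tau>)
    have "concat (map (\<lambda>i. A i @ xd k j \<tau>1 i) [1..<Suc \<tau> + 1]) @ A (Suc \<tau> + 1) =
      (concat (map (\<lambda>i. A i @ xd k j \<tau>1 i) [1..<\<tau> + 1]) @ A (\<tau> + 1)) @ xd k j \<tau>1 (\<tau> + 1) @ A (\<tau> + 2)"
      by simp
    then show ?case unfolding Suc by simp
  qed simp
  then show ?thesis by (simp add: type2_word_def)
qed

definition tie_exp :: "nat \<Rightarrow> int \<Rightarrow> nat \<Rightarrow> nat \<Rightarrow> int" where
  "tie_exp k j \<tau>1 i = (if i \<le> \<tau>1 then j else j - 2 * int k)"

lemma xd_eq: "xd k j \<tau>1 = (\<lambda>i. pw X (tie_exp k j \<tau>1 i))"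
  by (auto simp: xd_def tie_exp_def)

lemma tie_exp_mod: "tie_exp k j \<tau>1 i mod (2 * int k) = j mod (2 * int k)"
  by (simp add: tie_exp_def mod_diff_right_eq[symmetric] flip: mod_diff_eq)

abbreviation pws :: "syll \<Rightarrow> xyword" where
  "pws \<equiv> \<lambda>(g, n). pw g n"

text \<open>The hypothesis lists the tied syllables in order of occurrence, so decoding the marks
  puts each of them back into its place.\<close>

lemma wd_fill:
  assumes "filter (\<lambda>s. red k s = (X, j)) ss = map (\<lambda>i. (X, d i)) [i..<i + nones (map (mark k j) ss)]"
  shows "wd ss = fill pws (\<lambda>i. pw X (d i)) i (map (mark k j) ss)"
  using assms
proof (induction ss arbitrary: i)
  case (Cons s ss)
  show ?case
  proof (cases "red k s = (X, j)")
    case True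
    have "s # filter (\<lambda>s. red k s = (X, j)) ss = map (\<lambda>i. (X, d i)) [i..<i + Suc (nones (map (mark k j) ss))]"
      using Cons.prems True by (simp add: mark_def[of k j s] del: upt_Suc)
    then have s: "s = (X, d i)" and
      "filter (\<lambda>s. red k s = (X, j)) ss = map (\<lambda>i. (X, d i)) [Suc i..<Suc i + nones (map (mark k j) ss)]"
      by (simp_all add: upt_conv_Cons del: upt_Suc)
    then have "wd ss = fill pws (\<lambda>i. pw X (d i)) (Suc i) (map (mark k j) ss)" by (intro Cons.IH)
    moreover have "mark k j s = None" using True by (simp add: mark_def)
    ultimately show ?thesis using s by simp
  next
    case False
    then have m: "mark k j s = Some s" by (simp add: mark_def)
    have "wd ss = fill pws (\<lambda>i. pw X (d i)) i (map (mark k j) ss)"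
      by (rule Cons.IH) (use Cons.prems False m in simp)
    then show ?thesis using m by (cases s) simp
  qed
qed simp

lemma nones_mark: "nones (map (mark k j) ss) = length (filter (\<lambda>s. red k s = (X, j)) ss)"
  by (induction ss) (auto simp: mark_def)

lemma replicate_tie_exp:
  "replicate \<tau>1 (X, j) @ replicate \<tau>2 (X, j - 2 * int k) = map (\<lambda>i. (X, tie_exp k j \<tau>1 i)) [1..<1 + (\<tau>1 + \<tau>2)]"
  by (rule nth_equalityI) (auto simp: nth_append tie_exp_def simp del: upt_Suc)

lemma wd_tied_fill:
  assumes "filter (\<lambda>s. red k s = (X, j)) ss = replicate \<tau>1 (X, j) @ replicate \<tau>2 (X, j - 2 * int k)"
  shows "wd ss = fill pws (xd k j \<tau>1) 1 (map (mark k j) ss)" "nones (map (mark k j) ss) = \<tau>1 + \<tau>2"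
proof -
  show *: "nones (map (mark k j) ss) = \<tau>1 + \<tau>2" using assms by (simp add: nones_mark)
  show "wd ss = fill pws (xd k j \<tau>1) 1 (map (mark k j) ss)"
    unfolding xd_eq by (rule wd_fill) (simp only: assms * replicate_tie_exp)
qed

lemma gen_neq_X_iff: "g \<noteq> X \<longleftrightarrow> g = Y"
  by (cases g) auto

text \<open>Ties are powers of \<open>x\<close>, so by alternation the end of a block facing a tie
  is a power of \<open>y\<close>, and a block between two ties is not empty. Within the blocks the
  residue \<open>j\<close> does not occur, which turns the closed bounds of the word into the strict
  ones of Type 2.\<close>

lemma tied_type2_blocks:
  assumes syl: "syl ss" and j: "int k \<le> j" "j \<le> 2 * int k - 1" and \<tau>1: "\<tau>1 \<ge> 1"
    and bounds: "\<forall>a. (X, a) \<in> set ss \<longrightarrow> j - 2 * int k \<le> a \<and> a \<le> j"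
    and sep: "map (mark k j) ss = separated C (\<tau>1 + \<tau>2)"
  shows "type2_blocks k j \<tau>1 \<tau>2 (\<lambda>s. wd (C s))"
proof -
  have block: "syl (C s) \<and> (\<forall>a. (X, a) \<in> set (C s) \<longrightarrow> - 2 * int k + j + 1 \<le> a \<and> a \<le> j - 1) \<and>
      (s = 1 \<or> C s = [] \<and> s = \<tau>1 + \<tau>2 + 1 \<or> C s \<noteq> [] \<and> fst (hd (C s)) = Y) \<and>
      (s = \<tau>1 + \<tau>2 + 1 \<or> C s = [] \<and> s = 1 \<or> C s \<noteq> [] \<and> fst (last (C s)) = Y)"
    if s: "s \<in> {1..\<tau>1 + \<tau>2 + 1}" for s
  proof -
    obtain U V where UV: "separated C (\<tau>1 + \<tau>2) = U @ map Some (C s) @ V"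
      "if s = 1 then U = [] else U \<noteq> [] \<and> last U = None"
      "if s = \<tau>1 + \<tau>2 + 1 then V = [] else V \<noteq> [] \<and> hd V = None"
      using separated_block[OF s] by blast
    obtain U' R where R: "ss = U' @ R" "map (mark k j) R = map Some (C s) @ V" and U: "map (mark k j) U' = U"
      using sep UV(1) by (auto simp: map_eq_append_conv[of _ _ U])
    then obtain C' V' where "R = C' @ V'" and C: "map (mark k j) C' = map Some (C s)" and V: "map (mark k j) V' = V"
      by (metis map_eq_append_conv)
    then have ss: "ss = U' @ C' @ V'" using R by simp
    have C_eq: "C' = C s \<and> (\<forall>c\<in>set C'. red k c \<noteq> (X, j))" if "map (mark k j) C' = map Some D" "D = C s" for D C'
      using that(1) unfolding that(2)[symmetric]
      by (induction C' arbitrary: D) (auto simp: mark_def split: if_splits)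
    have C': "C' = C s" "\<forall>c\<in>set C'. red k c \<noteq> (X, j)" using C_eq[OF C HOL.refl] by auto
    have sylC: "syl (C s)" using syl by (simp add: ss C'(1) syl_append)
    have bnd: "- 2 * int k + j + 1 \<le> a \<and> a \<le> j - 1" if "(X, a) \<in> set (C s)" for a
    proof -
      have "j - 2 * int k \<le> a" "a \<le> j" using that bounds by (auto simp: ss C')
      \<comment> \<open>The residue excludes both ends of the interval at once.\<close>
      moreover have "a mod (2 * int k) \<noteq> j" using that C' by force
      then have "a \<noteq> j" "a \<noteq> j - 2 * int k" using j by (auto simp: mod_pos_pos_trivial)
      ultimately show ?thesis by linarith
    qed
    have U': "fst (last U') = X \<and> U' \<noteq> []" if "s \<noteq> 1"
      using UV(2) that U by (auto simp: last_map mark_def red_def split: if_splits)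
    have V': "fst (hd V') = X \<and> V' \<noteq> []" if "s \<noteq> \<tau>1 + \<tau>2 + 1"
      using UV(3) that V by (auto simp: hd_map mark_def red_def split: if_splits)
    have adj: "U' = [] \<or> C s @ V' = [] \<or> fst (last U') \<noteq> fst (hd (C s @ V'))"
      "C s = [] \<or> V' = [] \<or> fst (last (C s)) \<noteq> fst (hd V')"
      using syl unfolding ss C'(1) syl_append by auto
    have "s = 1 \<or> s = \<tau>1 + \<tau>2 + 1" if "C s = []" 
    proof (rule ccontr)
      assume "\<not> (s = 1 \<or> s = \<tau>1 + \<tau>2 + 1)"
      then show False using adj(1) that U' V' by simp
    qed
    moreover have "fst (hd (C s)) = Y" if "s \<noteq> 1" "C s \<noteq> []"
      using adj(1) that U' by (auto simp flip: gen_neq_X_iff)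
    moreover have "fst (last (C s)) = Y" if "s \<noteq> \<tau>1 + \<tau>2 + 1" "C s \<noteq> []"
      using adj(2) that V' by (auto simp flip: gen_neq_X_iff)
    ultimately show ?thesis using sylC bnd \<tau>1 by blast
  qed
  have "x_bounded (- 2 * int k + j + 1) (j - 1) (wd (C s))" if "s \<in> {1..\<tau>1 + \<tau>2 + 1}" for s
  proof -
    have C: "syl (C s)" "\<And>a. (X, a) \<in> set (C s) \<Longrightarrow> - 2 * int k + j + 1 \<le> a \<and> a \<le> j - 1"
      using block[OF that] by blast+
    obtain bs where "block_form bs" "bword bs = wd (C s)" "\<forall>(a, b)\<in>set bs. a \<noteq> 0 \<longrightarrow> (X, a) \<in> set (C s)"
      using blocks_of_sylls[OF C(1)] by blast
    then show ?thesis unfolding x_bounded_def using C(2) by (intro exI[of _ bs]) auto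
  qed
  moreover have "wd (C 1) = [] \<or> fst (last (wd (C 1))) = Y"
    using block[of 1] \<tau>1 wd_eq_Nil_iff last_wd[of "C 1"] by auto
  moreover have "wd (C (\<tau>1 + \<tau>2 + 1)) = [] \<or> fst (hd (wd (C (\<tau>1 + \<tau>2 + 1)))) = Y"
    using block[of "\<tau>1 + \<tau>2 + 1"] \<tau>1 wd_eq_Nil_iff hd_wd[of "C (\<tau>1 + \<tau>2 + 1)"] by auto
  moreover have "wd (C s) \<noteq> [] \<and> fst (hd (wd (C s))) = Y \<and> fst (last (wd (C s))) = Y"
    if "s \<in> {2..\<tau>1 + \<tau>2}" for s
  proof -
    have "syl (C s)" "C s \<noteq> []" "fst (hd (C s)) = Y" "fst (last (C s)) = Y"
      using block[of s] that by auto
    then show ?thesis using wd_eq_Nil_iff hd_wd last_wd by metis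
  qed
  ultimately show ?thesis using j \<tau>1 unfolding type2_blocks_def by blast
qed

text \<open>The strict bounds exclude the residue \<open>j\<close> within the blocks, so the ties
  are exactly the powers of \<open>x\<close> between them; the conditions on the ends of the blocks
  make the concatenation alternate.\<close>

lemma type2_blocks_sylls:
  assumes A: "type2_blocks k j \<tau>1 \<tau>2 A"
  shows "\<exists>ss. syl ss \<and> wd ss = type2_word k j \<tau>1 \<tau>2 A \<and>
    (\<forall>a. (X, a) \<in> set ss \<longrightarrow> j - 2 * int k \<le> a \<and> a \<le> j) \<and>
    filter (\<lambda>s. red k s = (X, j)) ss = replicate \<tau>1 (X, j) @ replicate \<tau>2 (X, j - 2 * int k)"
proof -
  let ?\<tau> = "\<tau>1 + \<tau>2"
  have j: "int k \<le> j" "j \<le> 2 * int k - 1" "\<tau>1 \<ge> 1" using A by (auto simp: type2_blocks_def)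
  have "\<exists>C. syl C \<and> wd C = A s \<and> (\<forall>a. (X, a) \<in> set C \<longrightarrow> j - 2 * int k < a \<and> a < j \<and> a \<noteq> 0)"
    if "s \<in> {1..?\<tau> + 1}" for s
  proof -
    have "x_bounded (- 2 * int k + j + 1) (j - 1) (A s)" using A that by (simp add: type2_blocks_def)
    then obtain bs where bs: "block_form bs" "A s = bword bs"
      "\<forall>(\<alpha>, \<beta>)\<in>set bs. \<alpha> \<noteq> 0 \<longrightarrow> - 2 * int k + j + 1 \<le> \<alpha> \<and> \<alpha> \<le> j - 1" unfolding x_bounded_def by blast
    then show ?thesis
      by (intro exI[of _ "block_sylls bs"]) (auto simp: syl_block_sylls wd_block_sylls set_block_sylls)
  qed
  then obtain C where C: "\<And>s. s \<in> {1..?\<tau> + 1} \<Longrightarrow> syl (C s) \<and> wd (C s) = A s \<and>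
      (\<forall>a. (X, a) \<in> set (C s) \<longrightarrow> j - 2 * int k < a \<and> a < j \<and> a \<noteq> 0)"
    by metis
  have C_filter: "filter (\<lambda>s. red k s = (X, j)) (C s) = []" if "s \<in> {1..?\<tau> + 1}" for s
  proof -
    have "a mod (2 * int k) \<noteq> j" if "(X, a) \<in> set (C s)" for a
    proof
      assume *: "a mod (2 * int k) = j"
      have "j - 2 * int k < a" "a < j" using C that \<open>s \<in> _\<close> by auto
      moreover have "j mod (2 * int k) = j" using j by (simp add: mod_pos_pos_trivial)
      ultimately show False using mod_eq_gap[of j "2 * int k" a] * j by simp
    qed
    then show ?thesis by (fastforce simp: filter_empty_conv red_def)
  qed
  have first: "A 1 = [] \<or> fst (last (A 1)) = Y"
    and last: "A (?\<tau> + 1) = [] \<or> fst (hd (A (?\<tau> + 1))) = Y"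
    and mid: "\<And>s. s \<in> {2..?\<tau>} \<Longrightarrow> A s \<noteq> [] \<and> fst (hd (A s)) = Y \<and> fst (List.last (A s)) = Y"
    using A by (auto simp: type2_blocks_def)
  have C_hd: "C s = [] \<or> fst (hd (C s)) = Y" if "s \<in> {2..?\<tau> + 1}" for s
  proof -
    have "A s = [] \<or> fst (hd (A s)) = Y" using last mid that by (cases "s = ?\<tau> + 1") auto
    then show ?thesis using C[of s] that hd_wd[of "C s"] wd_eq_Nil_iff[of "C s"] by auto
  qed
  have C_last: "C s = [] \<and> s = 1 \<or> C s \<noteq> [] \<and> fst (List.last (C s)) = Y" if "s \<in> {1..?\<tau>}" for s
  proof -
    have "A s = [] \<and> s = 1 \<or> A s \<noteq> [] \<and> fst (List.last (A s)) = Y" using first mid that by (cases "s = 1") auto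
    then show ?thesis using C[of s] that last_wd[of "C s"] wd_eq_Nil_iff[of "C s"] by auto
  qed
  define d where "d = tie_exp k j \<tau>1"
  have d: "d i \<noteq> 0" "j - 2 * int k \<le> d i" "d i \<le> j" "red k (X, d i) = (X, j)" for i
    using j tie_exp_mod[of k j \<tau>1 i] by (auto simp: d_def tie_exp_def)
  \<comment> \<open>The last clause allows the next power of \<open>x\<close> to be appended. It is
    not claimed for the final block, which may end in \<open>x\<close>.\<close>
  have "\<exists>ss. syl ss \<and> wd ss = A 1 @ concat (map (\<lambda>s. pw X (d (s - 1)) @ A s) [2..<m + 2]) \<and>
    (\<forall>a. (X, a) \<in> set ss \<longrightarrow> j - 2 * int k \<le> a \<and> a \<le> j) \<and>
    filter (\<lambda>s. red k s = (X, j)) ss = map (\<lambda>i. (X, d i)) [1..<1 + m] \<and>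
    (m < ?\<tau> \<longrightarrow> ss = [] \<or> fst (List.last ss) = Y)" if "m \<le> ?\<tau>" for m
    using that
  proof (induction m)
    case 0
    show ?case using C[of 1] C_last[of 1] C_filter[of 1] j
      by (intro exI[of _ "C 1"]) auto
  next
    case (Suc m)
    then obtain ss where ss: "syl ss" "wd ss = A 1 @ concat (map (\<lambda>s. pw X (d (s - 1)) @ A s) [2..<m + 2])"
      "\<forall>a. (X, a) \<in> set ss \<longrightarrow> j - 2 * int k \<le> a \<and> a \<le> j"
      "filter (\<lambda>s. red k s = (X, j)) ss = map (\<lambda>i. (X, d i)) [1..<1 + m]"
      "ss = [] \<or> fst (List.last ss) = Y" by auto
    have m: "m + 2 \<in> {1..?\<tau> + 1}" "m + 2 \<in> {2..?\<tau> + 1}" using Suc.prems by auto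
    let ?ts = "ss @ (X, d (m + 1)) # C (m + 2)"
    have 1: "syl ?ts" using ss(1,5) d(1) C[OF m(1)] C_hd[OF m(2)] by (auto simp: syl_append syl_Cons)
    have 2: "wd ?ts = A 1 @ concat (map (\<lambda>s. pw X (d (s - 1)) @ A s) [2..<Suc m + 2])"
      using ss(2) C[OF m(1)] by simp
    have 3: "\<forall>a. (X, a) \<in> set ?ts \<longrightarrow> j - 2 * int k \<le> a \<and> a \<le> j"
      using ss(3) d(2,3) C[OF m(1)] by force
    have 4: "filter (\<lambda>s. red k s = (X, j)) ?ts = map (\<lambda>i. (X, d i)) [1..<1 + Suc m]"
      using ss(4) d(4)[of "m + 1"] C_filter[OF m(1)] by simp
    have 5: "Suc m < ?\<tau> \<longrightarrow> ?ts = [] \<or> fst (List.last ?ts) = Y"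
      using C_last[of "m + 2"] by auto
    show ?case using 1 2 3 4 5 by blast
  qed
  from this[of ?\<tau>] show ?thesis
    unfolding type2_word_eq xd_eq replicate_tie_exp d_def[symmetric] by auto
qed

section \<open>Inversion of syllable lists\<close>

definition inv_sylls :: "syll list \<Rightarrow> syll list" where
  "inv_sylls ss = rev (map (\<lambda>(g, n). (g, - n)) ss)"

lemma wd_inv_sylls: "wd (inv_sylls ss) = winv (wd ss)"
  by (induction ss) (auto simp: inv_sylls_def)

lemma syl_inv_sylls: "syl ss \<Longrightarrow> syl (inv_sylls ss)"
proof (induction ss)
  case (Cons s ss)
  then show ?case
    by (cases s) (auto simp: inv_sylls_def syl_append syl_Cons last_rev hd_map case_prod_beta)
qed (simp add: inv_sylls_def)

lemma set_inv_sylls: "(g, a) \<in> set (inv_sylls ss) \<longleftrightarrow> (g, - a) \<in> set ss"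
  by (force simp: inv_sylls_def)

text \<open>Negation maps the window from \<open>\<theta> - 2k\<close> to
  \<open>\<theta> - 1\<close> onto the one from \<open>1 - \<theta>\<close> to
  \<open>2k - \<theta>\<close>, whose exclusive upper end is
  \<open>2k - \<theta> + 1\<close>.\<close>

lemma x_window_inv_sylls:
  assumes "x_window k c \<theta> ss"
  shows "x_window k (- c) (2 * int k - \<theta> + 1) (inv_sylls ss)"
  using assms unfolding x_window_def set_inv_sylls by (force simp: minus_le_iff)

text \<open>Negation changes the signs of the ties and reversal their order, so the positive ones
  stand first again, now \<open>\<tau>2\<close> of them with exponent \<open>2k - j\<close>.\<close>

lemma x_tied_inv_sylls:
  assumes "x_tied k j \<tau>1 \<tau>2 ss"
  shows "x_tied k (2 * int k - j) \<tau>2 \<tau>1 (inv_sylls ss)"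
proof -
  have j: "1 \<le> j" "j < 2 * int k" using assms by (auto simp: x_tied_def)
  have "(- a) mod (2 * int k) = 2 * int k - j \<longleftrightarrow> a mod (2 * int k) = j" for a
  proof -
    have "(- a) mod (2 * int k) = (if a mod (2 * int k) = 0 then 0 else 2 * int k - a mod (2 * int k))"
      by (rule zmod_zminus1_eq_if)
    then show ?thesis using j by auto
  qed
  then have "red k (case s of (g, n) \<Rightarrow> (g, - n)) = (X, 2 * int k - j) \<longleftrightarrow> red k s = (X, j)" for s
    by (cases s; cases "fst s") auto
  then have "filter (\<lambda>s. red k s = (X, 2 * int k - j)) (inv_sylls ss) =
      rev (map (\<lambda>(g, n). (g, - n)) (filter (\<lambda>s. red k s = (X, j)) ss))"
    by (simp add: inv_sylls_def filter_map comp_def flip: rev_filter)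
  also have "\<dots> = replicate \<tau>2 (X, 2 * int k - j) @ replicate \<tau>1 (X, - j)"
    using assms by (simp add: x_tied_def)
  finally show ?thesis using assms unfolding x_tied_def set_inv_sylls
    by (auto simp: minus_le_iff)
qed

lemma tied_type2_word:
  assumes "filter (\<lambda>s. red k s = (X, j)) ss = replicate \<tau>1 (X, j) @ replicate \<tau>2 (X, j - 2 * int k)"
    and "map (mark k j) ss = separated C (\<tau>1 + \<tau>2)"
  shows "wd ss = type2_word k j \<tau>1 \<tau>2 (\<lambda>s. wd (C s))"
  using wd_tied_fill(1)[OF assms(1)] unfolding assms(2) fill_separated type2_word_eq
  by (simp add: wd_def)

text \<open>The level \<open>j\<close> is the largest \<open>x\<close>-exponent, at least
  \<open>k\<close> by hypothesis. A window of \<open>2k\<close> integers contains its residue only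
  once, so there is no tie of the second kind.\<close>

lemma x_window_type2a:
  assumes "syl ss" "x_window k 0 \<theta> ss" "(X, a) \<in> set ss" "int k \<le> a" "k \<ge> 1"
  shows "wd ss \<in> type2a_pos k"
proof -
  define j where "j = Max (snd ` {s \<in> set ss. fst s = X})"
  have fin: "finite (snd ` {s \<in> set ss. fst s = X})" by simp
  have "j \<in> snd ` {s \<in> set ss. fst s = X}"
    unfolding j_def by (rule Max_in[OF fin]) (use assms(3) in force)
  then obtain s where "s \<in> set ss" "fst s = X" "j = snd s" by auto
  then have jss: "(X, j) \<in> set ss" by (metis prod.collapse)
  have max: "b \<le> j" if "(X, b) \<in> set ss" for b
    unfolding j_def by (rule Max_ge[OF fin]) (use that in force)
  have win: "\<theta> - 2 * int k \<le> b \<and> b < \<theta>" if "(X, b) \<in> set ss" for b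
    using x_windowD[OF assms(2) that] .
  have \<theta>: "\<theta> \<le> 2 * int k" using assms(2) by (auto simp: x_window_def)
  have j: "int k \<le> j" "j \<le> 2 * int k - 1" using max[OF assms(3)] assms(4) win[OF jss] \<theta> by linarith+
  have "s = (X, j)" if tie: "red k s = (X, j)" "s \<in> set ss" for s
  proof -
    obtain b where s: "s = (X, b)" and b: "b mod (2 * int k) = j" using tie(1) by (cases s) auto
    have "j mod (2 * int k) = j" using j by simp
    then have "\<not> b < j"
      using mod_eq_gap[of j "2 * int k" b] b win[OF jss] win[of b] tie(2) s assms(5) by fastforce
    then show ?thesis using max[of b] tie(2) s by simp
  qed
  moreover define F where "F = filter (\<lambda>s. red k s = (X, j)) ss"
  ultimately have F: "F = replicate (length F) (X, j)"
    by (intro replicate_eqI) auto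
  have "(X, j) \<in> set F" using jss j by (simp add: F_def)
  then have len: "length F \<ge> 1" by (cases F) auto
  obtain C where C: "map (mark k j) ss = separated C (length F + 0)"
    using separated_exists[of "map (mark k j) ss"] by (auto simp: nones_mark F_def)
  have "type2_blocks k j (length F) 0 (\<lambda>s. wd (C s))"
    by (rule tied_type2_blocks[OF assms(1) j len _ C]) (use max win win[OF jss] in fastforce)
  moreover have "wd ss = type2_word k j (length F) 0 (\<lambda>s. wd (C s))"
    by (rule tied_type2_word[OF _ C]) (use F F_def in simp)
  ultimately show ?thesis unfolding type2a_pos_def by blast
qed

text \<open>A nonzero \<open>c\<close> leads to Type 1 or its inverses. For \<open>c = 0\<close> the
  word is of Type 3 if no exponent reaches \<open>k\<close> in absolute value; otherwise the sign of
  such an exponent decides between Type 2a with \<open>j \<ge> k\<close> and an inverse of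
  it.\<close>

lemma sylls_setC:
  assumes "syl ss" "x_window k c \<theta> ss" "k \<ge> 1"
  shows "(wd ss, c) \<in> setC k"
proof -
  have pos: "(wd ss, c) \<in> type1_pos k" if ss: "syl ss" "x_window k c (2 * int k) ss" "c \<ge> 1" for ss c
  proof -
    obtain bs where bs: "block_form bs" "bword bs = wd ss" "\<forall>(a, b)\<in>set bs. a \<noteq> 0 \<longrightarrow> (X, a) \<in> set ss"
      using blocks_of_sylls[OF ss(1)] by blast
    have "0 \<le> a \<and> a \<le> 2 * int k - 1" if "(a, b) \<in> set bs" for a b
    proof (cases "a = 0")
      case False
      then have "(X, a) \<in> set ss" using bs(3) that by blast
      then show ?thesis using x_windowD[OF ss(2)] by fastforce
    qed (use assms(3) in simp)
    then show ?thesis using bs ss unfolding type1_pos_def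
      by (intro CollectI exI[of _ bs] exI[of _ c]) auto
  qed
  consider "c \<ge> 1" "\<theta> = 2 * int k" | "c \<le> - 1" "\<theta> = 1" | "c = 0" using assms(2) by (auto simp: x_window_def)
  then show ?thesis
  proof cases
    case 1
    then show ?thesis using pos assms by (simp add: setC_def type1_def)
  next
    case 2
    have "(wd (inv_sylls ss), - c) \<in> type1_pos k"
      using x_window_inv_sylls[OF assms(2)] 2 by (intro pos) (simp_all add: assms syl_inv_sylls)
    moreover have "(wd ss, c) = dinv (wd (inv_sylls ss), - c)" by (simp add: dinv_def wd_inv_sylls)
    ultimately show ?thesis unfolding setC_def type1_def by blast
  next
    case 3
    note win = assms(2)[unfolded 3]
    show ?thesis
    proof (cases "\<forall>a. (X, a) \<in> set ss \<longrightarrow> \<bar>a\<bar> \<le> int k - 1")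
      case True
      then show ?thesis using sylls_type3[OF assms(1)] assms(3) 3 by (simp add: setC_def)
    next
      case False
      then obtain a where a: "(X, a) \<in> set ss" "int k \<le> \<bar>a\<bar>" by force
      show ?thesis
      proof (cases "a \<ge> 0")
        case True
        then show ?thesis using x_window_type2a[OF assms(1) win a(1)] a assms(3) 3
          by (simp add: setC_def type2a_def)
      next
        case False
        have "wd (inv_sylls ss) \<in> type2a_pos k"
          using False a assms(3)
          by (intro x_window_type2a[OF syl_inv_sylls[OF assms(1)] x_window_inv_sylls[OF win, simplified], of "- a"])
            (auto simp: set_inv_sylls)
        then have "winv (wd (inv_sylls ss)) \<in> type2a k" unfolding type2a_def by blast
        then show ?thesis using 3 by (simp add: setC_def wd_inv_sylls)
      qed
    qed
  qed
qed

lemma setC_sylls: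
  assumes "u \<in> setC k" "k \<ge> 1"
  shows "\<exists>ss \<theta>. syl ss \<and> wd ss = fst u \<and> x_window k (snd u) \<theta> ss"
proof -
  have pos1: "\<exists>ss. syl ss \<and> wd ss = fst u \<and> x_window k (snd u) (2 * int k) ss" if "u \<in> type1_pos k" for u
  proof -
    obtain bs c where "u = (bword bs, c)" "c \<ge> 1" "block_form bs" "\<forall>(\<mu>, \<epsilon>)\<in>set bs. 0 \<le> \<mu> \<and> \<mu> \<le> 2 * int k - 1"
      using \<open>u \<in> type1_pos k\<close> unfolding type1_pos_def by blast
    then show ?thesis
      by (intro exI[of _ "block_sylls bs"])
        (force simp: syl_block_sylls wd_block_sylls x_window_def set_block_sylls)
  qed
  have pos2: "\<exists>ss \<theta>. syl ss \<and> wd ss = w \<and> x_window k 0 \<theta> ss" if w: "w \<in> type2a_pos k" for w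
  proof -
    obtain j \<tau>1 A where A: "w = type2_word k j \<tau>1 0 A" "type2_blocks k j \<tau>1 0 A"
      using w unfolding type2a_pos_def by blast
    then obtain ss where ss: "syl ss" "wd ss = w" "\<forall>a. (X, a) \<in> set ss \<longrightarrow> j - 2 * int k \<le> a \<and> a \<le> j"
      "filter (\<lambda>s. red k s = (X, j)) ss = replicate \<tau>1 (X, j)"
      using type2_blocks_sylls[OF A(2)] by auto
    have j: "int k \<le> j" "j \<le> 2 * int k - 1" using A by (auto simp: type2_blocks_def)
    \<comment> \<open>Its residue is \<open>j\<close>, but all syllables of this residue are
      \<open>(X, j)\<close>. Hence the lower bound is strict and \<open>j + 1\<close> is the upper
      end of a window.\<close>
    have "(X, j - 2 * int k) \<notin> set ss"
    proof
      assume "(X, j - 2 * int k) \<in> set ss"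
      then have "(X, j - 2 * int k) \<in> set (filter (\<lambda>s. red k s = (X, j)) ss)" using j by simp
      then show False using ss(4) assms(2) by (auto split: if_splits)
    qed
    then have "j - 2 * int k < a" if "(X, a) \<in> set ss" for a
      using ss(3) that by (metis order_le_less)
    then have "x_window k 0 (j + 1) ss" using ss(3) j assms(2) unfolding x_window_def by force
    then show ?thesis using ss by blast
  qed
  have inverse: "\<exists>ss \<theta>. syl ss \<and> wd ss = winv w \<and> x_window k (- c) \<theta> ss"
    if "syl ss" "wd ss = w" "x_window k c \<theta> ss" for ss w c \<theta>
    using syl_inv_sylls[OF that(1)] wd_inv_sylls[of ss] x_window_inv_sylls[OF that(3)] that(2) by blast
  consider "u \<in> type1_pos k" | v where "v \<in> type1_pos k" "u = dinv v"
    | w where "w \<in> type2a_pos k" "u = (w, 0)" | w where "w \<in> type2a_pos k" "u = (winv w, 0)"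
    | w where "w \<in> type3 k" "u = (w, 0)"
    using assms(1) unfolding setC_def type1_def type2a_def by blast
  then show ?thesis
  proof cases
    case 1
    then show ?thesis using pos1 by blast
  next
    case 2
    then show ?thesis using pos1[of v] inverse by (fastforce simp: dinv_def)
  next
    case 3
    then show ?thesis using pos2 by simp
  next
    case 4
    then show ?thesis using pos2[of w] inverse[where c = 0] by fastforce
  next
    case 5
    then obtain ss where "syl ss" "wd ss = w" "\<forall>a. (X, a) \<in> set ss \<longrightarrow> \<bar>a\<bar> \<le> int k - 1"
      using type3_sylls assms(2) by blast
    \<comment> \<open>The window from \<open>- k\<close> to \<open>k - 1\<close> contains all
      exponents of Type 3.\<close>
    then show ?thesis using 5 assms(2)
      by (intro exI[of _ ss] exI[of _ "int k"]) (fastforce simp: x_window_def)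
  qed
qed

lemma x_tied_type2b_pos:
  assumes "syl ss" "x_tied k j \<tau>1 \<tau>2 ss" "int k \<le> j"
  shows "wd ss \<in> type2b_pos k"
proof -
  have tied: "j \<le> 2 * int k - 1" "\<tau>1 \<ge> 1" "\<tau>2 \<ge> 1"
    "\<forall>a. (X, a) \<in> set ss \<longrightarrow> j - 2 * int k \<le> a \<and> a \<le> j"
    "filter (\<lambda>s. red k s = (X, j)) ss = replicate \<tau>1 (X, j) @ replicate \<tau>2 (X, j - 2 * int k)"
    using assms(2) by (auto simp: x_tied_def)
  obtain C where C: "map (mark k j) ss = separated C (\<tau>1 + \<tau>2)"
    using separated_exists[of "map (mark k j) ss"] wd_tied_fill(2)[OF tied(5)] by auto
  show ?thesis
    using tied_type2_blocks[OF assms(1,3) tied(1,2,4) C] tied_type2_word[OF tied(5) C] tied(3)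
    unfolding type2b_pos_def by blast
qed

text \<open>Type 2b is formulated for \<open>j \<ge> k\<close>; a smaller level becomes
  \<open>2k - j > k\<close> by inversion.\<close>

lemma sylls_type2b:
  assumes "syl ss" "x_tied k j \<tau>1 \<tau>2 ss"
  shows "wd ss \<in> type2b k"
proof (cases "int k \<le> j")
  case True
  then show ?thesis using x_tied_type2b_pos assms by (simp add: type2b_def)
next
  case False
  then have "wd (inv_sylls ss) \<in> type2b_pos k"
    using x_tied_type2b_pos[OF syl_inv_sylls[OF assms(1)] x_tied_inv_sylls[OF assms(2)]] by simp
  then have "winv (wd (inv_sylls ss)) \<in> type2b k" unfolding type2b_def by blast
  then show ?thesis by (simp add: wd_inv_sylls)
qed

lemma type2b_sylls:
  assumes "w \<in> type2b k"
  shows "\<exists>ss j \<tau>1 \<tau>2. syl ss \<and> wd ss = w \<and> x_tied k j \<tau>1 \<tau>2 ss"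
proof -
  have pos: "\<exists>ss j \<tau>1 \<tau>2. syl ss \<and> wd ss = w \<and> x_tied k j \<tau>1 \<tau>2 ss" if w: "w \<in> type2b_pos k" for w
  proof -
    obtain j \<tau>1 \<tau>2 A where A: "w = type2_word k j \<tau>1 \<tau>2 A" "\<tau>2 \<ge> 1" "type2_blocks k j \<tau>1 \<tau>2 A"
      using w unfolding type2b_pos_def by blast
    then obtain ss where "syl ss" "wd ss = w" "\<forall>a. (X, a) \<in> set ss \<longrightarrow> j - 2 * int k \<le> a \<and> a \<le> j"
      "filter (\<lambda>s. red k s = (X, j)) ss = replicate \<tau>1 (X, j) @ replicate \<tau>2 (X, j - 2 * int k)"
      using type2_blocks_sylls[OF A(3)] by auto
    moreover have "1 \<le> j" "j < 2 * int k" "\<tau>1 \<ge> 1" using A(3) by (auto simp: type2_blocks_def)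
    ultimately have "syl ss \<and> wd ss = w \<and> x_tied k j \<tau>1 \<tau>2 ss" using A(2) by (simp add: x_tied_def)
    then show ?thesis by blast
  qed
  consider "w \<in> type2b_pos k" | v where "v \<in> type2b_pos k" "w = winv v"
    using assms unfolding type2b_def by blast
  then show ?thesis
  proof cases
    case 1
    then show ?thesis by (rule pos)
  next
    case 2
    then show ?thesis using pos[of v] syl_inv_sylls wd_inv_sylls x_tied_inv_sylls by metis
  qed
qed

section \<open>Representatives as cyclically reduced syllable lists\<close>

lemma Cbar_sylls:
  assumes "u \<in> Cbar k" "k \<ge> 1"
  shows "\<exists>ss \<theta>. syl ss \<and> cyc ss \<and> wd ss = fst u \<and> x_window k (snd u) \<theta> ss"
proof -
  obtain ss \<theta> where ss: "syl ss" "wd ss = fst u" "x_window k (snd u) \<theta> ss"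
    using setC_sylls assms unfolding Cbar_def by blast
  obtain bs where bs: "block_form bs" "fst u = bword bs"
    "length bs \<ge> 2 \<longrightarrow> (fst (hd bs) = 0 \<longleftrightarrow> snd (last bs) = 0)" using assms unfolding Cbar_def by blast
  have "cyc ss" using bword_cyclic_sylls[OF bs(1) ss(1) _ bs(3)] ss(2) bs(2) by simp
  then show ?thesis using ss by blast
qed

lemma sylls_Cbar:
  assumes "syl ss" "cyc ss" "x_window k c \<theta> ss" "k \<ge> 1"
  shows "(wd ss, c) \<in> Cbar k"
proof -
  obtain bs where bs: "block_form bs" "bword bs = wd ss"
    "fst (hd bs) \<noteq> 0 \<longleftrightarrow> ss \<noteq> [] \<and> fst (hd ss) = X" "snd (last bs) \<noteq> 0 \<longleftrightarrow> ss \<noteq> [] \<and> fst (last ss) = Y"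
    using blocks_of_sylls[OF assms(1)] by blast
  have "fst (hd bs) = 0 \<longleftrightarrow> snd (last bs) = 0" if len: "length bs \<ge> 2"
  proof -
    obtain a b c d r where bs': "bs = (a, b) # (c, d) # r"
      using len by (cases bs; cases "tl bs") auto
    \<comment> \<open>Inner exponents of a block form do not vanish, so both generators occur and
      \<open>cyc\<close> compares the ends of at least two syllables.\<close>
    have "b \<noteq> 0" "c \<noteq> 0" using bs(1) by (auto simp: bs' block_form_Cons)
    then have "(Y, b < 0) \<in> set (wd ss)" "(X, c < 0) \<in> set (wd ss)"
      unfolding bs(2)[symmetric] bs' by (auto simp: pw_def)
    then have two: "X \<in> fst ` set (wd ss)" "Y \<in> fst ` set (wd ss)" by force+
    have "length ss \<ge> 2"
    proof (rule ccontr)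
      assume "\<not> length ss \<ge> 2"
      then have "ss = [] \<or> (\<exists>g n. ss = [(g, n)])"
        by (cases ss; cases "tl ss") auto
      then show False
      proof (elim disjE exE)
        fix g n assume "ss = [(g, n)]"
        then have "set (wd ss) \<subseteq> {(g, n < 0)}" by (auto simp: pw_def)
        then show False using two by (metis (no_types, lifting) gen.distinct(1) image_iff singletonD subset_iff fst_conv)
      qed (use two in simp)
    qed
    then have "ss \<noteq> []" "fst (hd ss) \<noteq> fst (last ss)" using assms(2) by (auto simp: cyc_def)
    then show ?thesis using bs(3,4) by (cases "fst (hd ss)"; cases "fst (last ss)") simp_all
  qed
  then show ?thesis using sylls_setC[OF assms(1,3,4)] bs unfolding Cbar_def by auto
qed

lemma Dbar_sylls:
  assumes "w \<in> Dbar k"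
  shows "\<exists>ss j \<tau>1 \<tau>2. syl ss \<and> cyc ss \<and> wd ss = w \<and> x_tied k j \<tau>1 \<tau>2 ss"
proof -
  obtain ss j \<tau>1 \<tau>2 where ss: "syl ss" "wd ss = w" "x_tied k j \<tau>1 \<tau>2 ss"
    using type2b_sylls assms unfolding Dbar_def by blast
  have "ss \<noteq> []" using x_tiedD(1)[OF ss(3)] by auto
  then have "cyc ss" using assms ss(2) hd_wd[OF ss(1)] last_wd[OF ss(1)] by (auto simp: Dbar_def cyc_def)
  then show ?thesis using ss by blast
qed

lemma sylls_Dbar:
  assumes "syl ss" "cyc ss" "x_tied k j \<tau>1 \<tau>2 ss"
  shows "wd ss \<in> Dbar k"
proof -
  \<comment> \<open>The two kinds of ties are different syllables, so the list is long enough for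
    \<open>cyc\<close> to separate its ends.\<close>
  have "j \<noteq> j - 2 * int k" using assms(3) by (auto simp: x_tied_def)
  then have "\<not> length ss \<le> 1"
    using x_tiedD[OF assms(3)] by (cases ss; cases "tl ss") auto
  then have "ss \<noteq> []" "fst (hd ss) \<noteq> fst (last ss)" using assms(2) by (auto simp: cyc_def)
  then show ?thesis
    using hd_wd[OF assms(1)] last_wd[OF assms(1)] sylls_type2b[OF assms(1,3)] by (simp add: Dbar_def)
qed

section \<open>Reduction to a representative\<close>

text \<open>Inserted syllables have residue \<open>j\<close> and are ties again, so overwriting the
  ties preserves residues and marks.\<close>

lemma refill:
  assumes d: "\<And>i. red k (X, d i) = (X, j)"
  shows "map (red k) (fill (\<lambda>s. [s]) (\<lambda>i. [(X, d i)]) i (map (mark k j) ss)) = map (red k) ss"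
    and "map (mark k j) (fill (\<lambda>s. [s]) (\<lambda>i. [(X, d i)]) i (map (mark k j) ss)) = map (mark k j) ss"
    and "filter (\<lambda>s. red k s = (X, j)) (fill (\<lambda>s. [s]) (\<lambda>i. [(X, d i)]) i (map (mark k j) ss)) =
      map (\<lambda>i. (X, d i)) [i..<i + nones (map (mark k j) ss)]"
    and "set (fill (\<lambda>s. [s]) (\<lambda>i. [(X, d i)]) i (map (mark k j) ss)) \<subseteq> set ss \<union> range (\<lambda>i. (X, d i))"
proof (induction ss arbitrary: i)
  case (Cons s ss)
  {
    case 1
    show ?case using Cons(1) d by (cases "red k s = (X, j)") (simp_all add: mark_def[of k j s])
  next
    case 2
    show ?case using Cons(2) d by (cases "red k s = (X, j)") (simp_all add: mark_def[of k j s] mark_def[of k j "(X, d i)"])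
  next
    case 3
    show ?case
    proof (cases "red k s = (X, j)")
      case True
      have "[i..<i + Suc n] = i # [Suc i..<Suc i + n]" for n by (simp add: upt_conv_Cons del: upt_Suc)
      then show ?thesis using Cons(3)[of "Suc i"] d True by (simp add: mark_def[of k j s] del: upt_Suc)
    next
      case False
      then show ?thesis using Cons(3) by (simp add: mark_def[of k j s] del: upt_Suc)
    qed
  next
    case 4
    show ?case using Cons(4)[of i] Cons(4)[of "Suc i"]
      by (cases "red k s = (X, j)") (auto simp: mark_def[of k j s])
  }
qed simp_all

lemma sum_list_two_values:
  fixes f :: "'a \<Rightarrow> 'b::comm_semiring_1"
  assumes "set F \<subseteq> {u, v}" "u \<noteq> v"
  shows "sum_list (map f F) = of_nat (count_list F u) * f u + of_nat (count_list F v) * f v"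
  using assms by (induction F) (auto simp: algebra_simps)

text \<open>The ties are put into the order demanded by \<open>x_tied\<close> without changing the
  number of either kind, so length and exponent sum remain. Residues remain entry by entry, and with
  them the class modulo the centre.\<close>

lemma tied_reorder:
  assumes ss: "syl ss" "cyc ss"
    and bounds: "\<forall>a. (X, a) \<in> set ss \<longrightarrow> j - 2 * int k \<le> a \<and> a \<le> j"
    and mem: "(X, j) \<in> set ss" "(X, j - 2 * int k) \<in> set ss" and j: "1 \<le> j" "j < 2 * int k"
  shows "\<exists>ts \<tau>1 \<tau>2. syl ts \<and> cyc ts \<and> x_tied k j \<tau>1 \<tau>2 ts \<and> modconj k (wd ss) (wd ts) \<and>
    expsum X (wd ts) = expsum X (wd ss) \<and> length (wd ts) = length (wd ss)"
proof -
  define F where "F = filter (\<lambda>s. red k s = (X, j)) ss"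
  define \<tau>1 \<tau>2 where "\<tau>1 = count_list F (X, j)" and "\<tau>2 = count_list F (X, j - 2 * int k)"
  have F: "set F \<subseteq> {(X, j), (X, j - 2 * int k)}" "(X, j) \<noteq> (X, j - 2 * int k)"
  proof
    fix s assume "s \<in> set F"
    then have "red k s = (X, j)" "s \<in> set ss" by (simp_all add: F_def)
    then obtain a where s: "s = (X, a)" "a mod (2 * int k) = j" "(X, a) \<in> set ss"
      by (cases s) simp
    have "a = j \<or> a = j - 2 * int k"
    proof (cases "a < j")
      case True
      have "a \<le> j - 2 * int k" using mod_eq_gap[of j "2 * int k" a] s(2) j True by simp
      then show ?thesis using bounds s(3) by force
    next
      case False
      then show ?thesis using bounds s(3) by force
    qed
    then show "s \<in> {(X, j), (X, j - 2 * int k)}" using s by auto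
  qed (use j in simp)
  have nones: "nones (map (mark k j) ss) = \<tau>1 + \<tau>2"
    using sum_list_two_values[OF F, of "\<lambda>_. 1 :: nat"] by (simp add: nones_mark F_def \<tau>1_def \<tau>2_def sum_list_triv)
  have "(X, j) \<in> set F" "(X, j - 2 * int k) \<in> set F" using mem j by (auto simp: F_def)
  then have \<tau>: "\<tau>1 \<ge> 1" "\<tau>2 \<ge> 1"
    by (auto simp: \<tau>1_def \<tau>2_def Suc_le_eq count_list_0_iff simp flip: neq0_conv)
  define d where "d = tie_exp k j \<tau>1"
  have d: "d i \<noteq> 0" "j - 2 * int k \<le> d i" "d i \<le> j" "red k (X, d i) = (X, j)" for i
    using j tie_exp_mod[of k j \<tau>1 i] by (auto simp: d_def tie_exp_def)
  define ts where "ts = fill (\<lambda>s. [s]) (\<lambda>i. [(X, d i)]) 1 (map (mark k j) ss)"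
  have red: "map (red k) ts = map (red k) ss" and mark: "map (mark k j) ts = map (mark k j) ss"
    and filt: "filter (\<lambda>s. red k s = (X, j)) ts = map (\<lambda>i. (X, d i)) [1..<1 + nones (map (mark k j) ss)]"
    and set: "set ts \<subseteq> set ss \<union> range (\<lambda>i. (X, d i))"
    unfolding ts_def using refill[of k d j 1 ss] d(4) by auto
  \<comment> \<open>Alternation depends on the generators alone and can be read off from the
    residues, where both lists agree.\<close>
  have alt: "alternating us \<longleftrightarrow> alternating (map (red k) us)" for us
    by (simp add: successively_map)
  have "syl ts"
    using ss(1) set d(1) unfolding syl_def alt[of ts] alt[of ss] red by fastforce
  moreover have "cyc ts" using ss(2) cyc_red[of k ts] cyc_red[of k ss] red by simp
  moreover have tied: "x_tied k j \<tau>1 \<tau>2 ts"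
    unfolding x_tied_def replicate_tie_exp d_def[symmetric]
    using j \<tau> set bounds d(2,3) filt nones by fastforce
  moreover have "modconj k (wd ss) (wd ts)"
    using modconj_trans[OF modconj_wd_red modconj_sym[OF modconj_wd_red[of k ts, unfolded red]]] .
  moreover have sum: "sum_list (map f ts) = sum_list (map f ss)" for f :: "syll \<Rightarrow> 'b::comm_semiring_1"
    using sum_list_tied[OF tied, of f] sum_list_mark[of f ss k j] sum_list_two_values[OF F, of f]
    by (simp add: mark F_def[symmetric] \<tau>1_def \<tau>2_def)
  moreover have "expsum X (wd ts) = expsum X (wd ss)" by (simp add: expsum_X_wd sum)
  moreover have "length (wd ts) = length (wd ss)" unfolding length_wd by (rule sum)
  ultimately show ?thesis by blast
qed

lemma sylls_or_cancel: "(\<exists>ss. syl ss \<and> wd ss = w) \<or> (\<exists>u a b v. w = u @ [(a, b), (a, \<not> b)] @ v)"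
proof (induction w)
  case Nil
  show ?case by (intro disjI1 exI[of _ "[]"]) simp
next
  case (Cons l w)
  obtain g b where l: "l = (g, b)" by (cases l)
  define e :: int where "e = (if b then -1 else 1)"
  have e: "[l] = pw g e" by (simp add: e_def pw_def l)
  show ?case
  proof (cases "\<exists>u a b v. w = u @ [(a, b), (a, \<not> b)] @ v")
    case True
    then obtain u a b v where "l # w = (l # u) @ [(a, b), (a, \<not> b)] @ v" by auto
    then show ?thesis by blast
  next
    case False
    then obtain ss where ss: "syl ss" "wd ss = w" using Cons by blast
    show ?thesis
    proof (cases "ss = [] \<or> fst (hd ss) \<noteq> g")
      case True
      have "syl ((g, e) # ss)" "wd ((g, e) # ss) = l # w"
        using True ss e[symmetric] by (auto simp: syl_Cons e_def)
      then show ?thesis by blast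
    next
      case False
      then obtain n r where r: "ss = (g, n) # r" by (cases ss) auto
      show ?thesis
      proof (cases "0 \<le> e * n")
        case True
        have n: "n \<noteq> 0" using ss r by (simp add: syl_Cons)
        have "e + n \<noteq> 0" using True n by (auto simp: e_def split: if_splits)
        then have "syl ((g, e + n) # r)" using ss by (auto simp: r syl_Cons)
        moreover have "wd ((g, e + n) # r) = l # w"
          using ss(2) e pw_add_same_sign[OF True, of g] by (simp add: r) (metis append_Cons append_Nil append_assoc)
        ultimately show ?thesis by blast
      next
        case False
        then have "(n < 0) = (\<not> b)" "n \<noteq> 0" by (auto simp: e_def split: if_splits)
        then have "pw g n = (g, \<not> b) # replicate (nat \<bar>n\<bar> - 1) (g, \<not> b)"
          by (cases "nat \<bar>n\<bar>") (auto simp: pw_def)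
        then have "l # w = [] @ [(g, b), (g, \<not> b)] @ (replicate (nat \<bar>n\<bar> - 1) (g, \<not> b) @ wd r)"
          using ss(2) by (simp add: r l)
        then show ?thesis by blast
      qed
    qed
  qed
qed

text \<open>The length of \<open>expand k (w, c)\<close>.\<close>

definition cost :: "nat \<Rightarrow> xyword \<Rightarrow> int \<Rightarrow> int" where
  "cost k w c = int (length w) + 2 * int k * \<bar>c\<bar>"

text \<open>Weighting \<open>\<Delta>\<close> by \<open>2k - 1\<close> instead of its length \<open>2k\<close> makes the extraction of a full
  twist from a power of \<open>x\<close> count as progress although it preserves the length.\<close>

definition progress :: "nat \<Rightarrow> xyword \<Rightarrow> int \<Rightarrow> int" where
  "progress k w c = int (length w) + (2 * int k - 1) * \<bar>c\<bar>"

text \<open>The claim carried through the reduction: the element of \<open>expand k (w, c)\<close>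
  has a representative in its conjugacy class that is not longer. Keeping \<open>c\<close> apart
  from \<open>w\<close> lets full twists be moved between them.\<close>

definition represented :: "nat \<Rightarrow> xyword \<Rightarrow> int \<Rightarrow> bool" where
  "represented k w c \<longleftrightarrow> (\<exists>v d. modconj k w v \<and>
    expsum X w + 2 * int k * c = expsum X v + 2 * int k * d \<and> cost k v d \<le> cost k w c \<and>
    ((v, d) \<in> Cbar k \<or> d = 0 \<and> v \<in> Dbar k))"

lemma represented_trans:
  assumes "represented k v d" "modconj k w v"
    and "expsum X w + 2 * int k * c = expsum X v + 2 * int k * d" "cost k v d \<le> cost k w c"
  shows "represented k w c"
  using assms unfolding represented_def by (metis (no_types, lifting) modconj_trans order_trans)

lemma in_set_two_split:
  assumes "u \<in> set xs" "v \<in> set xs" "u \<noteq> v"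
  shows "\<exists>l m r. xs = l @ u # m @ v # r \<or> xs = l @ v # m @ u # r"
proof -
  obtain l r where xs: "xs = l @ u # r" using split_list[OF assms(1)] by blast
  then consider "v \<in> set l" | "v \<in> set r" using assms by auto
  then show ?thesis
  proof cases
    case 1
    then obtain l' m where "l = l' @ v # m" by (meson split_list)
    then show ?thesis using xs by (intro exI[of _ l'] exI[of _ m] exI[of _ r]) simp
  next
    case 2
    then obtain m r' where "r = m @ v # r'" by (meson split_list)
    then show ?thesis using xs by (intro exI[of _ l] exI[of _ m] exI[of _ r']) simp
  qed
qed

text \<open>Two moves keep the class: \<open>shift\<close> trades full twists between an
  \<open>x\<close>-exponent and \<open>c\<close>, \<open>exchange\<close> between two
  \<open>x\<close>-exponents. If no move makes progress, then for \<open>c \<noteq> 0\<close> the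
  exponents already lie in the window of \<open>c\<close>. For \<open>c = 0\<close> they spread over
  at most \<open>2k\<close>; equality means that both ties occur, and a smaller spread gives a
  window.\<close>

lemma cyc_sylls_represented:
  assumes k: "k \<ge> 1" and ss: "syl ss" "cyc ss"
    and IH: "\<And>v d. progress k v d < progress k (wd ss) c \<Longrightarrow> represented k v d"
  shows "represented k (wd ss) c"
proof -
  have shift: "represented k (wd ss) c"
    if a: "(X, a) \<in> set ss"
      and le: "\<bar>a + 2 * int k * m\<bar> + 2 * int k * \<bar>c - m\<bar> \<le> \<bar>a\<bar> + 2 * int k * \<bar>c\<bar>"
      and less: "\<bar>a + 2 * int k * m\<bar> + (2 * int k - 1) * \<bar>c - m\<bar> < \<bar>a\<bar> + (2 * int k - 1) * \<bar>c\<bar>" for a m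
  proof -
    obtain l r where lr: "ss = l @ (X, a) # r" using split_list[OF a] by blast
    define v where "v = wd l @ pw X (a + 2 * int k * m) @ wd r"
    have "represented k v (c - m)"
      by (rule IH) (use less in \<open>simp add: progress_def v_def lr\<close>)
    then show ?thesis
    proof (rule represented_trans)
      show "modconj k (wd ss) v" using modconj_shift[of k "wd l" a "wd r" m] by (simp add: v_def lr)
      show "expsum X (wd ss) + 2 * int k * c = expsum X v + 2 * int k * (c - m)"
        by (simp add: v_def lr algebra_simps)
      show "cost k v (c - m) \<le> cost k (wd ss) c" using le by (simp add: cost_def v_def lr)
    qed
  qed
  have exchange: "represented k (wd ss) c"
    if lr: "ss = l @ (X, a) # m @ (X, b) # r"
      and less: "\<bar>a + 2 * int k * e\<bar> + \<bar>b - 2 * int k * e\<bar> < \<bar>a\<bar> + \<bar>b\<bar>" for l a m b r e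
  proof -
    define v where "v = wd l @ pw X (a + 2 * int k * e) @ wd m @ pw X (b - 2 * int k * e) @ wd r"
    have "represented k v c"
      by (rule IH) (use less in \<open>simp add: progress_def v_def lr\<close>)
    then show ?thesis
    proof (rule represented_trans)
      have "modconj k (wd ss) (wd l @ pw X (a + 2 * int k * e) @ (wd m @ pw X b @ wd r))"
        using modconj_shift[of k "wd l" a "wd m @ pw X b @ wd r" e] by (simp add: lr)
      also have "modconj k \<dots> v"
        using modconj_shift[of k "wd l @ pw X (a + 2 * int k * e) @ wd m" b "wd r" "- e"] by (simp add: v_def)
      finally show "modconj k (wd ss) v" .
      show "expsum X (wd ss) + 2 * int k * c = expsum X v + 2 * int k * c"
        by (simp add: v_def lr)
      show "cost k v c \<le> cost k (wd ss) c" using less by (simp add: cost_def v_def lr)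
    qed
  qed
  have window: "represented k (wd ss) c" if "x_window k c \<theta> ss" for \<theta>
    using sylls_Cbar[OF ss that k] modconj_refl unfolding represented_def by blast
  show ?thesis
  proof (rule ccontr)
    assume not: "\<not> represented k (wd ss) c"
    have neg: "0 \<le> a" if "c \<ge> 1" "(X, a) \<in> set ss" for a
    proof (rule ccontr)
      assume "\<not> 0 \<le> a"
      \<comment> \<open>Taking one twist out of \<open>c\<close> frees the weight
        \<open>2k - 1\<close>, while the absolute value of a negative exponent grows by at most
        \<open>2k - 2\<close>.\<close>
      then have "\<bar>a + 2 * int k\<bar> \<le> \<bar>a\<bar> + 2 * int k - 2" using k by linarith
      then show False using shift[OF that(2), of 1] not that(1) \<open>\<not> 0 \<le> a\<close> by (simp add: algebra_simps)
    qed
    have pos: "a \<le> 0" if "c \<le> - 1" "(X, a) \<in> set ss" for a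
    proof (rule ccontr)
      assume "\<not> a \<le> 0"
      then have "\<bar>a - 2 * int k\<bar> \<le> \<bar>a\<bar> + 2 * int k - 2" using k by linarith
      then show False using shift[OF that(2), of "- 1"] not that(1) \<open>\<not> a \<le> 0\<close> by (simp add: algebra_simps)
    qed
    have upper: "a < 2 * int k" if "c \<ge> 0" "(X, a) \<in> set ss" for a
    proof (rule ccontr)
      assume "\<not> a < 2 * int k"
      then show False using shift[OF that(2), of "- 1"] not that(1) k by (simp add: algebra_simps)
    qed
    have lower: "- 2 * int k < a" if "c \<le> 0" "(X, a) \<in> set ss" for a
    proof (rule ccontr)
      assume "\<not> - 2 * int k < a"
      then show False using shift[OF that(2), of 1] not that(1) k by (simp add: algebra_simps)
    qed
    consider "c \<ge> 1" | "c \<le> - 1" | "c = 0" by linarith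
    then show False
    proof cases
      case 1
      have "x_window k c (2 * int k) ss" using 1 neg upper by (simp add: x_window_def)
      then show False using window not by blast
    next
      case 2
      have "x_window k c 1 ss" using 2 pos lower by (force simp: x_window_def)
      then show False using window not by blast
    next
      case 3
      have gap: "a - b \<le> 2 * int k" if mem: "(X, a) \<in> set ss" "(X, b) \<in> set ss" for a b
      proof (rule ccontr)
        assume big: "\<not> a - b \<le> 2 * int k"
        have ab: "a < 2 * int k" "- 2 * int k < b" using upper lower that 3 by auto
        have "(X, a) \<noteq> (X, b)" using big k by auto
        then obtain l m r where "ss = l @ (X, a) # m @ (X, b) # r \<or> ss = l @ (X, b) # m @ (X, a) # r"
          using in_set_two_split[OF mem] by blast
        \<comment> \<open>By \<open>ab\<close> the absolute values of the new exponents add up to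
          \<open>4k - (a - b)\<close>, which is less than \<open>2k\<close> and hence less than
          \<open>a - b\<close>.\<close>
        then show False
          using exchange[of l a m b r "- 1"] exchange[of l b m a r 1] not big ab by auto
      qed
      show False
      proof (cases "\<exists>a b. (X, a) \<in> set ss \<and> (X, b) \<in> set ss \<and> a - b = 2 * int k")
        case True
        then obtain j where j: "(X, j) \<in> set ss" "(X, j - 2 * int k) \<in> set ss"
          by (metis add_diff_cancel_left' diff_add_cancel diff_diff_eq2)
        have "1 \<le> j" "j < 2 * int k" using upper[OF _ j(1)] lower[OF _ j(2)] 3 by auto
        moreover have "\<forall>a. (X, a) \<in> set ss \<longrightarrow> j - 2 * int k \<le> a \<and> a \<le> j"
          using gap[OF j(1)] gap[OF _ j(2)] by fastforce
        ultimately obtain ts \<tau>1 \<tau>2 where "syl ts" "cyc ts" "x_tied k j \<tau>1 \<tau>2 ts" "modconj k (wd ss) (wd ts)"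
            "expsum X (wd ts) = expsum X (wd ss)" "length (wd ts) = length (wd ss)"
          using tied_reorder[OF ss _ j] by blast
        then have "represented k (wd ss) c"
          unfolding represented_def using sylls_Dbar 3
          by (intro exI[of _ "wd ts"] exI[of _ 0]) (auto simp: cost_def)
        then show False using not by blast
      next
        case False
        \<comment> \<open>The inserted 0 is the value in the absence of positive exponents; it keeps
          \<open>P + 1\<close> at least \<open>1\<close>, so that the window contains 0.\<close>
        define P where "P = Max (insert 0 (snd ` {s \<in> set ss. fst s = X}))"
        have fin: "finite (insert 0 (snd ` {s \<in> set ss. fst s = X}))" by simp
        have P0: "0 \<le> P" unfolding P_def by (rule Max_ge[OF fin]) simp
        have max: "a \<le> P" if "(X, a) \<in> set ss" for a
          unfolding P_def by (rule Max_ge[OF fin]) (use that in force)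
        have "P \<in> insert 0 (snd ` {s \<in> set ss. fst s = X})"
          unfolding P_def by (rule Max_in[OF fin]) simp
        then have "P = 0 \<or> (\<exists>s\<in>set ss. s = (X, P))" by (auto simp: prod_eq_iff)
        then have P: "P = 0 \<or> (X, P) \<in> set ss" by blast
        have "P < 2 * int k" using P upper 3 k by auto
        moreover have "P - 2 * int k < a" if "(X, a) \<in> set ss" for a
          using P
        proof
          assume "(X, P) \<in> set ss"
          then have "P - a \<noteq> 2 * int k" using False that by blast
          then show ?thesis using gap[OF \<open>(X, P) \<in> set ss\<close> that] by linarith
        qed (use lower[OF _ that] 3 in simp)
        ultimately have "x_window k c (P + 1) ss"
          using P0 max 3 unfolding x_window_def by force
        then show False using window not by blast
      qed
    qed
  qed
qed

text \<open>A word that is not reduced is shortened by cancellation. In a reduced word whose two end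
  syllables share a generator, these are merged cyclically. What remains is a cyclically reduced
  list, where the moves on exponents take over.\<close>

lemma all_represented:
  assumes k: "k \<ge> 1"
  shows "represented k w c"
proof (induction "nat (progress k w c)" arbitrary: w c rule: less_induct)
  case less
  have nonneg: "0 \<le> progress k v d" for v d using k by (simp add: progress_def)
  have IH: "represented k v d" if "progress k v d < progress k w c" for v d
    using less[of v d] that nonneg[of v d] by simp
  have shorter: "represented k w c" if "modconj k w v" "expsum X w = expsum X v" "length v < length w" for v
    by (rule represented_trans[OF IH that(1)]) (use that in \<open>auto simp: progress_def cost_def\<close>)
  have cyclic: "represented k w c"
    if "modconj k w (wd ss)" "expsum X w = expsum X (wd ss)" "length (wd ss) \<le> length w" "syl ss" "cyc ss" for ss
  proof -
    have "represented k (wd ss) c"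
      by (rule cyc_sylls_represented[OF k that(4,5)], rule IH) (use that(3) in \<open>simp add: progress_def\<close>)
    then show ?thesis
      by (rule represented_trans) (use that in \<open>auto simp: cost_def\<close>)
  qed
  show ?case
  proof (cases "\<exists>u a b v. w = u @ [(a, b), (a, \<not> b)] @ v")
    case True
    then obtain u a b v where w: "w = u @ [(a, b), (a, \<not> b)] @ v" by blast
    have "group_eq k w (u @ v)" unfolding w by (rule pres_eq.cancel)
    then show ?thesis
      using shorter[OF modconj_group_eq expsum_group_eq, of "u @ v"] by (simp add: w)
  next
    case False
    then obtain ss where ss: "syl ss" "wd ss = w" using sylls_or_cancel by blast
    show ?thesis
    proof (cases "cyc ss")
      case True
      then show ?thesis using cyclic[of ss] ss by simp
    next
      case False
      then obtain g m mid n where ss_eq: "ss = (g, m) # mid @ [(g, n)]"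
        by (cases ss; cases "tl ss" rule: rev_cases) (auto simp: cyc_def)
      have "mid \<noteq> []" using ss(1) by (auto simp: ss_eq syl_Cons)
      then have mid: "mid \<noteq> []" "fst (hd mid) \<noteq> g" "fst (last mid) \<noteq> g" "syl mid" "m \<noteq> 0" "n \<noteq> 0"
        using ss(1) by (auto simp: ss_eq syl_Cons syl_append)
      let ?v = "pw g (n + m) @ wd mid"
      have "modconj k w (pw g n @ pw g m @ wd mid)"
        using modconj_append_commute[of k "pw g m @ wd mid" "pw g n"] ss(2) by (simp add: ss_eq)
      also have "modconj k \<dots> ?v"
        using pres_eq_append_right[OF group_eq_pw_add[of k g n m], of "wd mid"]
        by (simp add: modconj_group_eq)
      finally have conj: "modconj k w ?v" .
      have exps: "expsum X w = expsum X ?v" using ss(2) by (auto simp: ss_eq)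
      have len: "length w = nat \<bar>m\<bar> + length (wd mid) + nat \<bar>n\<bar>" using ss(2) by (auto simp: ss_eq)
      \<comment> \<open>Equal signs merge the ends into a cyclically reduced list without
        lengthening the word; opposite signs cancel and shorten it.\<close>
      show ?thesis
      proof (cases "0 \<le> n * m")
        case True
        then have "n + m \<noteq> 0" using mid(5,6) by (auto simp: zero_le_mult_iff)
        then have "syl ((g, n + m) # mid)" "cyc ((g, n + m) # mid)"
          using mid by (auto simp: syl_Cons cyc_def)
        moreover have "nat \<bar>n + m\<bar> \<le> nat \<bar>m\<bar> + nat \<bar>n\<bar>" by arith
        ultimately show ?thesis using cyclic[of "(g, n + m) # mid"] conj exps len by auto
      next
        case False
        then have "\<bar>n + m\<bar> < \<bar>n\<bar> + \<bar>m\<bar>" by (auto simp: not_le mult_less_0_iff)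
        then have "nat \<bar>n + m\<bar> < nat \<bar>m\<bar> + nat \<bar>n\<bar>" by arith
        then have "length ?v < length w" using len by simp
        then show ?thesis using shorter conj exps by blast
      qed
    qed
  qed
qed

section \<open>Uniqueness and minimality\<close>

lemma Cbar_unique:
  assumes k: "k \<ge> 1" and u: "u \<in> Cbar k" and v: "v \<in> Cbar k"
    and conj: "modconj k (fst u) (fst v)"
    and sum: "expsum X (fst u) + 2 * int k * snd u = expsum X (fst v) + 2 * int k * snd v"
  shows "cyclic_perm u v"
proof -
  obtain ss \<theta> where ss: "syl ss" "cyc ss" "wd ss = fst u" "x_window k (snd u) \<theta> ss"
    using Cbar_sylls[OF u k] by blast
  obtain ts \<eta> where ts: "syl ts" "cyc ts" "wd ts = fst v" "x_window k (snd v) \<eta> ts"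
    using Cbar_sylls[OF v k] by blast
  obtain n where n: "map (red k) ts = map (red k) (rotate n ss)"
    using modconj_sylls_rotate[of ss ts k] ss ts conj x_window_small by metis
  have "rotate n ss = ts \<and> snd u = snd v"
    by (rule x_window_unique[OF n[symmetric], of "snd u" \<theta> "snd v" \<eta>])
      (use ss(3,4) ts(3,4) sum k in \<open>simp_all add: sum_list_map_rotate flip: expsum_X_wd\<close>)
  moreover have "\<exists>m. wd (rotate n ss) = rotate m (wd ss)"
  proof -
    let ?m = "n mod length ss"
    have "wd (rotate n ss) = rotate (length (wd (take ?m ss))) (wd (take ?m ss) @ wd (drop ?m ss))"
      by (subst rotate_append) (simp add: rotate_drop_take)
    then show ?thesis by (metis append_take_drop_id wd_simps(3))
  qed
  ultimately show ?thesis using ss(3) ts(3) by (auto simp: cyclic_perm_def)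
qed

lemma Cbar_Dbar_disjoint:
  assumes k: "k \<ge> 1" and u: "u \<in> Cbar k" and w: "w \<in> Dbar k" and conj: "modconj k (fst u) w"
    and sum: "expsum X (fst u) + 2 * int k * snd u = expsum X w"
  shows False
proof -
  obtain ss \<theta> where ss: "syl ss" "cyc ss" "wd ss = fst u" "x_window k (snd u) \<theta> ss"
    using Cbar_sylls[OF u k] by blast
  obtain ts j \<tau>1 \<tau>2 where ts: "syl ts" "cyc ts" "wd ts = w" "x_tied k j \<tau>1 \<tau>2 ts"
    using Dbar_sylls[OF w] by blast
  obtain n where n: "map (red k) ts = map (red k) (rotate n ss)"
    using modconj_sylls_rotate[of ss ts k] ss ts conj x_window_small x_tied_small by metis
  show False
    by (rule x_window_not_tied[OF n[symmetric], of "snd u" \<theta> j \<tau>1 \<tau>2])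
      (use ss(3,4) ts(3,4) sum in \<open>simp_all add: sum_list_map_rotate flip: expsum_X_wd\<close>)
qed

text \<open>By \<open>x_tied_unique\<close> the level and the numbers of ties are invariants of the
  class, so the second word is described with the parameters of the first.\<close>

lemma Dbar_aligned:
  assumes ss: "syl ss" "cyc ss" "x_tied k j \<tau>1 \<tau>2 ss" and w: "w \<in> Dbar k"
    and conj: "modconj k (wd ss) w" and sum: "expsum X (wd ss) = expsum X w"
  shows "\<exists>ts n. wd ts = w \<and> x_tied k j \<tau>1 \<tau>2 ts \<and> map (mark k j) ts = rotate n (map (mark k j) ss)"
proof -
  obtain ts j' \<sigma>1 \<sigma>2 where ts: "syl ts" "cyc ts" "wd ts = w" "x_tied k j' \<sigma>1 \<sigma>2 ts"
    using Dbar_sylls[OF w] by blast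
  obtain n where n: "map (red k) ts = map (red k) (rotate n ss)"
    using modconj_sylls_rotate[of ss ts k] ss ts conj x_tied_small by metis
  have "j' = j \<and> \<sigma>1 = \<tau>1 \<and> \<sigma>2 = \<tau>2 \<and> map (mark k j) ts = rotate n (map (mark k j) ss)"
    by (rule x_tied_unique[OF n ss(3) ts(4)]) (use ts(3) sum in \<open>simp flip: expsum_X_wd\<close>)
  then show ?thesis using ts by blast
qed

text \<open>\<open>sum_list_tied\<close> expresses the length by the marks, which agree up to
  rotation, and by the level and the numbers of ties, which are the same for both words.\<close>

lemma Dbar_length_eq:
  assumes "w \<in> Dbar k" "w' \<in> Dbar k" "modconj k w w'" "expsum X w = expsum X w'"
  shows "length w = length w'"
proof -
  obtain ss j \<tau>1 \<tau>2 where ss: "syl ss" "cyc ss" "wd ss = w" "x_tied k j \<tau>1 \<tau>2 ss"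
    using Dbar_sylls[OF assms(1)] by blast
  obtain ts n where ts: "wd ts = w'" "x_tied k j \<tau>1 \<tau>2 ts"
    and mark: "map (mark k j) ts = rotate n (map (mark k j) ss)"
    using Dbar_aligned[OF ss(1,2,4) assms(2)] assms(3,4) ss(3) by blast
  have "sum_list (map f ts) = sum_list (map f ss)" for f :: "syll \<Rightarrow> nat"
    unfolding sum_list_tied[OF ss(4), of f] sum_list_tied[OF ts(2), of f] mark sum_list_map_rotate ..
  then show ?thesis unfolding ss(3)[symmetric] ts(1)[symmetric] length_wd by (rule HOL.sym)
qed

section \<open>Minimality of the representatives\<close>

definition rep_word :: "nat \<Rightarrow> xyword \<Rightarrow> bool" where
  "rep_word k w \<longleftrightarrow> (\<exists>u\<in>Cbar k. w = expand k u) \<or> w \<in> Dbar k"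

abbreviation (input) conj_elts :: "nat \<Rightarrow> xyword \<Rightarrow> xyword \<Rightarrow> bool" where
  "conj_elts k u v \<equiv> conjugate_in (G4 k) (elt k u) (elt k v)"

lemma conj_elts_sym: "k \<ge> 1 \<Longrightarrow> conj_elts k u v \<Longrightarrow> conj_elts k v u"
  using modconj_sym by (auto simp: conjugate_iff_modconj)

lemma conj_elts_trans: "k \<ge> 1 \<Longrightarrow> conj_elts k u v \<Longrightarrow> conj_elts k v w \<Longrightarrow> conj_elts k u w"
  using modconj_trans by (auto simp: conjugate_iff_modconj)

lemma conj_elts_refl: "k \<ge> 1 \<Longrightarrow> conj_elts k u u"
  by (simp add: conjugate_iff_modconj)

lemma modconj_expand: "modconj k (expand k u) (fst u)"
  by (cases u) (simp add: expand_eq modconj_full_twist)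

lemma expsum_expand: "expsum X (expand k u) = expsum X (fst u) + 2 * int k * snd u"
  by (cases u) (simp add: expand_eq)

text \<open>The reduction starts from \<open>c = 0\<close>, where the cost is the length of
  \<open>w\<close>.\<close>

lemma rep_word_exists:
  assumes "k \<ge> 1"
  shows "\<exists>v. rep_word k v \<and> conj_elts k w v \<and> length v \<le> length w"
proof -
  obtain v d where v: "modconj k w v" "expsum X w = expsum X v + 2 * int k * d"
    "cost k v d \<le> cost k w 0" "(v, d) \<in> Cbar k \<or> d = 0 \<and> v \<in> Dbar k"
    using all_represented[OF assms, of w 0] by (auto simp: represented_def)
  have "modconj k w (expand k (v, d))"
    using modconj_trans[OF v(1) modconj_sym[OF modconj_full_twist]] by (simp add: expand_eq)
  moreover have "expsum X w = expsum X (expand k (v, d))" using v(2) by (simp add: expsum_expand)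
  moreover have "int (length (expand k (v, d))) \<le> int (length w)"
    using v(3) by (simp add: expand_eq cost_def)
  moreover have "rep_word k (expand k (v, d))"
    using v(4) unfolding rep_word_def by (elim disjE) (blast, simp add: expand_eq)
  ultimately show ?thesis using assms by (auto simp: conjugate_iff_modconj)
qed

lemma Cbar_conj_iff:
  assumes "k \<ge> 1" "u \<in> Cbar k" "v \<in> Cbar k"
  shows "conj_elts k (expand k u) (expand k v) \<longleftrightarrow> cyclic_perm u v"
proof
  assume "conj_elts k (expand k u) (expand k v)"
  then have "modconj k (expand k u) (expand k v)" "expsum X (expand k u) = expsum X (expand k v)"
    using assms(1) by (auto simp: conjugate_iff_modconj)
  then show "cyclic_perm u v"
    using Cbar_unique[OF assms] modconj_trans[OF modconj_sym[OF modconj_expand] modconj_trans[OF _ modconj_expand]]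
    by (simp add: expsum_expand)
next
  assume "cyclic_perm u v"
  then obtain n where n: "snd u = snd v" "fst v = rotate n (fst u)" by (auto simp: cyclic_perm_def)
  have "modconj k (fst u) (fst v)" unfolding n(2) by (rule modconj_rotate)
  then have "modconj k (expand k u) (expand k v)"
    using modconj_trans[OF modconj_expand modconj_trans[OF _ modconj_sym[OF modconj_expand]]] by blast
  moreover have "expsum X (fst v) = expsum X (fst u)"
    unfolding n(2) expsum_def by (rule sum_list_map_rotate)
  ultimately show "conj_elts k (expand k u) (expand k v)"
    using assms(1) n(1) by (simp add: conjugate_iff_modconj expsum_expand)
qed

lemma rep_word_length_eq:
  assumes k: "k \<ge> 1" and "rep_word k v" "rep_word k w" and conj: "conj_elts k v w"
  shows "length v = length w"
proof -
  have len: "length (expand k u) = length (expand k v)" if "cyclic_perm u v" for u v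
    using that by (cases u; cases v) (auto simp: cyclic_perm_def expand_eq)
  have mixed: False if "u \<in> Cbar k" "d \<in> Dbar k" "conj_elts k (expand k u) d" for u d
    using Cbar_Dbar_disjoint[OF k that(1,2)] that(3) k
      modconj_trans[OF modconj_sym[OF modconj_expand]]
    by (auto simp: conjugate_iff_modconj expsum_expand)
  consider u u' where "u \<in> Cbar k" "u' \<in> Cbar k" "v = expand k u" "w = expand k u'"
    | u where "u \<in> Cbar k" "v = expand k u" "w \<in> Dbar k"
    | u where "u \<in> Cbar k" "w = expand k u" "v \<in> Dbar k"
    | "v \<in> Dbar k" "w \<in> Dbar k"
    using assms(2,3) unfolding rep_word_def by blast
  then show ?thesis
  proof cases
    case 1
    then show ?thesis using Cbar_conj_iff[OF k] conj len by blast
  next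
    case 2
    then show ?thesis using mixed conj by blast
  next
    case 3
    then show ?thesis using mixed conj_elts_sym[OF k conj] by blast
  next
    case 4
    moreover have "modconj k v w" "expsum X v = expsum X w"
      using conj k by (simp_all add: conjugate_iff_modconj)
    ultimately show ?thesis by (rule Dbar_length_eq)
  qed
qed

text \<open>A competitor \<open>w\<close> reduces to a representative not longer than itself, which
  is conjugate to \<open>v\<close> and so has the length of \<open>v\<close>.\<close>

lemma rep_word_minimal:
  assumes "k \<ge> 1" "rep_word k v" "conj_elts k v w"
  shows "length v \<le> length w"
proof -
  obtain u where "rep_word k u" "conj_elts k w u" "length u \<le> length w"
    using rep_word_exists[OF assms(1)] by blast
  then show ?thesis
    using rep_word_length_eq[OF assms(1,2)] conj_elts_trans[OF assms(1,3)] by fastforce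
qed

lemma word_length_attained: "\<exists>w. elt k w = elt k v \<and> length w = word_length k (elt k v)"
  unfolding word_length_def by (rule LeastI_ex) blast

lemma rep_word_geodesic:
  assumes "k \<ge> 1" "rep_word k v"
  shows "geodesic k v"
proof -
  obtain w where w: "elt k w = elt k v" "length w = word_length k (elt k v)"
    using word_length_attained by blast
  have "conj_elts k v w" using w(1) conj_elts_refl[OF assms(1)] by simp
  from rep_word_minimal[OF assms this] have "length v \<le> word_length k (elt k v)" using w(2) by simp
  moreover have "word_length k (elt k v) \<le> length v"
    unfolding word_length_def by (rule Least_le) blast
  ultimately show ?thesis by (simp add: geodesic_def)
qed

lemma rep_word_conj_geodesic:
  assumes "k \<ge> 1" "rep_word k v"
  shows "conj_geodesic k v"
  unfolding conj_geodesic_def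
proof (rule Least_equality[symmetric])
  have "word_length k (elt k v) = length v"
    using rep_word_geodesic[OF assms] by (simp add: geodesic_def)
  then show "\<exists>h\<in>carrier (G4 k). conjugate_in (G4 k) (elt k v) h \<and> word_length k h = length v"
    using conj_elts_refl[OF assms(1)] by (intro bexI[of _ "elt k v"]) (auto simp: carrier_G4)
next
  fix n assume "\<exists>h\<in>carrier (G4 k). conjugate_in (G4 k) (elt k v) h \<and> word_length k h = n"
  then obtain w where w: "conj_elts k v w" "word_length k (elt k w) = n" by (auto simp: carrier_G4)
  obtain u where "elt k u = elt k w" "length u = n" using word_length_attained w(2) by blast
  then show "length v \<le> n" using rep_word_minimal[OF assms, of u] w(1) by simp
qed

section \<open>Split cyclic permutations and conjugacy\<close>

lemma split_cyclic_pos_conj: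
  assumes "k \<ge> 1" "split_cyclic_pos k w w'"
  shows "conj_elts k w w'"
proof -
  obtain j \<tau>1 \<tau>2 A where w: "w = type2_word k j \<tau>1 \<tau>2 A"
    and split: "split_case1 k j \<tau>1 \<tau>2 A w' \<or> split_case2 k j \<tau>1 \<tau>2 A w'"
    using assms(2) unfolding split_cyclic_pos_def by blast
  let ?\<tau> = "\<tau>1 + \<tau>2" and ?x = "xd k j \<tau>1"
  let ?fill = "fill id ?x 1"
  \<comment> \<open>Marked lists carry whole blocks here: \<open>seg a b\<close> lists the blocks
    from \<open>a\<close> to \<open>b - 1\<close>, each preceded by a tie. In both forms of split
    cyclic permutation the two words then decode \<open>U @ V\<close> and \<open>V @ U\<close> with
    the same powers of \<open>x\<close>, so that rotation invariance of \<open>fill\<close>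
    applies.\<close>
  define seg where "seg a b = concat (map (\<lambda>s. [None, Some (A s)]) [a..<b])" for a b
  have nones_seg: "nones (seg a b) = b - a" for a b
    by (induction b) (auto simp: seg_def Suc_diff_le)
  have fill_seg: "fill id x i (seg a b) = concat (map (\<lambda>s. x (i + s - a) @ A s) [a..<b])" for x i a b
    using nones_seg by (induction b) (auto simp: seg_def fill_append)
  have seg_append: "seg a b @ seg b c = seg a c" if "a \<le> b" "b \<le> c" for a b c
    unfolding seg_def using upt_add_eq_append[of a b "c - b"] that by simp
  have "\<exists>U V. w = ?fill (U @ V) \<and> w' = ?fill (V @ U)"
    using split
  proof
    assume "split_case1 k j \<tau>1 \<tau>2 A w'"
    then obtain t where t: "2 \<le> t" "t \<le> ?\<tau> + 1" and w': "w' = concat (map (\<lambda>s. ?x (s + 1 - t) @ A s) [t..<?\<tau> + 2]) @ A 1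
         @ concat (map (\<lambda>s. ?x (?\<tau> + 1 + s - t) @ A s) [2..<t])"
      unfolding split_case1_def Let_def by auto
    let ?U = "Some (A 1) # seg 2 t" and ?V = "seg t (?\<tau> + 2)"
    have "?U @ ?V = Some (A 1) # seg 2 (?\<tau> + 2)" using seg_append t by simp
    then have "w = ?fill (?U @ ?V)" by (simp add: w type2_word_eq fill_seg)
    moreover have "w' = ?fill (?V @ ?U)"
      unfolding w' using t by (simp add: fill_append fill_seg nones_seg add.commute)
    ultimately show ?thesis by blast
  next
    assume "split_case2 k j \<tau>1 \<tau>2 A w'"
    then obtain t P Q where t: "1 \<le> t" "t \<le> ?\<tau> + 1" and PQ: "A t = P @ Q" and
      w': "w' = Q @ concat (map (\<lambda>s. ?x (s - t) @ A s) [t + 1..<?\<tau> + 2]) @ (A(t := P)) 1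
         @ concat (map (\<lambda>s. ?x (?\<tau> + s - t) @ (A(t := P)) s) [2..<t + 1])"
      unfolding split_case2_def Let_def by auto
    let ?V = "Some Q # seg (t + 1) (?\<tau> + 2)"
    \<comment> \<open>The first block has no tie in front of it, so splitting it needs its own
      decomposition.\<close>
    show ?thesis
    proof (cases "t = 1")
      case True
      have "w = ?fill ([Some P] @ ?V)"
        using True PQ by (simp add: w type2_word_eq fill_seg numeral_2_eq_2)
      moreover have "w' = ?fill (?V @ [Some P])"
        using True by (simp add: w' fill_append fill_seg numeral_2_eq_2)
      ultimately show ?thesis by blast
    next
      case False
      then have t2: "2 \<le> t" using t by simp
      let ?U = "Some (A 1) # seg 2 t @ [None, Some P]"
      have "seg 2 (?\<tau> + 2) = seg 2 t @ [None, Some (A t)] @ seg (t + 1) (?\<tau> + 2)"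
        using seg_append[of 2 t "?\<tau> + 2"] seg_append[of t "t + 1" "?\<tau> + 2"] t t2 by (simp add: seg_def)
      moreover have "?fill (Some (A 1) # seg 2 (?\<tau> + 2)) = w" by (simp add: w type2_word_eq fill_seg)
      ultimately have "w = ?fill (?U @ ?V)" by (simp add: fill_append PQ)
      moreover have "w' = ?fill (?V @ ?U)"
      proof -
        have "concat (map (\<lambda>s. ?x (?\<tau> + s - t) @ (A(t := P)) s) [2..<t + 1]) =
          concat (map (\<lambda>s. ?x (?\<tau> + s - t) @ A s) [2..<t]) @ ?x ?\<tau> @ P"
          using t2 by simp (auto intro!: arg_cong[of _ _ concat])
        moreover have "Suc (\<tau>1 + \<tau>2 - Suc 0) = \<tau>1 + \<tau>2" using t t2 by simp
        ultimately show ?thesis unfolding w' using t t2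
          by (simp add: fill_append fill_seg nones_seg add.commute)
      qed
      ultimately show ?thesis by blast
    qed
  qed
  then obtain U V where UV: "w = ?fill (U @ V)" "w' = ?fill (V @ U)" by blast
  have VU: "V @ U = rotate (length U) (U @ V)" by (simp add: rotate_append)
  have "modconj k w w'"
    unfolding UV VU xd_eq by (rule modconj_fill_rotate[OF tie_exp_mod])
  moreover have "expsum X w = expsum X w'"
    unfolding UV VU xd_eq by (rule expsum_fill_rotate[symmetric])
  ultimately show ?thesis using assms(1) by (simp add: conjugate_iff_modconj)
qed

text \<open>A rotation of the marks cuts the marked list into \<open>U\<close> and \<open>V\<close>.
  With \<open>\<tau>U\<close> ties before the cut, it falls into block \<open>\<tau>U + 1\<close>,
  whose two pieces \<open>?P\<close> and \<open>?Q\<close> may be empty; hence the second form of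
  split cyclic permutation covers every rotation.\<close>

lemma tied_split_cyclic_pos:
  assumes k: "k \<ge> 1" and j: "int k \<le> j" and ss: "syl ss" "x_tied k j \<tau>1 \<tau>2 ss"
    and ts: "x_tied k j \<tau>1 \<tau>2 ts"
    and marks: "map (mark k j) ts = rotate n (map (mark k j) ss)" and w': "wd ts \<in> Dbar k"
  shows "split_cyclic_pos k (wd ss) (wd ts)"
proof -
  let ?x = "xd k j \<tau>1" and ?F = "\<lambda>C. concat (map pws C)"
  have tied: "j \<le> 2 * int k - 1" "\<tau>1 \<ge> 1" "\<tau>2 \<ge> 1"
    "\<forall>a. (X, a) \<in> set ss \<longrightarrow> j - 2 * int k \<le> a \<and> a \<le> j"
    "filter (\<lambda>s. red k s = (X, j)) ss = replicate \<tau>1 (X, j) @ replicate \<tau>2 (X, j - 2 * int k)"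
    "filter (\<lambda>s. red k s = (X, j)) ts = replicate \<tau>1 (X, j) @ replicate \<tau>2 (X, j - 2 * int k)"
    using ss(2) ts by (auto simp: x_tied_def)
  define M where "M = map (mark k j) ss"
  define U V where "U = take (n mod length M) M" and "V = drop (n mod length M) M"
  have UV: "M = U @ V" "map (mark k j) ts = V @ U"
    using marks by (simp_all add: U_def V_def M_def[symmetric] rotate_drop_take)
  define \<tau>U \<tau>V where "\<tau>U = nones U" and "\<tau>V = nones V"
  have \<tau>: "\<tau>1 + \<tau>2 = \<tau>U + \<tau>V"
    using wd_tied_fill(2)[OF tied(5)] UV(1) by (simp add: M_def \<tau>U_def \<tau>V_def)
  obtain C where C: "U = separated C \<tau>U" using separated_exists[of U] by (auto simp: \<tau>U_def)
  obtain D where D: "V = separated D \<tau>V" using separated_exists[of V] by (auto simp: \<tau>V_def)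
  define E where "E s = (if s \<le> \<tau>U then C s else if s = \<tau>U + 1 then C s @ D 1 else D (s - \<tau>U))" for s
  have E: "map (mark k j) ss = separated E (\<tau>1 + \<tau>2)"
    using UV(1) separated_append[of C \<tau>U D \<tau>V] by (simp add: M_def C D \<tau> E_def[abs_def])
  define A where "A s = wd (E s)" for s
  have blocks: "type2_blocks k j \<tau>1 \<tau>2 A"
    using tied_type2_blocks[OF ss(1) j tied(1,2,4) E] by (simp add: A_def[abs_def])
  have word: "wd ss = type2_word k j \<tau>1 \<tau>2 A"
    using tied_type2_word[OF tied(5) E] by (simp add: A_def[abs_def])
  let ?t = "\<tau>U + 1" and ?P = "wd (C (\<tau>U + 1))" and ?Q = "wd (D 1)"
  have F: "?F = wd" by (simp add: wd_def fun_eq_iff)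
  have w'_eq: "wd ts = wd (D 1) @ concat (map (\<lambda>s. ?x (s - 1) @ wd (D s)) [2..<\<tau>V + 2]) @
      wd (C 1) @ concat (map (\<lambda>s. ?x (\<tau>V + s - 1) @ wd (C s)) [2..<\<tau>U + 2])"
    using wd_tied_fill(1)[OF tied(6)] unfolding UV(2) fill_append C D fill_separated nones_separated F[THEN fun_cong]
    by simp
  have "split_case2 k j \<tau>1 \<tau>2 A (wd ts)"
    unfolding split_case2_def Let_def
  proof (rule bexI[of _ ?t], rule exI[of _ ?P], rule exI[of _ ?Q], rule conjI)
    show "A ?t = ?P @ ?Q" by (simp add: A_def E_def)
    show "?t \<in> {1..\<tau>1 + \<tau>2 + 1}" by (simp add: \<tau>)
    have shift: "[?t + 1..<\<tau>1 + \<tau>2 + 2] = map (\<lambda>s. s + \<tau>U) [2..<\<tau>V + 2]"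
      by (rule nth_equalityI) (simp_all add: \<tau> del: upt_Suc)
    have "concat (map (\<lambda>s. ?x (s - ?t) @ A s) [?t + 1..<\<tau>1 + \<tau>2 + 2]) =
        concat (map (\<lambda>s. ?x (s - 1) @ wd (D s)) [2..<\<tau>V + 2])"
      unfolding shift map_map by (rule arg_cong[of _ _ concat], rule map_cong) (auto simp: A_def E_def)
    moreover have "(A(?t := ?P)) 1 = wd (C 1)" by (auto simp: A_def E_def)
    moreover have "concat (map (\<lambda>s. ?x (\<tau>1 + \<tau>2 + s - ?t) @ (A(?t := ?P)) s) [2..<?t + 1]) =
        concat (map (\<lambda>s. ?x (\<tau>V + s - 1) @ wd (C s)) [2..<\<tau>U + 2])"
      by (rule arg_cong[of _ _ concat], rule map_cong) (auto simp: A_def E_def \<tau>)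
    ultimately show "wd ts = ?Q @ concat (map (\<lambda>s. ?x (s - ?t) @ A s) [?t + 1..<\<tau>1 + \<tau>2 + 2]) @
        (A(?t := ?P)) 1 @ concat (map (\<lambda>s. ?x (\<tau>1 + \<tau>2 + s - ?t) @ (A(?t := ?P)) s) [2..<?t + 1])"
      unfolding w'_eq by simp
  qed
  moreover have "geodesic k (wd ts)" using rep_word_geodesic[OF k] w' by (simp add: rep_word_def)
  moreover have "wd ts \<in> setD k" using w' by (simp add: Dbar_def)
  ultimately show ?thesis unfolding split_cyclic_pos_def using blocks word tied(3) by blast
qed

lemma cyc_inv_sylls: "cyc ss \<Longrightarrow> cyc (inv_sylls ss)"
  by (cases "ss = []") (auto simp: cyc_def inv_sylls_def hd_rev last_rev hd_map last_map case_prod_beta)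

lemma winv_Dbar:
  assumes "w \<in> Dbar k"
  shows "winv w \<in> Dbar k"
proof -
  obtain ss j \<tau>1 \<tau>2 where "syl ss" "cyc ss" "wd ss = w" "x_tied k j \<tau>1 \<tau>2 ss"
    using Dbar_sylls[OF assms] by blast
  then show ?thesis
    using sylls_Dbar[OF syl_inv_sylls cyc_inv_sylls x_tied_inv_sylls] wd_inv_sylls by metis
qed

text \<open>Levels \<open>j \<ge> k\<close> fit the definition directly. For smaller levels both
  words are inverted, which preserves conjugacy; these are the two alternatives in
  \<open>split_cyclic_perm\<close>.\<close>

lemma Dbar_conj_iff:
  assumes k: "k \<ge> 1" and w: "w \<in> Dbar k" "w' \<in> Dbar k"
  shows "conj_elts k w w' \<longleftrightarrow> split_cyclic_perm k w w'"
proof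
  assume conj: "conj_elts k w w'"
  have pos: "split_cyclic_pos k (wd ss) v"
    if "syl ss" "cyc ss" "x_tied k j \<tau>1 \<tau>2 ss" "int k \<le> j" "v \<in> Dbar k" "conj_elts k (wd ss) v"
    for ss j \<tau>1 \<tau>2 v
    using Dbar_aligned[OF that(1,2,3,5)] that(6) k tied_split_cyclic_pos[OF k that(4,1,3)] that(5)
    by (auto simp: conjugate_iff_modconj)
  obtain ss j \<tau>1 \<tau>2 where ss: "syl ss" "cyc ss" "wd ss = w" "x_tied k j \<tau>1 \<tau>2 ss"
    using Dbar_sylls[OF w(1)] by blast
  show "split_cyclic_perm k w w'"
  proof (cases "int k \<le> j")
    case True
    then show ?thesis using pos[OF ss(1,2,4) True w(2)] conj ss(3) by (simp add: split_cyclic_perm_def)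
  next
    case False
    have "split_cyclic_pos k (wd (inv_sylls ss)) (winv w')"
      by (rule pos[OF syl_inv_sylls[OF ss(1)] cyc_inv_sylls[OF ss(2)] x_tied_inv_sylls[OF ss(4)] _ winv_Dbar[OF w(2)]])
        (use False conjugate_winv[OF conj] ss(3) in \<open>simp_all add: wd_inv_sylls\<close>)
    then show ?thesis using ss(3) by (simp add: split_cyclic_perm_def wd_inv_sylls)
  qed
next
  assume "split_cyclic_perm k w w'"
  then consider "split_cyclic_pos k w w'" | "split_cyclic_pos k (winv w) (winv w')"
    unfolding split_cyclic_perm_def by blast
  then show "conj_elts k w w'"
  proof cases
    case 1
    then show ?thesis using split_cyclic_pos_conj k by blast
  next
    case 2
    then show ?thesis using conjugate_winv[OF split_cyclic_pos_conj[OF k 2]] by simp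
  qed
qed

theorem corollary4p8:
  fixes k :: nat
  assumes "k \<ge> 2"
  shows
    "((\<forall>u\<in>Cbar k. conj_geodesic k (expand k u)) \<and>
      (\<forall>u\<in>Cbar k. \<forall>v\<in>Cbar k.
         conjugate_in (G4 k) (elt k (expand k u)) (elt k (expand k v)) \<longleftrightarrow> cyclic_perm u v)) \<and>
     ((\<forall>w\<in>Dbar k. conj_geodesic k w) \<and>
      (\<forall>w\<in>Dbar k. \<forall>w'\<in>Dbar k.
         conjugate_in (G4 k) (elt k w) (elt k w') \<longleftrightarrow> split_cyclic_perm k w w')) \<and>
     (\<forall>g\<in>carrier (G4 k).
        (\<exists>u\<in>Cbar k. conjugate_in (G4 k) g (elt k (expand k u))) \<or>
        (\<exists>w\<in>Dbar k. conjugate_in (G4 k) g (elt k w)))"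
proof (intro conjI ballI)
  have k: "k \<ge> 1" using assms by simp
  show "conj_geodesic k (expand k u)" if "u \<in> Cbar k" for u
    using rep_word_conj_geodesic[OF k] that by (auto simp: rep_word_def)
  show "conj_elts k (expand k u) (expand k v) \<longleftrightarrow> cyclic_perm u v" if "u \<in> Cbar k" "v \<in> Cbar k" for u v
    using Cbar_conj_iff[OF k that] .
  show "conj_geodesic k w" if "w \<in> Dbar k" for w
    using rep_word_conj_geodesic[OF k] that by (auto simp: rep_word_def)
  show "conj_elts k w w' \<longleftrightarrow> split_cyclic_perm k w w'" if "w \<in> Dbar k" "w' \<in> Dbar k" for w w'
    using Dbar_conj_iff[OF k that] .
  show "(\<exists>u\<in>Cbar k. conjugate_in (G4 k) g (elt k (expand k u))) \<or>
        (\<exists>w\<in>Dbar k. conjugate_in (G4 k) g (elt k w))" if g: "g \<in> carrier (G4 k)" for g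
  proof -
    obtain v where "g = elt k v" using g by (auto simp: carrier_G4)
    moreover obtain w where "rep_word k w" "conj_elts k v w" using rep_word_exists[OF k] by blast
    ultimately show ?thesis unfolding rep_word_def by blast
  qed
qed

end
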